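(* (i) Let $\Lambda=(\lambda_1,\dots,\lambda_n)$ with $\lambda_i\in\mathbb{R}^k$ be a weakly hyperbolic configuration, let $Z=Z(\Lambda)\subset\mathbb{R}^n$, and let $Z'\subset\mathbb{R}^{n+1}$ (coordinates $x_0,x_1,\dots,x_n$) be the manifold given by $$\lambda_1(x_0^2+x_1^2)+\sum_{i>1}\lambda_i x_i^2=0,\qquad (x_0^2+x_1^2)+\sum_{i>1}x_i^2=1 .$$ Let $Z_+=Z\cap\{x_1\ge 0\}$ and $Z_0=Z\cap\{x_1=0\}$. Then $Z'$ is an open book with trivial monodromy, binding $Z_0$ and page $Z_+$. (ii) If $\mathcal{P}$ is a simple convex polytope and $F$ is one of its facets, there is an open book decomposition of $Z^{\mathbb{C}}(\mathcal{P})$ with binding $Z^{\mathbb{C}}(F)$ and trivial monodromy.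
   Context: For $\Lambda=(\lambda_1,\dots,\lambda_n)$, $\lambda_i\in\mathbb{R}^k$, weak hyperbolicity means: if $J\subset\{1,\dots,n\}$ has $k$ or fewer elements then the origin is not in the convex hull of the $\lambda_i$ with $i\in J$. This is always assumed, and it is equivalent to smoothness (transversality) of $$Z(\Lambda)=\Big\{x\in\mathbb{R}^n:\ \sum_{i=1}^n\lambda_i x_i^2=0,\ \sum_{i=1}^n x_i^2=1\Big\}.$$ The complex version (moment-angle manifold) is $$Z^{\mathbb{C}}(\Lambda)=\Big\{z\in\mathbb{C}^n:\ \sum_{i=1}^n\lambda_i |z_i|^2=0,\ \sum_{i=1}^n |z_i|^2=1\Big\}.$$ The associated polytope is $$\mathcal{P}=\Big\{r\in\mathbb{R}^n:\ \sum_{i=1}^n\lambda_i r_i=0,\ \sum_{i=1}^n r_i=1,\ r_i\ge 0\Big\};$$ it is simple, every simple polytope can be realized in this way, and one writes $Z^{\mathbb{C}}(\mathcal{P})=Z^{\mathbb{C}}(\Lambda)$. The facets of $\mathcal{P}$ are its non-empty intersections with the coordinate hyperplanes $r_i=0$. If $F=\mathcal{P}\cap\{r_i=0\}$ is a facet, $Z^{\mathbb{C}}(F)$ denotes the moment-angle manifold of the configuration obtained from $\Lambda$ by removing $\lambda_i$, i.e. $Z^{\mathbb{C}}(\Lambda)\cap\{z_i=0\}$. $Z_+$ is a manifold with boundary $Z_0$; $Z_0$ is regarded as a submanifold of $Z'$ as $Z'\cap\{x_0=x_1=0\}$, and $Z_+$ as $Z'\cap\{x_0=0,\ x_1\ge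 0\}$. An open book decomposition of a closed manifold $M$ consists of a closed codimension-2 submanifold $B$ (the binding, possibly empty) with trivial normal bundle, and a smooth locally trivial fibration $\pi:M\setminus B\to\mathbb{S}^1$ which on a tubular neighbourhood $B\times\mathbb{D}^2$ of $B$ is the angular coordinate of the $\mathbb{D}^2$ factor. The pages are the closures of the fibres of $\pi$ (manifolds with boundary $B$). The monodromy is trivial if, for a page $W$, $M$ is obtained as $(W\times\mathbb{S}^1)\cup(\partial W\times\mathbb{D}^2)$, i.e. the open book is the one associated with the identity map of $W$. *)

theory Defs
  imports "HOL-Analysis.Analysis"
begin

section \<open>Smooth maps and manifolds in Euclidean space\<close>

text \<open>Meant for open \<open>U\<close>. Iterated directional derivatives suffice for \<open>C\<^sup>k\<close> because the
  domain is finite-dimensional.\<close>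

primrec Ck_on :: "nat \<Rightarrow> 'a::euclidean_space set \<Rightarrow> ('a \<Rightarrow> 'b::euclidean_space) \<Rightarrow> bool" where
  "Ck_on 0 U f \<longleftrightarrow> continuous_on U f"
| "Ck_on (Suc k) U f \<longleftrightarrow>
     (\<forall>x\<in>U. f differentiable (at x)) \<and> (\<forall>v. Ck_on k U (\<lambda>x. frechet_derivative f (at x) v))"

text \<open>On an arbitrary subset of Euclidean space, a map is smooth if it extends locally to a
  \<open>C\<^sup>\<infinity>\<close> map on an open set. This also covers manifolds with boundary and products such as
  \<open>W \<times> S\<^sup>1\<close>.\<close>

definition smooth_map :: "'a::euclidean_space set \<Rightarrow> ('a \<Rightarrow> 'b::euclidean_space) \<Rightarrow> bool" where
  "smooth_map X f \<longleftrightarrow>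
     (\<forall>x\<in>X. \<exists>U g. open U \<and> x \<in> U \<and> (\<forall>k. Ck_on k U g) \<and> (\<forall>y\<in>U \<inter> X. g y = f y))"

definition diffeo ::
    "'a::euclidean_space set \<Rightarrow> 'b::euclidean_space set \<Rightarrow> ('a \<Rightarrow> 'b) \<Rightarrow> bool" where
  "diffeo X Y f \<longleftrightarrow> bij_betw f X Y \<and> smooth_map X f \<and> smooth_map Y (inv_into X f)"

text \<open>The model space \<open>R\<^sup>d\<close> of a chart is a \<open>d\<close>-dimensional linear subspace \<open>T\<close> of the ambient
  space, and the model half-space is the part of \<open>T\<close> on which \<open>e\<close> is nonnegative.\<close>

definition interior_point :: "nat \<Rightarrow> 'a::euclidean_space set \<Rightarrow> 'a \<Rightarrow> bool" where
  "interior_point d M x \<longleftrightarrow>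
     (\<exists>(T::'a set) U V f. subspace T \<and> dim T = d \<and>
        openin (top_of_set M) U \<and> x \<in> U \<and> openin (top_of_set T) V \<and> diffeo U V f)"

definition boundary_point :: "nat \<Rightarrow> 'a::euclidean_space set \<Rightarrow> 'a \<Rightarrow> bool" where
  "boundary_point d M x \<longleftrightarrow>
     (\<exists>(T::'a set) e U V f. subspace T \<and> dim T = d \<and> e \<in> T \<and> e \<noteq> 0 \<and>
        openin (top_of_set M) U \<and> x \<in> U \<and>
        openin (top_of_set (T \<inter> {y. 0 \<le> e \<bullet> y})) V \<and> diffeo U V f \<and> e \<bullet> f x = 0)"

definition closed_manifold :: "nat \<Rightarrow> 'a::euclidean_space set \<Rightarrow> bool" where
  "closed_manifold d M \<longleftrightarrow> compact M \<and> (\<forall>x\<in>M. interior_point d M x)"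

definition manifold_with_boundary :: "nat \<Rightarrow> 'a::euclidean_space set \<Rightarrow> bool" where
  "manifold_with_boundary d M \<longleftrightarrow> (\<forall>x\<in>M. interior_point d M x \<or> boundary_point d M x)"

definition manifold_boundary :: "nat \<Rightarrow> 'a::euclidean_space set \<Rightarrow> 'a set" where
  "manifold_boundary d M = {x \<in> M. boundary_point d M x}"

definition tangent_space :: "'a::euclidean_space set \<Rightarrow> 'a \<Rightarrow> 'a set" where
  "tangent_space M x =
     {v. \<exists>\<gamma> \<epsilon>. 0 < \<epsilon> \<and> smooth_map {-\<epsilon><..<\<epsilon>::real} \<gamma> \<and> \<gamma> ` {-\<epsilon><..<\<epsilon>} \<subseteq> M \<and>
        \<gamma> 0 = x \<and> (\<gamma> has_vector_derivative v) (at 0)}"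

text \<open>Triviality of the rank 2 normal bundle \<open>TM|\<^sub>B / TB\<close>: two smooth fields along \<open>B\<close> whose
  classes form a basis of each fibre.\<close>

definition trivial_normal_bundle2 :: "'a::euclidean_space set \<Rightarrow> 'a set \<Rightarrow> bool" where
  "trivial_normal_bundle2 M B \<longleftrightarrow>
     (\<exists>u v. smooth_map B u \<and> smooth_map B v \<and>
        (\<forall>b\<in>B. tangent_space M b =
                  {t + \<alpha> *\<^sub>R u b + \<beta> *\<^sub>R v b | t \<alpha> \<beta>. t \<in> tangent_space B b} \<and>
               (\<forall>\<alpha> \<beta>. \<alpha> *\<^sub>R u b + \<beta> *\<^sub>R v b \<in> tangent_space B b \<longrightarrow> \<alpha> = 0 \<and> \<beta> = 0)))"


section \<open>Open books\<close>

abbreviation S1 :: "complex set" where "S1 \<equiv> sphere 0 1"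
abbreviation D2 :: "complex set" where "D2 \<equiv> cball 0 1"

definition fibre :: "'a set \<Rightarrow> ('a \<Rightarrow> complex) \<Rightarrow> complex set \<Rightarrow> 'a set" where
  "fibre E \<pi> J = {x \<in> E. \<pi> x \<in> J}"

definition smooth_fibration_S1 :: "'a::euclidean_space set \<Rightarrow> ('a \<Rightarrow> complex) \<Rightarrow> bool" where
  "smooth_fibration_S1 E \<pi> \<longleftrightarrow> smooth_map E \<pi> \<and> \<pi> ` E \<subseteq> S1 \<and>
     (\<forall>\<theta>\<in>S1. \<exists>J h. openin (top_of_set S1) J \<and> \<theta> \<in> J \<and>
        diffeo (fibre E \<pi> J) (J \<times> fibre E \<pi> {\<theta>}) h \<and> (\<forall>x\<in>fibre E \<pi> J. fst (h x) = \<pi> x))"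

definition page :: "'a::euclidean_space set \<Rightarrow> 'a set \<Rightarrow> ('a \<Rightarrow> complex) \<Rightarrow> complex \<Rightarrow> 'a set" where
  "page M B \<pi> \<theta> = closure (fibre (M - B) \<pi> {\<theta>})"

text \<open>Here \<open>sgn z = z / |z|\<close> is the angular coordinate of \<open>z \<noteq> 0\<close>. An empty binding is
  treated separately because \<open>M\<close> may then be 1-dimensional.\<close>

definition tubular_angular ::
    "'a::euclidean_space set \<Rightarrow> 'a set \<Rightarrow> ('a \<Rightarrow> complex) \<Rightarrow> ('a \<times> complex \<Rightarrow> 'a) \<Rightarrow> 'a set \<Rightarrow> bool" where
  "tubular_angular M B \<pi> \<tau> N \<longleftrightarrow> N \<subseteq> M \<and> diffeo (B \<times> D2) N \<tau> \<and>
     (\<exists>O'. openin (top_of_set M) O' \<and> B \<subseteq> O' \<and> O' \<subseteq> N) \<and>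
     (\<forall>b\<in>B. \<tau> (b, 0) = b) \<and> (\<forall>b\<in>B. \<forall>z\<in>D2 - {0}. \<pi> (\<tau> (b, z)) = sgn z)"

definition open_book ::
    "nat \<Rightarrow> 'a::euclidean_space set \<Rightarrow> 'a set \<Rightarrow> ('a \<Rightarrow> complex) \<Rightarrow> bool" where
  "open_book d M B \<pi> \<longleftrightarrow>
     closed_manifold (Suc d) M \<and> B \<subseteq> M \<and>
     (B = {} \<or> (\<exists>c. d = Suc c \<and> closed_manifold c B)) \<and>
     trivial_normal_bundle2 M B \<and>
     smooth_fibration_S1 (M - B) \<pi> \<and>
     (\<exists>\<tau> N. tubular_angular M B \<pi> \<tau> N) \<and>
     (\<forall>\<theta>\<in>S1. manifold_with_boundary d (page M B \<pi> \<theta>) \<and>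
              manifold_boundary d (page M B \<pi> \<theta>) = B)"

text \<open>\<open>M\<close> is \<open>W \<times> S\<^sup>1\<close> and \<open>\<partial>W \<times> D\<^sup>2\<close> glued along \<open>\<partial>W \<times> S\<^sup>1\<close> by the identity, compatibly with
  the projection to the circle; \<open>\<Phi>\<close> and \<open>\<tau>\<close> are the inclusions of the two pieces. As a subset of
  \<open>M\<close>, the slice \<open>\<Phi> (W \<times> {\<theta>})\<close> is a page with a collar of its boundary removed.\<close>

definition trivial_monodromy ::
    "nat \<Rightarrow> 'a::euclidean_space set \<Rightarrow> 'a set \<Rightarrow> ('a \<Rightarrow> complex) \<Rightarrow> 'a set \<Rightarrow> bool" where
  "trivial_monodromy d M B \<pi> W \<longleftrightarrow>
     (\<exists>\<Phi> \<tau> M1 M2.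
        diffeo (W \<times> S1) M1 \<Phi> \<and>
        tubular_angular M (manifold_boundary d W) \<pi> \<tau> M2 \<and>
        M = M1 \<union> M2 \<and>
        M1 \<inter> M2 = \<Phi> ` (manifold_boundary d W \<times> S1) \<and>
        (\<forall>b\<in>manifold_boundary d W. \<forall>\<theta>\<in>S1. \<Phi> (b, \<theta>) = \<tau> (b, \<theta>)) \<and>
        (\<forall>w\<in>W. \<forall>\<theta>\<in>S1. \<pi> (\<Phi> (w, \<theta>)) = \<theta>))"

definition open_book_trivial_monodromy ::
    "'a::euclidean_space set \<Rightarrow> 'a set \<Rightarrow> 'a set \<Rightarrow> bool" where
  "open_book_trivial_monodromy M B W \<longleftrightarrow>
     (\<exists>d \<pi>. open_book d M B \<pi> \<and> (\<exists>\<theta>\<in>S1. W = page M B \<pi> \<theta>) \<and> trivial_monodromy d M B \<pi> W)"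


section \<open>Intersections of quadrics\<close>

text \<open>The role of \<open>R\<^sup>k\<close> is played by a linear subspace \<open>E\<close> of dimension \<open>k\<close> of a Euclidean space.
  With \<open>E = UNIV\<close> in \<open>real ^ 'k\<close> this is the usual setting; \<open>E = {0}\<close> gives \<open>k = 0\<close>, which is
  needed for spheres and simplices. The family may have repetitions, so \<open>J\<close> ranges over index
  sets.\<close>

definition weakly_hyperbolic ::
    "'v::euclidean_space set \<Rightarrow> ('n::finite \<Rightarrow> 'v) \<Rightarrow> bool" where
  "weakly_hyperbolic E \<Lambda> \<longleftrightarrow> subspace E \<and> range \<Lambda> \<subseteq> E \<and>
     (\<forall>J. card J \<le> dim E \<longrightarrow> 0 \<notin> convex hull (\<Lambda> ` J))"

definition Z_real :: "('n::finite \<Rightarrow> 'v::euclidean_space) \<Rightarrow> (real ^ 'n) set" where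
  "Z_real \<Lambda> = {x. (\<Sum>i\<in>UNIV. (x $ i)\<^sup>2 *\<^sub>R \<Lambda> i) = 0 \<and> (\<Sum>i\<in>UNIV. (x $ i)\<^sup>2) = 1}"

definition Z_complex :: "('n::finite \<Rightarrow> 'v::euclidean_space) \<Rightarrow> (complex ^ 'n) set" where
  "Z_complex \<Lambda> =
     {z. (\<Sum>i\<in>UNIV. (cmod (z $ i))\<^sup>2 *\<^sub>R \<Lambda> i) = 0 \<and> (\<Sum>i\<in>UNIV. (cmod (z $ i))\<^sup>2) = 1}"

text \<open>The coordinates \<open>(x\<^sub>0, x\<^sub>1, \<dots>, x\<^sub>n)\<close> are written as a pair \<open>(x0, x)\<close>. The index whose
  coefficient is doubled (1 in the usual numbering) is a parameter \<open>j\<close>.\<close>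

definition Z_doubled ::
    "('n::finite \<Rightarrow> 'v::euclidean_space) \<Rightarrow> 'n \<Rightarrow> (real \<times> (real ^ 'n)) set" where
  "Z_doubled \<Lambda> j =
     {(x0, x). (x0\<^sup>2 + (x $ j)\<^sup>2) *\<^sub>R \<Lambda> j + (\<Sum>i\<in>UNIV - {j}. (x $ i)\<^sup>2 *\<^sub>R \<Lambda> i) = 0 \<and>
               (x0\<^sup>2 + (x $ j)\<^sup>2) + (\<Sum>i\<in>UNIV - {j}. (x $ i)\<^sup>2) = 1}"

definition Z_plus :: "('n::finite \<Rightarrow> 'v::euclidean_space) \<Rightarrow> 'n \<Rightarrow> (real ^ 'n) set" where
  "Z_plus \<Lambda> j = Z_real \<Lambda> \<inter> {x. 0 \<le> x $ j}"

definition Z_zero :: "('n::finite \<Rightarrow> 'v::euclidean_space) \<Rightarrow> 'n \<Rightarrow> (real ^ 'n) set" where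
  "Z_zero \<Lambda> j = Z_real \<Lambda> \<inter> {x. x $ j = 0}"

definition assoc_polytope :: "('n::finite \<Rightarrow> 'v::euclidean_space) \<Rightarrow> (real ^ 'n) set" where
  "assoc_polytope \<Lambda> =
     {r. (\<Sum>i\<in>UNIV. r $ i *\<^sub>R \<Lambda> i) = 0 \<and> (\<Sum>i\<in>UNIV. r $ i) = 1 \<and> (\<forall>i. 0 \<le> r $ i)}"

definition simple_polytope :: "'d::euclidean_space set \<Rightarrow> bool" where
  "simple_polytope P \<longleftrightarrow> polytope P \<and>
     (\<forall>v. v extreme_point_of P \<longrightarrow> int (card {G. G facet_of P \<and> v \<in> G}) = aff_dim P)"

definition realizes ::
    "('n::finite \<Rightarrow> 'v::euclidean_space) \<Rightarrow> ('d::euclidean_space \<Rightarrow> real ^ 'n) \<Rightarrow> 'd set \<Rightarrow> bool" where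
  "realizes \<Lambda> \<phi> P \<longleftrightarrow>
     (\<exists>A c. linear A \<and> (\<forall>x. \<phi> x = A x + c)) \<and> inj_on \<phi> P \<and> \<phi> ` P = assoc_polytope \<Lambda>"

end

theory Submission
  imports Defs
begin

text \<open>Both parts are instances of one statement about an intersection of quadrics with a rotational
symmetry. Let \<open>M\<close> be the set of all \<open>x\<close> with \<open>(\<Sum>b\<in>Basis. (x \<bullet> b)\<^sup>2 *\<^sub>R \<nu> b) = c0\<close>, and let \<open>p\<close> and \<open>q\<close>
be two basis vectors with \<open>\<nu> p = \<nu> q\<close>. The circle acts on \<open>M\<close> by rotating the plane of \<open>p\<close> and \<open>q\<close>.
The coordinates \<open>x \<bullet> q\<close> and \<open>x \<bullet> p\<close> form an equivariant map \<open>P\<close> from \<open>M\<close> to the complex numbers; its zero set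
\<open>B\<close> is the set of fixed points, and every orbit outside \<open>B\<close> meets the half \<open>W\<close>, given by
\<open>x \<bullet> p = 0\<close> and \<open>0 \<le> x \<bullet> q\<close>, exactly once. So the angle of \<open>P\<close> is a trivial fibration of \<open>M - B\<close> over the circle
whose fibres are copies of \<open>W - B\<close>. For the manifold with a doubled real coordinate, \<open>p\<close> and \<open>q\<close>
are the axes of \<open>x\<^sub>0\<close> and \<open>x\<^sub>1\<close>; for the moment-angle manifold, they are the imaginary and the real
axis of the coordinate \<open>z\<^sub>i\<close>.

Weak hyperbolicity is used in a single form: the vectors \<open>\<nu> b\<close> with \<open>b\<close> in the support of a point of
\<open>M\<close> span the same space as all \<open>\<nu> b\<close> (\<open>weakly_hyperbolic_spanning\<close>). Three consequences carry the
proof.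

First, charts are explicit. The equations are linear in the squares of the coordinates, so one can
select a set \<open>K\<close> in the support of a given point and express the squares of the coordinates in \<open>K\<close> as
affine functions of the remaining squares. Near the point the signs are constant, and \<open>M\<close> is a graph
over the other coordinates (\<open>local_section\<close>). This yields the manifold structures, the
tangent spaces and the boundary of \<open>W\<close>.

Second, there is an explicit collar. To move a point \<open>x\<close> with \<open>P x = z\<close>, whose remaining coordinates
form a point of \<open>B\<close>, into \<open>M\<close>, the contribution \<open>\<bar>z\<bar>\<^sup>2 \<nu> q\<close> of the new coordinates has to be compensated.
A weighted least squares solution \<open>\<eta> x\<close> of a linear system does this by rescaling each of the other coordinates,
which defines a smooth map \<open>T\<close> of a neighbourhood of \<open>B\<close> (\<open>QH_T\<close>). It fixes the points
with \<open>P x = 0\<close> and commutes with the rotation. The inverse function theorem near the compact set \<open>B\<close>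
turns it into a tube \<open>B \<times> D\<^sup>2\<close> (\<open>tube_coordinates\<close>).

Third, in collar coordinates \<open>(b, t)\<close> the page can be pushed away from its boundary by replacing \<open>t\<close>
with \<open>\<phi> t\<close>, where \<open>\<phi>\<close> maps \<open>[0, \<infinity>)\<close> onto \<open>[\<epsilon>, \<infinity>)\<close> and is the identity far out (\<open>half_line_push\<close>,
\<open>push\<close>). Rotating the pushed page fills the part of \<open>M\<close> where \<open>\<bar>P x\<bar> \<ge> \<epsilon>\<close>, the tube fills
the rest, and both parametrizations agree on \<open>B \<times> S\<^sup>1\<close> because \<open>T\<close> commutes with the rotation.\<close>

section \<open>Continuously differentiable maps\<close>

lemma Ck_on_cong:
  assumes "open U" "\<And>x. x \<in> U \<Longrightarrow> f x = g x" "Ck_on k U f"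
  shows "Ck_on k U g"
  using assms(2,3)
proof (induction k arbitrary: f g)
  case 0
  then show ?case by (simp cong: continuous_on_cong)
next
  case (Suc k)
  have D: "(g has_derivative frechet_derivative f (at x)) (at x)" if "x \<in> U" for x
    by (rule has_derivative_transform_within_open[where f = f, OF _ \<open>open U\<close> that])
      (use Suc.prems that in \<open>auto simp: frechet_derivative_works\<close>)
  then have "frechet_derivative f (at x) = frechet_derivative g (at x)" if "x \<in> U" for x
    using that frechet_derivative_at by blast
  then have "Ck_on k U (\<lambda>x. frechet_derivative g (at x) v)" for v
    using Suc.IH[of "\<lambda>x. frechet_derivative f (at x) v" "\<lambda>x. frechet_derivative g (at x) v"] Suc.prems
    by auto
  then show ?case using D by (auto simp: differentiable_def)
qed

text \<open>This makes the usual differentiation rules applicable: any derivative known on \<open>U\<close> may replace the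
Frechet derivative operator.\<close>

lemma Ck_on_SucI:
  assumes "open U" "\<And>x. x \<in> U \<Longrightarrow> (f has_derivative f' x) (at x)"
    "\<And>v. Ck_on k U (\<lambda>x. f' x v)"
  shows "Ck_on (Suc k) U f"
proof -
  have "f' x = frechet_derivative f (at x)" if "x \<in> U" for x
    using assms(2)[OF that] frechet_derivative_at by blast
  then have "Ck_on k U (\<lambda>x. frechet_derivative f (at x) v)" for v
    using Ck_on_cong[OF assms(1) _ assms(3)] by auto
  then show ?thesis using assms(2) by (auto simp: differentiable_def)
qed

lemma Ck_on_derivative:
  assumes "Ck_on (Suc k) U f" "x \<in> U"
  shows "(f has_derivative frechet_derivative f (at x)) (at x)"
  using assms frechet_derivative_works by auto

lemma Ck_on_continuous: "Ck_on k U f \<Longrightarrow> continuous_on U f"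
  by (cases k) (auto intro!: continuous_at_imp_continuous_on differentiable_imp_continuous_within)

lemma Ck_on_lower: "Ck_on (Suc k) U f \<Longrightarrow> Ck_on k U f"
proof (induction k arbitrary: f)
  case 0
  then show ?case using Ck_on_continuous[of "Suc 0" U f] by simp
next
  case (Suc k)
  then show ?case by (metis Ck_on.simps(2))
qed

lemma Ck_on_subset: "Ck_on k U f \<Longrightarrow> V \<subseteq> U \<Longrightarrow> Ck_on k V f"
proof (induction k arbitrary: f)
  case 0
  then show ?case using continuous_on_subset by auto
next
  case (Suc k)
  then show ?case by auto
qed

lemma Ck_on_local:
  assumes "\<And>x. x \<in> U \<Longrightarrow> \<exists>V. open V \<and> x \<in> V \<and> Ck_on k V f"
  shows "Ck_on k U f"
  using assms
proof (induction k arbitrary: f)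
  case 0
  then show ?case
    by (metis Ck_on.simps(1) continuous_at_imp_continuous_on continuous_on_eq_continuous_at)
next
  case (Suc k)
  have "Ck_on k U (\<lambda>x. frechet_derivative f (at x) v)" for v
    by (rule Suc.IH) (use Suc.prems in \<open>force\<close>)
  then show ?case using Suc.prems by force
qed

lemma Ck_on_const: "Ck_on k U (\<lambda>x. c)"
proof (induction k arbitrary: c)
  case (Suc k)
  have "frechet_derivative (\<lambda>x. c) (at x) = (\<lambda>v. 0)" for x :: 'a
    by (simp add: frechet_derivative_const)
  then show ?case using Suc by auto
qed auto

lemma Ck_on_bounded_linear:
  assumes "bounded_linear L" "open U" "Ck_on k U f"
  shows "Ck_on k U (\<lambda>x. L (f x))"
  using assms(3)
proof (induction k arbitrary: f)
  case 0
  then show ?case using bounded_linear.continuous_on[OF assms(1)] by auto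
next
  case (Suc k)
  show ?case
  proof (rule Ck_on_SucI[OF assms(2)])
    show "((\<lambda>x. L (f x)) has_derivative (\<lambda>v. L (frechet_derivative f (at x) v))) (at x)" if "x \<in> U" for x
      using bounded_linear.has_derivative[OF assms(1) Ck_on_derivative[OF Suc.prems that]] .
    show "Ck_on k U (\<lambda>x. L (frechet_derivative f (at x) v))" for v
      using Suc by auto
  qed
qed

lemma Ck_on_linear: "bounded_linear L \<Longrightarrow> Ck_on k U L"
proof (cases k)
  case 0
  then show "bounded_linear L \<Longrightarrow> Ck_on k U L" 
    by (simp add: linear_continuous_on)
next
  case (Suc j)
  assume L: "bounded_linear L"
  have "frechet_derivative L (at x) = L" for x
    using bounded_linear_imp_has_derivative[OF L] frechet_derivative_at by metis
  then show ?thesis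
    using Suc L Ck_on_const by (auto simp: bounded_linear_imp_differentiable)
qed

lemma Ck_on_add:
  assumes "open U" "Ck_on k U f" "Ck_on k U g"
  shows "Ck_on k U (\<lambda>x. f x + g x)"
  using assms(2,3)
proof (induction k arbitrary: f g)
  case 0
  then show ?case by (auto intro: continuous_intros)
next
  case (Suc k)
  show ?case
  proof (rule Ck_on_SucI[OF assms(1)])
    show "((\<lambda>x. f x + g x) has_derivative
       (\<lambda>v. frechet_derivative f (at x) v + frechet_derivative g (at x) v)) (at x)" if "x \<in> U" for x
      by (intro has_derivative_add Ck_on_derivative[OF _ that]) (use Suc.prems in auto)
  qed (use Suc in auto)
qed

lemma Ck_on_sum:
  assumes "open U" "\<And>i. i \<in> I \<Longrightarrow> Ck_on k U (f i)"
  shows "Ck_on k U (\<lambda>x. \<Sum>i\<in>I. f i x)"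
  using assms(2)
  by (induction I rule: infinite_finite_induct) (auto intro: Ck_on_const Ck_on_add[OF assms(1)])

lemma Ck_on_bilinear:
  assumes "bounded_bilinear prd" "open U" "Ck_on k U f" "Ck_on k U g"
  shows "Ck_on k U (\<lambda>x. prd (f x) (g x))"
  using assms(3,4)
proof (induction k arbitrary: f g)
  case 0
  then show ?case using bounded_bilinear.continuous_on[OF assms(1)] by auto
next
  case (Suc k)
  show ?case
  proof (rule Ck_on_SucI[OF assms(2)])
    show "((\<lambda>x. prd (f x) (g x)) has_derivative
       (\<lambda>v. prd (f x) (frechet_derivative g (at x) v) + prd (frechet_derivative f (at x) v) (g x))) (at x)"
      if "x \<in> U" for x
      by (intro bounded_bilinear.FDERIV[OF assms(1)] Ck_on_derivative[OF _ that]) (use Suc.prems in auto)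
    show "Ck_on k U (\<lambda>x. prd (f x) (frechet_derivative g (at x) v)
        + prd (frechet_derivative f (at x) v) (g x))" for v
      by (intro Ck_on_add[OF assms(2)] Suc.IH) (use Suc.prems Ck_on_lower in auto)
  qed
qed

lemma linear_sum_Basis:
  fixes L :: "'a::euclidean_space \<Rightarrow> 'b::real_vector"
  assumes "linear L"
  shows "L u = (\<Sum>b\<in>Basis. (u \<bullet> b) *\<^sub>R L b)"
proof -
  have "L u = L (\<Sum>b\<in>Basis. (u \<bullet> b) *\<^sub>R b)" by (simp add: euclidean_representation)
  also have "\<dots> = (\<Sum>b\<in>Basis. (u \<bullet> b) *\<^sub>R L b)"
    by (simp only: linear_sum[OF assms] linear_cmul[OF assms])
  finally show ?thesis .
qed

text \<open>In coordinates, the chain rule expresses the derivative of the composite as a sum of products of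
functions to which the induction hypothesis applies.\<close>

lemma Ck_on_compose:
  assumes "open U" "open V" "Ck_on k U f" "Ck_on k V g" "f ` U \<subseteq> V"
  shows "Ck_on k U (\<lambda>x. g (f x))"
  using assms(3,4,5)
proof (induction k arbitrary: f g)
  case 0
  then show ?case using continuous_on_compose2 by (metis Ck_on.simps(1))
next
  case (Suc k)
  show ?case
  proof (rule Ck_on_SucI[OF assms(1)])
    fix x assume x: "x \<in> U"
    have fx: "f x \<in> V" using x Suc.prems by auto
    have G: "(g has_derivative frechet_derivative g (at (f x))) (at (f x))"
      using Ck_on_derivative[OF Suc.prems(2) fx] .
    have eq: "frechet_derivative g (at (f x)) w
         = (\<Sum>b\<in>Basis. (w \<bullet> b) *\<^sub>R frechet_derivative g (at (f x)) b)" for w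
      by (rule linear_sum_Basis[OF has_derivative_linear[OF G]])
    have "(\<lambda>v. \<Sum>b\<in>Basis. (frechet_derivative f (at x) v \<bullet> b) *\<^sub>R frechet_derivative g (at (f x)) b)
        = frechet_derivative g (at (f x)) \<circ> frechet_derivative f (at x)"
      by (rule ext, unfold o_def, rule eq[symmetric])
    then show "((\<lambda>x. g (f x)) has_derivative (\<lambda>v. \<Sum>b\<in>Basis. (frechet_derivative f (at x) v \<bullet> b)
         *\<^sub>R frechet_derivative g (at (f x)) b)) (at x)"
      using diff_chain_at[OF Ck_on_derivative[OF Suc.prems(1) x] G] by (simp only: o_def)
  next
    fix v
    show "Ck_on k U (\<lambda>x. \<Sum>b\<in>Basis. (frechet_derivative f (at x) v \<bullet> b)
         *\<^sub>R frechet_derivative g (at (f x)) b)"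
      by (intro Ck_on_sum[OF assms(1)] Ck_on_bilinear[OF bounded_bilinear_scaleR assms(1)]
          Ck_on_bounded_linear[OF bounded_linear_inner_left assms(1)] Suc.IH)
        (use Suc.prems Ck_on_lower[OF Suc.prems(1)] in auto)
  qed
qed

section \<open>Linear systems depending on a parameter\<close>

text \<open>The sum on the right is a substitute for the operator norm that is visibly continuous in the
parameter.\<close>

lemma parameter_linear_deviation:
  fixes A :: "'x::euclidean_space \<Rightarrow> 'w::euclidean_space \<Rightarrow> 'w"
  assumes "linear (A x)" "linear (A y)"
  shows "norm (A x u - A y u) \<le> (\<Sum>b\<in>Basis. norm (A x b - A y b)) * norm u"
proof -
  have L: "linear (\<lambda>u. A x u - A y u)" using assms linear_compose_sub by blast
  have "A x u - A y u = (\<Sum>b\<in>Basis. (u \<bullet> b) *\<^sub>R (A x b - A y b))"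
    by (rule linear_sum_Basis[OF L])
  also have "norm \<dots> \<le> (\<Sum>b\<in>Basis. norm (A x b - A y b) * norm u)"
    by (rule sum_norm_le) (simp add: Basis_le_norm mult.commute mult_right_mono)
  finally show ?thesis by (simp add: sum_distrib_right)
qed

text \<open>If \<open>A x0\<close> stretches every vector by a factor at least \<open>c > 0\<close>, then the same holds with a smaller
positive factor for all maps that deviate from it by less than \<open>c\<close>.\<close>

lemma open_injective_parameters:
  fixes A :: "'x::euclidean_space \<Rightarrow> 'w::euclidean_space \<Rightarrow> 'w"
  assumes U: "open U" and lin: "\<And>x. x \<in> U \<Longrightarrow> linear (A x)"
    and cont: "\<And>u. continuous_on U (\<lambda>x. A x u)"
  shows "open {x \<in> U. inj (A x)}"
proof (subst open_subopen, safe)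
  fix x0 assume x0: "x0 \<in> U" "inj (A x0)"
  obtain c where c: "c > 0" "\<And>u. c * norm u \<le> norm (A x0 u)"
    using linear_inj_bounded_below_pos[OF lin[OF x0(1)] x0(2)] by blast
  define a where "a x = (\<Sum>b\<in>Basis. norm (A x b - A x0 b))" for x
  have "continuous_on U a" unfolding a_def by (intro continuous_intros cont)
  then have "open {x \<in> U. a x < c}"
    using continuous_open_preimage[OF _ U open_lessThan[of c]] by (simp add: vimage_def Int_def)
  moreover have "x0 \<in> {x \<in> U. a x < c}" using x0 c by (simp add: a_def)
  moreover have "inj (A x)" if x: "x \<in> U" "a x < c" for x
    unfolding linear_injective_0[OF lin[OF x(1)]]
  proof (intro allI impI, rule ccontr)
    fix u assume u: "A x u = 0" "u \<noteq> 0"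
    have "c * norm u \<le> norm (A x u - A x0 u)" using c(2)[of u] u by simp
    also have "\<dots> \<le> a x * norm u"
      unfolding a_def by (rule parameter_linear_deviation) (use lin x x0 in auto)
    finally show False using u x by simp
  qed
  ultimately show "\<exists>T. open T \<and> x0 \<in> T \<and> T \<subseteq> {x \<in> U. inj (A x)}"
    by (intro exI[of _ "{x \<in> U. a x < c}"]) auto
qed

text \<open>The increment of the continuous factor is multiplied by values of the other factor, which are of
first order; so it only contributes to the error term.\<close>

lemma has_derivative_scaleR_vanishing:
  fixes f :: "'a::real_normed_vector \<Rightarrow> 'b::real_normed_vector"
  assumes g: "isCont g x" and f: "(f has_derivative f') (at x)" and f0: "f x = 0"
  shows "((\<lambda>y. g y *\<^sub>R f y) has_derivative (\<lambda>v. g x *\<^sub>R f' v)) (at x)"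
proof -
  have bl: "bounded_linear f'" using f has_derivative_bounded_linear by blast
  obtain C where C: "C > 0" "\<And>v. norm (f' v) \<le> norm v * C" using bounded_linear.pos_bounded[OF bl] by blast
  have g0: "((\<lambda>y. g y - g x) \<longlongrightarrow> 0) (at x)" using g by (simp add: isCont_def LIM_zero)
  have e: "((\<lambda>y. norm (f y - f x - f' (y - x)) / norm (y - x)) \<longlongrightarrow> 0) (at x)"
    using f by (simp add: has_derivative_iff_norm)
  have lim: "((\<lambda>y. \<bar>g y\<bar> * (norm (f y - f x - f' (y - x)) / norm (y - x)) + \<bar>g y - g x\<bar> * C) \<longlongrightarrow> 0) (at x)"
    using tendsto_add[OF tendsto_mult[OF tendsto_rabs[OF g[unfolded isCont_def]] e]
        tendsto_mult[OF tendsto_rabs[OF g0] tendsto_const[of C]]] by simp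
  show ?thesis unfolding has_derivative_iff_norm
  proof (intro conjI)
    show "bounded_linear (\<lambda>v. g x *\<^sub>R f' v)" using bl bounded_linear_const_scaleR by blast
    show "((\<lambda>y. norm (g y *\<^sub>R f y - g x *\<^sub>R f x - g x *\<^sub>R f' (y - x)) / norm (y - x)) \<longlongrightarrow> 0) (at x)"
    proof (rule tendsto_sandwich[OF _ _ tendsto_const lim])
      show "\<forall>\<^sub>F y in at x. norm (g y *\<^sub>R f y - g x *\<^sub>R f x - g x *\<^sub>R f' (y - x)) / norm (y - x)
         \<le> \<bar>g y\<bar> * (norm (f y - f x - f' (y - x)) / norm (y - x)) + \<bar>g y - g x\<bar> * C"
        unfolding eventually_at_filter
      proof (intro always_eventually allI impI)
        fix y assume "y \<noteq> x" then have n: "norm (y - x) > 0" by simp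
        have "g y *\<^sub>R f y - g x *\<^sub>R f x - g x *\<^sub>R f' (y - x)
          = g y *\<^sub>R (f y - f x - f' (y - x)) + (g y - g x) *\<^sub>R f' (y - x)"
          by (simp add: f0 algebra_simps)
        then have "norm (g y *\<^sub>R f y - g x *\<^sub>R f x - g x *\<^sub>R f' (y - x))
          \<le> \<bar>g y\<bar> * norm (f y - f x - f' (y - x)) + \<bar>g y - g x\<bar> * norm (f' (y - x))"
          by (metis norm_scaleR norm_triangle_ineq)
        also have "\<dots> \<le> \<bar>g y\<bar> * norm (f y - f x - f' (y - x)) + \<bar>g y - g x\<bar> * (norm (y - x) * C)"
          using C by (simp add: mult_left_mono)
        finally show "norm (g y *\<^sub>R f y - g x *\<^sub>R f x - g x *\<^sub>R f' (y - x)) / norm (y - x)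
         \<le> \<bar>g y\<bar> * (norm (f y - f x - f' (y - x)) / norm (y - x)) + \<bar>g y - g x\<bar> * C"
          using n by (simp add: field_simps)
      qed
    qed (auto)
  qed
qed

text \<open>The solution of a linear system is as smooth as its data. Differentiating \<open>A x (w x) = v x\<close> gives a
system with the same matrix for the derivative of \<open>w\<close>, so induction applies as soon as \<open>w\<close> is known to
be differentiable. At \<open>x0\<close> this follows from
\<open>w x = inv (A x0) (v x - (A x (w x) - A x0 (w x)))\<close>: the bracketed difference is a
sum of products of the continuous coordinates of \<open>w\<close> with differentiable factors that vanish at \<open>x0\<close>.\<close>

lemma Ck_on_linear_solve:
  fixes A :: "'x::euclidean_space \<Rightarrow> 'w::euclidean_space \<Rightarrow> 'w"
  assumes U: "open U" and lin: "\<And>x. x \<in> U \<Longrightarrow> linear (A x)" and inj: "\<And>x. x \<in> U \<Longrightarrow> inj (A x)"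
    and A: "\<And>u. Ck_on k U (\<lambda>x. A x u)" and v: "Ck_on k U v"
    and sol: "\<And>x. x \<in> U \<Longrightarrow> A x (w x) = v x"
  shows "Ck_on k U w"
  using A v sol
proof (induction k arbitrary: v w)
  case 0
  show ?case unfolding Ck_on.simps
  proof (rule continuous_at_imp_continuous_on, rule ballI)
    fix x0 assume x0: "x0 \<in> U"
    obtain c where c: "c > 0" "\<And>u. c * norm u \<le> norm (A x0 u)"
      using linear_inj_bounded_below_pos[OF lin[OF x0] inj[OF x0]] by blast
    define a where "a x = (\<Sum>b\<in>Basis. norm (A x b - A x0 b))" for x
    have a0: "(a \<longlongrightarrow> 0) (at x0)"
    proof -
      have "((\<lambda>x. A x b) \<longlongrightarrow> A x0 b) (at x0)" for b
        using 0(1) x0 U by (simp add: continuous_on_eq_continuous_at isCont_def)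
      then have "(a \<longlongrightarrow> (\<Sum>b\<in>(Basis::'w set). norm (A x0 b - A x0 b))) (at x0)"
        unfolding a_def by (intro tendsto_intros)
      then show ?thesis by simp
    qed
    have v0: "(v \<longlongrightarrow> v x0) (at x0)" 
      using 0(2) x0 U by (simp add: continuous_on_eq_continuous_at isCont_def)
    have bound: "norm (w x - w x0) \<le> (norm (v x - v x0) + a x * norm (w x0)) / (c - a x)"
      if x: "x \<in> U" "a x < c" for x
    proof -
      have "A x0 (w x - w x0) = v x - v x0 - (A x (w x) - A x0 (w x))"
        using 0(3) x x0 by (simp add: linear_diff[OF lin[OF x0]])
      then have "c * norm (w x - w x0) \<le> norm (v x - v x0) + norm (A x (w x) - A x0 (w x))"
        using c(2)[of "w x - w x0"] norm_triangle_ineq4 by (metis (no_types, opaque_lifting) order_trans)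
      moreover have "norm (A x (w x) - A x0 (w x)) \<le> a x * norm (w x)"
        unfolding a_def by (rule parameter_linear_deviation) (use lin x x0 in auto)
      moreover have "a x * norm (w x) \<le> a x * (norm (w x - w x0) + norm (w x0))"
        by (rule mult_left_mono) (auto simp: a_def sum_nonneg norm_triangle_sub add.commute)
      ultimately have "(c - a x) * norm (w x - w x0) \<le> norm (v x - v x0) + a x * norm (w x0)"
        by (simp add: algebra_simps)
      then show ?thesis using x by (simp add: field_simps)
    qed
    have "((\<lambda>x. (norm (v x - v x0) + a x * norm (w x0)) / (c - a x)) \<longlongrightarrow>
        (norm (v x0 - v x0) + 0 * norm (w x0)) / (c - 0)) (at x0)"
      using c by (intro tendsto_intros a0 v0) auto
    then have "((\<lambda>x. w x - w x0) \<longlongrightarrow> 0) (at x0)"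
    proof (rule Lim_null_comparison[rotated, OF tendsto_eq_rhs])
      have "\<forall>\<^sub>F x in at x0. a x < c" using order_tendstoD(2)[OF a0 c(1)] .
      moreover have "\<forall>\<^sub>F x in at x0. x \<in> U" using U x0 eventually_at_topological by blast
      ultimately show "\<forall>\<^sub>F x in at x0. norm (w x - w x0)
          \<le> (norm (v x - v x0) + a x * norm (w x0)) / (c - a x)"
        by eventually_elim (use bound in auto)
    qed auto
    then show "isCont w x0" by (simp add: isCont_def LIM_zero_iff)
  qed
next
  case (Suc k)
  have wk: "Ck_on k U w"
    by (rule Suc.IH[OF _ _ Suc.prems(3)]) (use Suc.prems Ck_on_lower in blast)+
  define A' where "A' x h u = frechet_derivative (\<lambda>x. A x u) (at x) h" for x h u
  have A': "((\<lambda>x. A x u) has_derivative (\<lambda>h. A' x h u)) (at x)" if "x \<in> U" for x u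
    using Ck_on_derivative[OF Suc.prems(1) that] by (simp add: A'_def)
  define R where "R x h = frechet_derivative v (at x) h - (\<Sum>b\<in>Basis. (w x \<bullet> b) *\<^sub>R A' x h b)" for x h
  define w' where "w' x h = inv (A x) (R x h)" for x h
  have surj: "surj (A x)" if "x \<in> U" for x
    by (rule linear_injective_imp_surjective[OF lin[OF that] inj[OF that]]) simp
  have Aw': "A x (w' x h) = R x h" if "x \<in> U" for x h
    unfolding w'_def using surj_f_inv_f[OF surj[OF that]] .
  show ?case
  proof (rule Ck_on_SucI[OF U])
    fix x assume x: "x \<in> U"
    have blinv: "bounded_linear (inv (A x))"
      using inj_linear_imp_inv_linear[OF lin[OF x] inj[OF x]] linear_conv_bounded_linear by auto
    have wc: "isCont (\<lambda>y. w y \<bullet> b) x" for b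
      using Ck_on_continuous[OF wk] x U
      by (intro continuous_intros) (simp add: continuous_on_eq_continuous_at)
    have R: "((\<lambda>y. v y - (\<Sum>b\<in>Basis. (w y \<bullet> b) *\<^sub>R (A y b - A x b))) has_derivative R x) (at x)"
      unfolding R_def
    proof (intro has_derivative_diff has_derivative_sum has_derivative_scaleR_vanishing wc
        Ck_on_derivative[OF Suc.prems(2) x])
      show "((\<lambda>y. A y b - A x b) has_derivative (\<lambda>h. A' x h b)) (at x)" for b
        using has_derivative_diff[OF A'[OF x, of b] has_derivative_const[of "A x b"]] by simp
    qed auto
    have "((\<lambda>y. inv (A x) (v y - (\<Sum>b\<in>Basis. (w y \<bullet> b) *\<^sub>R (A y b - A x b)))) has_derivative w' x) (at x)"
      unfolding w'_def using bounded_linear.has_derivative[OF blinv R] .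
    then show "(w has_derivative w' x) (at x)"
    proof (rule has_derivative_transform_within_open[OF _ U x])
      fix y assume y: "y \<in> U"
      have "(\<Sum>b\<in>Basis. (w y \<bullet> b) *\<^sub>R A z b) = A z (w y)" if "z \<in> U" for z
        by (rule linear_sum_Basis[OF lin[OF that], symmetric])
      then have "v y - (\<Sum>b\<in>Basis. (w y \<bullet> b) *\<^sub>R (A y b - A x b)) = A x (w y)"
        using x y Suc.prems(3) by (simp add: scaleR_diff_right sum_subtractf)
      then show "inv (A x) (v y - (\<Sum>b\<in>Basis. (w y \<bullet> b) *\<^sub>R (A y b - A x b))) = w y"
        using inv_f_f[OF inj[OF x]] by simp
    qed
  next
    fix h
    show "Ck_on k U (\<lambda>x. w' x h)"
    proof (rule Suc.IH[of "\<lambda>x. R x h"])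
      show "Ck_on k U (\<lambda>x. R x h)"
        unfolding R_def A'_def diff_conv_add_uminus
        by (intro Ck_on_add[OF U] Ck_on_bounded_linear[OF bounded_linear_minus[OF bounded_linear_ident] U] Ck_on_sum[OF U] Ck_on_bilinear[OF bounded_bilinear_scaleR U]
          Ck_on_bounded_linear[OF bounded_linear_inner_left U] wk)
         (use Suc.prems in auto)
    qed (use Ck_on_lower[OF Suc.prems(1)] Aw' in auto)
  qed
qed

section \<open>Inverse function theorem\<close>

text \<open>The derivative of the inverse at \<open>y\<close> solves a linear system whose matrix is the derivative of \<open>f\<close> at
\<open>g y\<close>; hence each order of differentiability of \<open>g\<close> gives the next one.\<close>

lemma Ck_on_inverse:
  fixes f :: "'a::euclidean_space \<Rightarrow> 'a"
  assumes U: "open U" and f: "\<And>k. Ck_on k U f"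
    and gf: "\<And>x. x \<in> U \<Longrightarrow> g (f x) = x"
    and inj: "\<And>x. x \<in> U \<Longrightarrow> inj (frechet_derivative f (at x))"
  shows "open (f ` U)" "Ck_on k (f ` U) g"
proof -
  have injf: "inj_on f U" using gf by (metis inj_onI)
  have cf: "continuous_on U f" using f Ck_on_continuous by blast
  show V: "open (f ` U)" using invariance_of_domain[OF cf U injf] .
  define D where "D x = frechet_derivative f (at x)" for x
  have D: "(f has_derivative D x) (at x)" if "x \<in> U" for x
    unfolding D_def using Ck_on_derivative[OF f that] .
  have linD: "linear (D x)" if "x \<in> U" for x using has_derivative_linear[OF D[OF that]] .
  have surjD: "surj (D x)" if "x \<in> U" for x
    by (rule linear_injective_imp_surjective[OF linD[OF that]])
      (use inj[OF that] in \<open>simp_all add: D_def\<close>)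
  have Dg: "(g has_derivative inv (D (g y))) (at y)" if y: "y \<in> f ` U" for y
  proof -
    obtain x where x: "x \<in> U" "y = f x" using y by auto
    have "D x \<circ> inv (D x) = id" using surjD[OF x(1)] by (simp add: surj_iff)
    then show ?thesis
      using has_derivative_inverse_on[OF U D gf _ x(1), of "\<lambda>x. inv (D x)"] x gf by simp
  qed
  show "Ck_on k (f ` U) g"
  proof (induction k)
    case 0
    show ?case
      using has_derivative_continuous[OF Dg] by (auto intro!: continuous_at_imp_continuous_on)
  next
    case (Suc k)
    show ?case
    proof (rule Ck_on_SucI[OF V Dg])
      fix v
      show "Ck_on k (f ` U) (\<lambda>y. inv (D (g y)) v)"
      proof (rule Ck_on_linear_solve[OF V, where A = "\<lambda>y. D (g y)"])
        show "Ck_on k (f ` U) (\<lambda>y. D (g y) u)" for u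
          by (rule Ck_on_compose[OF V U Suc])
            (use f[of "Suc k"] gf in \<open>auto simp: D_def\<close>)
        show "Ck_on k (f ` U) (\<lambda>y. v)" by (rule Ck_on_const)
      qed (use gf linD inj surjD in \<open>auto simp: D_def surj_f_inv_f\<close>)
    qed
  qed
qed

lemma Ck_on_locally_injective:
  fixes f :: "'a::euclidean_space \<Rightarrow> 'a"
  assumes U: "open U" and f: "Ck_on 1 U f" and a: "a \<in> U" and inj: "inj (frechet_derivative f (at a))"
  obtains r where "r > 0" "ball a r \<subseteq> U" "inj_on f (ball a r)"
proof -
  define D where "D x = frechet_derivative f (at x)" for x
  have D: "(f has_derivative D x) (at x)" if "x \<in> U" for x
    unfolding D_def using Ck_on_derivative[of 0 U f] f that by simp
  have linD: "linear (D x)" if "x \<in> U" for x using has_derivative_linear[OF D[OF that]] .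
  have injD: "inj (D a)" using inj by (simp add: D_def)
  have bl: "bounded_linear (inv (D a))"
    using inj_linear_imp_inv_linear[OF linD[OF a] injD] linear_conv_bounded_linear by auto
  have id: "inv (D a) \<circ> D a = id" using injD by (simp add: inj_iff)
  define s where "s x = (\<Sum>b\<in>Basis. norm (D x b - D a b))" for x
  have "continuous_on U s" unfolding s_def D_def
    by (intro continuous_intros) (use f in auto)
  then have "isCont s a" using U a by (simp add: continuous_on_eq_continuous_at)
  then have small: "\<exists>d>0. \<forall>x. dist a x < d \<longrightarrow> onorm (\<lambda>v. D x v - D a v) < e" if "e > 0" for e
  proof -
    obtain d0 where d0: "d0 > 0" "ball a d0 \<subseteq> U" using U a open_contains_ball by blast
    have "\<forall>\<^sub>F x in at a. dist (s x) (s a) < e"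
      using \<open>isCont s a\<close> that by (simp add: isCont_def tendstoD)
    then obtain d where "d > 0" "\<And>x. x \<noteq> a \<Longrightarrow> dist x a < d \<Longrightarrow> dist (s x) (s a) < e"
      unfolding eventually_at by auto
    then have d: "d > 0" "\<And>x. dist x a < d \<Longrightarrow> dist (s x) (s a) < e"
      using that by (metis dist_self)+
    have "onorm (\<lambda>v. D x v - D a v) < e" if x: "dist a x < min d d0" for x
    proof -
      have xU: "x \<in> U" using x d0 by auto
      have "onorm (\<lambda>v. D x v - D a v) \<le> s x"
        unfolding s_def by (rule onorm_le) (rule parameter_linear_deviation, use linD xU a in auto)
      also have "s x < e" using d(2)[of x] x by (simp add: s_def dist_commute dist_real_def sum_nonneg)
      finally show ?thesis .
    qed
    then show ?thesis using d(1) d0(1) by (intro exI[of _ "min d d0"]) auto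
  qed
  show ?thesis
    by (rule has_derivative_locally_injective[OF a U bl id D small]) (use that in auto)
qed

text \<open>Only injectivity near \<open>B\<close> goes beyond the local theorem. If it failed on all neighbourhoods, there would be
pairs of distinct points with equal images whose distance to \<open>B\<close> tends to \<open>0\<close>. Subsequences converge to
points of \<open>B\<close> with equal images, thus to the same point, and \<open>f\<close> is injective near that point.\<close>

lemma inverse_function_near_compact:
  fixes f :: "'a::euclidean_space \<Rightarrow> 'a"
  assumes O: "open O'" and f: "\<And>k. Ck_on k O' f" and B: "compact B" "B \<subseteq> O'" "inj_on f B"
    and inj: "\<And>b. b \<in> B \<Longrightarrow> inj (frechet_derivative f (at b))"
  obtains U g where "open U" "B \<subseteq> U" "U \<subseteq> O'" "open (f ` U)" "\<forall>k. Ck_on k (f ` U) g"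
    "\<forall>x\<in>U. g (f x) = x"
proof -
  define U0 where "U0 = {x \<in> O'. inj (frechet_derivative f (at x))}"
  have U0: "open U0" unfolding U0_def
  proof (rule open_injective_parameters[OF O])
    show "continuous_on O' (\<lambda>x. frechet_derivative f (at x) u)" for u
      using f[of "Suc 0"] by auto
    show "linear (frechet_derivative f (at x))" if "x \<in> O'" for x
      using has_derivative_linear[OF Ck_on_derivative[OF f that]] .
  qed
  have BU0: "B \<subseteq> U0" using B inj by (auto simp: U0_def)
  define N where "N n = {x. infdist x B < 1 / real (Suc n)}" for n
  have ex: "\<exists>n. N n \<subseteq> U0 \<and> inj_on f (N n)" if ne: "B \<noteq> {}"
  proof (rule ccontr)
    assume "\<nexists>n. N n \<subseteq> U0 \<and> inj_on f (N n)"
    obtain e where e: "e > 0" "{x. infdist x B < e} \<subseteq> U0"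
    proof -
      obtain e where e: "e > 0" "(\<Union>b\<in>B. ball b e) \<subseteq> U0"
        using compact_subset_open_imp_ball_epsilon_subset[OF B(1) U0 BU0] by blast
      have "x \<in> U0" if "infdist x B < e" for x
      proof -
        obtain b where "b \<in> B" "infdist x B = dist x b"
          using infdist_attains_inf[of B x] B(1) ne compact_imp_closed by metis
        then have "b \<in> B" "x \<in> ball b e" using that by (auto simp: dist_commute)
        then show ?thesis using e(2) by blast
      qed
      then show ?thesis using that[OF e(1)] by blast
    qed
    obtain n0 where n0: "1 / real (Suc n0) < e" using e(1) by (metis nat_approx_posE)
    have "\<exists>x y. x \<in> N n \<and> y \<in> N n \<and> x \<noteq> y \<and> f x = f y" if "n \<ge> n0" for n
    proof -
      have "1 / real (Suc n) \<le> 1 / real (Suc n0)" using that by (simp add: frac_le)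
      then have "N n \<subseteq> U0" using n0 e(2) by (force simp: N_def)
      then show ?thesis using \<open>\<nexists>n. N n \<subseteq> U0 \<and> inj_on f (N n)\<close> unfolding inj_on_def by blast
    qed
    then have "\<exists>x y. x \<in> N (n0 + n) \<and> y \<in> N (n0 + n) \<and> x \<noteq> y \<and> f x = f y" for n by simp
    then obtain X Y where XY: "\<And>n. X n \<in> N (n0 + n)" "\<And>n. Y n \<in> N (n0 + n)" "\<And>n. X n \<noteq> Y n"
      "\<And>n. f (X n) = f (Y n)" by metis
    have near: "\<exists>b\<in>B. dist (Z n) b < 1 / real (Suc n)" if "\<And>n. Z n \<in> N (n0 + n)" for Z :: "nat \<Rightarrow> 'a" and n
    proof -
      obtain b where "b \<in> B" "infdist (Z n) B = dist (Z n) b"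
        using infdist_attains_inf[of B "Z n"] B(1) ne compact_imp_closed by metis
      moreover have "1 / real (Suc (n0 + n)) \<le> 1 / real (Suc n)" by (simp add: frac_le)
      ultimately show ?thesis using that[of n] unfolding N_def by force
    qed
    obtain P where P: "\<And>n. P n \<in> B" "\<And>n. dist (X n) (P n) < 1 / real (Suc n)"
      using near[of X, OF XY(1)] by metis
    obtain R where R: "\<And>n. R n \<in> B" "\<And>n. dist (Y n) (R n) < 1 / real (Suc n)"
      using near[of Y, OF XY(2)] by metis
    have "compact (B \<times> B)" using B(1) compact_Times by blast
    then obtain l r where l: "l \<in> B \<times> B" "strict_mono r" "((\<lambda>n. (P n, R n)) \<circ> r) \<longlonglongrightarrow> l"
      unfolding compact_def using P(1) R(1) by (metis (no_types, lifting) SigmaI)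
    have lims: "(\<lambda>n. P (r n)) \<longlonglongrightarrow> fst l" "(\<lambda>n. R (r n)) \<longlonglongrightarrow> snd l"
      using tendsto_fst[OF l(3)] tendsto_snd[OF l(3)] by (auto simp: o_def)
    have z: "(\<lambda>n. 1 / real (Suc (r n))) \<longlonglongrightarrow> 0"
      using LIMSEQ_subseq_LIMSEQ[OF LIMSEQ_inverse_real_of_nat l(2)] by (simp add: o_def field_simps)
    have dX: "(\<lambda>n. X (r n) - P (r n)) \<longlonglongrightarrow> 0"
      by (rule Lim_null_comparison[OF _ z]) (use P(2) in \<open>auto simp: dist_norm intro!: always_eventually less_imp_le\<close>)
    have dY: "(\<lambda>n. Y (r n) - R (r n)) \<longlonglongrightarrow> 0"
      by (rule Lim_null_comparison[OF _ z]) (use R(2) in \<open>auto simp: dist_norm intro!: always_eventually less_imp_le\<close>)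
    have X: "(\<lambda>n. X (r n)) \<longlonglongrightarrow> fst l" using tendsto_add[OF dX lims(1)] by simp
    have Y: "(\<lambda>n. Y (r n)) \<longlonglongrightarrow> snd l" using tendsto_add[OF dY lims(2)] by simp
    have lB: "fst l \<in> B" "snd l \<in> B" using l(1) by auto
    have cont: "isCont f x" if "x \<in> O'" for x
      using Ck_on_continuous[OF f] O that by (metis continuous_on_eq_continuous_at)
    have "f (fst l) = f (snd l)"
      using LIMSEQ_unique[OF isCont_tendsto_compose[OF cont X] isCont_tendsto_compose[OF cont Y, folded XY(4)]]
        lB B(2) by (auto simp: XY(4))
    then have eq: "fst l = snd l" using B(3) lB by (meson inj_onD)
    obtain s where s: "s > 0" "inj_on f (ball (fst l) s)"
      using Ck_on_locally_injective[OF O f _ inj[OF lB(1)]] lB B(2) by blast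
    have "\<forall>\<^sub>F n in sequentially. X (r n) \<in> ball (fst l) s"
      using topological_tendstoD[OF X open_ball] s(1) by simp
    moreover have "\<forall>\<^sub>F n in sequentially. Y (r n) \<in> ball (fst l) s"
      using topological_tendstoD[OF Y open_ball] s(1) eq by simp
    ultimately have "\<forall>\<^sub>F n in sequentially. False"
      by eventually_elim (use s(2) XY(3,4) in \<open>metis inj_onD\<close>)
    then show False by simp
  qed
  obtain U where U: "open U" "B \<subseteq> U" "U \<subseteq> U0" "inj_on f U"
  proof (cases "B = {}")
    case True
    then show ?thesis using that[of "{}"] by auto
  next
    case False
    then obtain n where n: "N n \<subseteq> U0" "inj_on f (N n)" using ex by blast
    have "open (N n)" unfolding N_def by (intro open_Collect_less continuous_intros)
    moreover have "B \<subseteq> N n" by (auto simp: N_def)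
    ultimately show ?thesis using that n by blast
  qed
  have fU: "\<And>k. Ck_on k U f" using f U(3) Ck_on_subset unfolding U0_def by blast
  have gf: "inv_into U f (f x) = x" if "x \<in> U" for x using that U(4) by simp
  have injU: "inj (frechet_derivative f (at x))" if "x \<in> U" for x using that U(3) by (auto simp: U0_def)
  show ?thesis
  proof (rule that[OF U(1,2)])
    show "U \<subseteq> O'" using U(3) by (auto simp: U0_def)
    show "open (f ` U)" by (rule Ck_on_inverse(1)[OF U(1) fU gf injU])
    show "\<forall>k. Ck_on k (f ` U) (inv_into U f)" using Ck_on_inverse(2)[OF U(1) fU gf injU] by blast
    show "\<forall>x\<in>U. inv_into U f (f x) = x" using gf by blast
  qed
qed

section \<open>Elementary functions\<close>

lemma Ck_on_inverse_real: "Ck_on k {x::real. x \<noteq> 0} inverse"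
proof (induction k)
  case 0
  show ?case by (auto intro: continuous_intros)
next
  case (Suc k)
  have U: "open {x::real. x \<noteq> 0}" by (simp add: open_Collect_neq)
  show ?case
  proof (rule Ck_on_SucI[OF U])
    show "(inverse has_derivative (\<lambda>v. - (inverse x * v * inverse x))) (at x)" if "x \<in> {x::real. x \<noteq> 0}" for x
      using that by (auto intro!: derivative_eq_intros)
    show "Ck_on k {x. x \<noteq> 0} (\<lambda>x. - (inverse x * v * inverse x))" for v :: real
      by (intro Ck_on_bounded_linear[OF bounded_linear_minus[OF bounded_linear_ident] U]
          Ck_on_bilinear[OF bounded_bilinear_mult U] Ck_on_const Suc)
  qed
qed

lemma Ck_on_sqrt: "Ck_on k {0<..} sqrt"
proof (induction k)
  case 0
  show ?case by (auto intro: continuous_intros)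
next
  case (Suc k)
  have V: "open {x::real. x \<noteq> 0}" by (simp add: open_Collect_neq)
  show ?case
  proof (rule Ck_on_SucI[OF open_greaterThan])
    show "(sqrt has_derivative (*) (inverse (sqrt x) / 2)) (at x)" if "x \<in> {0<..}" for x
      using DERIV_real_sqrt[of x] that by (simp add: has_field_derivative_def)
    show "Ck_on k {0<..} (\<lambda>x. inverse (sqrt x) / 2 * v)" for v :: real
      by (intro Ck_on_bilinear[OF bounded_bilinear_mult open_greaterThan] Ck_on_const
          Ck_on_bounded_linear[OF bounded_linear_divide open_greaterThan]
          Ck_on_compose[OF open_greaterThan V Suc Ck_on_inverse_real]) auto
  qed
qed

text \<open>The function \<open>exp (- 1 / x) / x ^ m\<close>, extended by zero. The derivative of a
member of this family is a combination of two other members, so all of them are smooth.\<close>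

definition flat :: "nat \<Rightarrow> real \<Rightarrow> real" where
  "flat m x = (if x > 0 then exp (- inverse x) * inverse x ^ m else 0)"

lemma flat_tendsto_0: "(flat m \<longlongrightarrow> 0) (at 0)"
proof -
  have "((\<lambda>x. inverse x ^ m / exp (inverse x)) \<longlongrightarrow> 0) (at_right (0::real))"
    using filterlim_compose[OF tendsto_power_div_exp_0 filterlim_inverse_at_top_right] .
  then have r: "(flat m \<longlongrightarrow> 0) (at_right 0)"
    by (rule Lim_transform_eventually)
      (auto simp: flat_def eventually_at_filter exp_minus field_simps)
  have "((\<lambda>x. 0) \<longlongrightarrow> (0::real)) (at_left 0)" by simp
  then have l: "(flat m \<longlongrightarrow> 0) (at_left 0)"
    by (rule Lim_transform_eventually) (auto simp: flat_def eventually_at_filter)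
  show ?thesis using filterlim_split_at[OF l r] .
qed

lemma flat_derivative:
  "(flat m has_real_derivative (flat (m + 2) x - real m * flat (m + 1) x)) (at x)"
proof -
  consider "x > 0" | "x < 0" | "x = 0" by linarith
  then show ?thesis
  proof cases
    case 1
    have "((\<lambda>x. exp (- inverse x) * inverse x ^ m) has_real_derivative
        (flat (m + 2) x - real m * flat (m + 1) x)) (at x)"
      using 1 power_Suc[of x "m - 1"]
      by (cases "m = 0") (auto intro!: derivative_eq_intros simp: flat_def field_simps power2_eq_square)
    then show ?thesis
      by (rule has_field_derivative_transform_within_open[where S = "{0<..}"]) (use 1 in \<open>auto simp: flat_def\<close>)
  next
    case 2
    have "((\<lambda>x. 0) has_real_derivative (flat (m + 2) x - real m * flat (m + 1) x)) (at x)"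
      using 2 by (auto simp: flat_def)
    then show ?thesis
      by (rule has_field_derivative_transform_within_open[where S = "{..<0}"]) (use 2 in \<open>auto simp: flat_def\<close>)
  next
    case 3
    have "((\<lambda>h. (flat m (0 + h) - flat m 0) / h) \<longlongrightarrow> 0) (at 0)"
      by (rule Lim_transform_eventually[OF flat_tendsto_0[of "Suc m"]])
        (auto simp: flat_def eventually_at_filter field_simps)
    then show ?thesis using 3 by (simp add: DERIV_def flat_def)
  qed
qed

lemma Ck_on_flat: "Ck_on k UNIV (flat m)"
proof (induction k arbitrary: m)
  case 0
  show ?case using flat_derivative by (auto intro!: continuous_at_imp_continuous_on DERIV_isCont)
next
  case (Suc k)
  show ?case
  proof (rule Ck_on_SucI[OF open_UNIV])
    show "(flat m has_derivative (*) (flat (m + 2) x + (- real m) * flat (m + 1) x)) (at x)" for x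
      using flat_derivative[of m x] by (simp add: has_field_derivative_def)
    show "Ck_on k UNIV (\<lambda>x. (flat (m + 2) x + (- real m) * flat (m + 1) x) * v)" for v
      by (intro Ck_on_bilinear[OF bounded_bilinear_mult open_UNIV] Ck_on_add[OF open_UNIV] Ck_on_const Suc)
  qed
qed

section \<open>Smooth maps on arbitrary sets\<close>

named_theorems smooth_intros

lemma smooth_map_Ck:
  assumes "\<And>k. Ck_on k U f" "open U" "X \<subseteq> U"
  shows "smooth_map X f"
  unfolding smooth_map_def using assms by blast

lemma smooth_mapE:
  assumes "smooth_map X f" "x \<in> X"
  obtains U g where "open U" "x \<in> U" "\<forall>k. Ck_on k U g" "\<forall>y\<in>U. y \<in> X \<longrightarrow> g y = f y"
proof -
  from bspec[OF assms(1)[unfolded smooth_map_def] assms(2)] obtain U g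
    where *: "open U \<and> x \<in> U \<and> (\<forall>k. Ck_on k U g) \<and> (\<forall>y\<in>U \<inter> X. g y = f y)" by (elim exE)
  show thesis by (rule that[of U g]) (use * in simp_all)
qed

lemma smooth_mapI:
  assumes "\<And>x. x \<in> X \<Longrightarrow> \<exists>U g. open U \<and> x \<in> U \<and> (\<forall>k. Ck_on k U g) \<and> (\<forall>y\<in>U. y \<in> X \<longrightarrow> g y = f y)"
  shows "smooth_map X f"
  using assms unfolding smooth_map_def Ball_def Int_iff by metis

text \<open>Being \<open>k\<close> times continuously differentiable is local, so the local extensions glue on an open set.\<close>

lemma smooth_map_open_iff:
  assumes "open U"
  shows "smooth_map U f \<longleftrightarrow> (\<forall>k. Ck_on k U f)"
proof
  assume f: "smooth_map U f"
  show "\<forall>k. Ck_on k U f"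
  proof (intro allI Ck_on_local)
    fix k x assume "x \<in> U"
    with f obtain V g where V: "open V" "x \<in> V" "\<forall>k. Ck_on k V g" "\<forall>y\<in>V. y \<in> U \<longrightarrow> g y = f y"
      by (rule smooth_mapE)
    note V = V[rule_format]
    have "Ck_on k (V \<inter> U) f"
      by (rule Ck_on_cong[OF open_Int[OF V(1) assms] V(4) Ck_on_subset[OF V(3)]]) auto
    moreover have "open (V \<inter> U)" using V(1) assms by (rule open_Int)
    ultimately show "\<exists>V. open V \<and> x \<in> V \<and> Ck_on k V f" using V(2) \<open>x \<in> U\<close> by blast
  qed
qed (use assms smooth_map_Ck in blast)

lemma smooth_map_subset:
  assumes "smooth_map X f" "Y \<subseteq> X"
  shows "smooth_map Y f"
  using assms(1) unfolding smooth_map_def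
  by (meson assms(2) Int_mono order_refl subsetD)

lemma smooth_map_cong:
  assumes "smooth_map X f" "\<And>x. x \<in> X \<Longrightarrow> f x = g x"
  shows "smooth_map X g"
  using assms by (simp add: smooth_map_def)

text \<open>Used for maps defined by cases whose formulas agree on an open overlap.\<close>

lemma smooth_map_local:
  assumes "\<And>x. x \<in> X \<Longrightarrow> \<exists>U. open U \<and> x \<in> U \<and> smooth_map (X \<inter> U) f"
  shows "smooth_map X f"
proof (rule smooth_mapI)
  fix x assume x: "x \<in> X"
  then obtain U where U: "open U" "x \<in> U" "smooth_map (X \<inter> U) f" using assms by blast
  have "x \<in> X \<inter> U" using x U by simp
  with U(3) obtain V g where V: "open V" "x \<in> V" "\<forall>k. Ck_on k V g"
    "\<forall>y\<in>V. y \<in> X \<inter> U \<longrightarrow> g y = f y" by (rule smooth_mapE)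
  note V = V[rule_format]
  show "\<exists>U g. open U \<and> x \<in> U \<and> (\<forall>k. Ck_on k U g) \<and> (\<forall>y\<in>U. y \<in> X \<longrightarrow> g y = f y)"
    using U V Ck_on_subset[OF V(3), of "V \<inter> U"]
    by (intro exI[of _ "V \<inter> U"] exI[of _ g]) (simp add: open_Int)
qed

lemma smooth_map_compose:
  assumes f: "smooth_map X f" and g: "smooth_map Y g" and "f ` X \<subseteq> Y"
  shows "smooth_map X (\<lambda>x. g (f x))"
proof (rule smooth_mapI)
  fix x assume x: "x \<in> X"
  with f obtain U F where U: "open U" "x \<in> U" "\<forall>k. Ck_on k U F" "\<forall>y\<in>U. y \<in> X \<longrightarrow> F y = f y"
    by (rule smooth_mapE)
    note U = U[rule_format]
  have "f x \<in> Y" using assms x by blast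
  with g obtain V G where V: "open V" "f x \<in> V" "\<forall>k. Ck_on k V G" "\<forall>y\<in>V. y \<in> Y \<longrightarrow> G y = g y"
    by (rule smooth_mapE)
    note V = V[rule_format]
  have W: "open (U \<inter> F -` V)"
    using continuous_open_preimage[OF Ck_on_continuous[OF U(3)] U(1) V(1)] .
  have "Ck_on k (U \<inter> F -` V) (\<lambda>x. G (F x))" for k
    by (rule Ck_on_compose[OF W V(1) Ck_on_subset[OF U(3)] V(3)]) auto
  moreover have "\<forall>y\<in>U \<inter> F -` V. y \<in> X \<longrightarrow> G (F y) = g (f y)" using U(4) V(4) assms(3) by auto
  moreover have "x \<in> U \<inter> F -` V" using U V x by auto
  ultimately show "\<exists>U h. open U \<and> x \<in> U \<and> (\<forall>k. Ck_on k U h) \<and> (\<forall>y\<in>U. y \<in> X \<longrightarrow> h y = g (f y))"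
    using W by (intro exI[of _ "U \<inter> F -` V"] exI[of _ "\<lambda>x. G (F x)"]) simp
qed

lemma smooth_map_continuous_on: "smooth_map X f \<Longrightarrow> continuous_on X f"
  unfolding continuous_on_eq_continuous_within
proof
  fix x assume f: "smooth_map X f" and x: "x \<in> X"
  from f x obtain U F where U: "open U" "x \<in> U" "\<forall>k. Ck_on k U F" "\<forall>y\<in>U. y \<in> X \<longrightarrow> F y = f y"
    by (rule smooth_mapE)
    note U = U[rule_format]
  have "isCont F x" using Ck_on_continuous[OF U(3)] U by (simp add: continuous_on_eq_continuous_at)
  then have "continuous (at x within X) F" by (rule continuous_at_imp_continuous_at_within)
  then show "continuous (at x within X) f"
    by (rule continuous_transform_within_openin[where T = X and S = "X \<inter> U", OF _ openin_open_Int[OF U(1)]])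
      (use U x in auto)
qed

lemma smooth_map_common_extension:
  assumes f: "smooth_map X f" and g: "smooth_map X g" and x: "x \<in> X"
  obtains U F G where "open U" "x \<in> U" "\<forall>k. Ck_on k U F" "\<forall>k. Ck_on k U G"
    "\<forall>y\<in>U. y \<in> X \<longrightarrow> F y = f y" "\<forall>y\<in>U. y \<in> X \<longrightarrow> G y = g y"
proof -
  from f x obtain U F where U: "open U" "x \<in> U" "\<forall>k. Ck_on k U F" "\<forall>y\<in>U. y \<in> X \<longrightarrow> F y = f y"
    by (rule smooth_mapE)
    note U = U[rule_format]
  from g x obtain V G where V: "open V" "x \<in> V" "\<forall>k. Ck_on k V G" "\<forall>y\<in>V. y \<in> X \<longrightarrow> G y = g y"
    by (rule smooth_mapE)
    note V = V[rule_format]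
  show thesis
    by (rule that[of "U \<inter> V" F G])
      (use U V Ck_on_subset[OF U(3), of "U \<inter> V"] Ck_on_subset[OF V(3), of "U \<inter> V"] in \<open>simp_all add: open_Int\<close>)
qed

lemma smooth_map_const [smooth_intros]: "smooth_map X (\<lambda>x. c)"
  by (rule smooth_map_Ck[of UNIV]) (auto intro: Ck_on_const)

lemma smooth_map_linear: "bounded_linear L \<Longrightarrow> smooth_map X L"
  by (rule smooth_map_Ck[of UNIV]) (auto intro: Ck_on_linear)

lemma smooth_map_ident [smooth_intros]: "smooth_map X (\<lambda>x. x)"
  by (rule smooth_map_linear) (rule bounded_linear_ident)

lemma smooth_map_bounded_linear:
  "bounded_linear L \<Longrightarrow> smooth_map X f \<Longrightarrow> smooth_map X (\<lambda>x. L (f x))"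
  by (rule smooth_map_compose[of X f UNIV]) (auto intro: smooth_map_linear)

lemma smooth_map_bilinear:
  assumes "bounded_bilinear prd" "smooth_map X f" "smooth_map X g"
  shows "smooth_map X (\<lambda>x. prd (f x) (g x))"
proof (rule smooth_mapI)
  fix x assume x: "x \<in> X"
  from assms(2,3) x obtain U F G where "open U" "x \<in> U" "\<forall>k. Ck_on k U F" "\<forall>k. Ck_on k U G"
    "\<forall>y\<in>U. y \<in> X \<longrightarrow> F y = f y" "\<forall>y\<in>U. y \<in> X \<longrightarrow> G y = g y"
    by (rule smooth_map_common_extension)
  then show "\<exists>U h. open U \<and> x \<in> U \<and> (\<forall>k. Ck_on k U h) \<and> (\<forall>y\<in>U. y \<in> X \<longrightarrow> h y = prd (f y) (g y))"
    by (intro exI[of _ U] exI[of _ "\<lambda>x. prd (F x) (G x)"]) (simp add: Ck_on_bilinear[OF assms(1)])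
qed

lemma smooth_map_add [smooth_intros]:
  assumes "smooth_map X f" "smooth_map X g"
  shows "smooth_map X (\<lambda>x. f x + g x)"
proof (rule smooth_mapI)
  fix x assume x: "x \<in> X"
  from assms x obtain U F G where "open U" "x \<in> U" "\<forall>k. Ck_on k U F" "\<forall>k. Ck_on k U G"
    "\<forall>y\<in>U. y \<in> X \<longrightarrow> F y = f y" "\<forall>y\<in>U. y \<in> X \<longrightarrow> G y = g y"
    by (rule smooth_map_common_extension)
  then show "\<exists>U h. open U \<and> x \<in> U \<and> (\<forall>k. Ck_on k U h) \<and> (\<forall>y\<in>U. y \<in> X \<longrightarrow> h y = f y + g y)"
    by (intro exI[of _ U] exI[of _ "\<lambda>x. F x + G x"]) (simp add: Ck_on_add)
qed

lemmas smooth_map_scaleR [smooth_intros] = smooth_map_bilinear[OF bounded_bilinear_scaleR]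
  and smooth_map_mult [smooth_intros] = smooth_map_bilinear[OF bounded_bilinear_mult]
  and smooth_map_inner [smooth_intros] = smooth_map_bilinear[OF bounded_bilinear_inner]
  and smooth_map_fst [smooth_intros] = smooth_map_bounded_linear[OF bounded_linear_fst]
  and smooth_map_snd [smooth_intros] = smooth_map_bounded_linear[OF bounded_linear_snd]
  and smooth_map_Re [smooth_intros] = smooth_map_bounded_linear[OF bounded_linear_Re]
  and smooth_map_Im [smooth_intros] = smooth_map_bounded_linear[OF bounded_linear_Im]
  and smooth_map_cnj [smooth_intros] = smooth_map_bounded_linear[OF bounded_linear_cnj]

lemma smooth_map_minus [smooth_intros]: "smooth_map X f \<Longrightarrow> smooth_map X (\<lambda>x. - f x)"
  by (rule smooth_map_bounded_linear[OF bounded_linear_minus[OF bounded_linear_ident]])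

lemma smooth_map_diff [smooth_intros]:
  "smooth_map X f \<Longrightarrow> smooth_map X g \<Longrightarrow> smooth_map X (\<lambda>x. f x - g x)"
  unfolding diff_conv_add_uminus by (intro smooth_intros)

lemma smooth_map_sum [smooth_intros]:
  "(\<And>i. i \<in> I \<Longrightarrow> smooth_map X (f i)) \<Longrightarrow> smooth_map X (\<lambda>x. \<Sum>i\<in>I. f i x)"
  by (induction I rule: infinite_finite_induct) (auto intro: smooth_intros)

lemma smooth_map_power [smooth_intros]:
  fixes f :: "'a::euclidean_space \<Rightarrow> real"
  shows "smooth_map X f \<Longrightarrow> smooth_map X (\<lambda>x. f x ^ n)"
  by (induction n) (auto intro: smooth_intros)

lemma smooth_map_Pair [smooth_intros]:
  assumes "smooth_map X f" "smooth_map X g"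
  shows "smooth_map X (\<lambda>x. (f x, g x))"
proof -
  have "smooth_map X (\<lambda>x. (f x, 0) + (0, g x))"
    by (intro smooth_map_add smooth_map_bounded_linear[OF bounded_linear_Pair[OF bounded_linear_ident bounded_linear_zero]]
       smooth_map_bounded_linear[OF bounded_linear_Pair[OF bounded_linear_zero bounded_linear_ident]] assms)
  then show ?thesis by simp
qed

lemma smooth_map_if [smooth_intros]:
  "smooth_map X f \<Longrightarrow> smooth_map X g \<Longrightarrow> smooth_map X (\<lambda>x. if c then f x else g x)"
  by (cases c) simp_all

lemma smooth_map_sqrt [smooth_intros]:
  assumes "smooth_map X f" "\<And>x. x \<in> X \<Longrightarrow> f x > 0"
  shows "smooth_map X (\<lambda>x. sqrt (f x))"
proof (rule smooth_map_compose[OF assms(1) smooth_map_Ck[OF Ck_on_sqrt open_greaterThan order_refl]])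
  show "f ` X \<subseteq> {0<..}" using assms(2) by auto
qed

lemma smooth_map_inverse [smooth_intros]:
  fixes f :: "'a::euclidean_space \<Rightarrow> real"
  assumes "smooth_map X f" "\<And>x. x \<in> X \<Longrightarrow> f x \<noteq> 0"
  shows "smooth_map X (\<lambda>x. inverse (f x))"
proof (rule smooth_map_compose[OF assms(1) smooth_map_Ck[OF Ck_on_inverse_real _ order_refl]])
  show "f ` X \<subseteq> {x. x \<noteq> 0}" using assms(2) by auto
qed (simp add: open_Collect_neq)

lemma smooth_map_derivative:
  assumes "smooth_map U f" "open U" "x \<in> U"
  shows "(f has_derivative frechet_derivative f (at x)) (at x)"
  by (rule Ck_on_derivative[OF assms(1)[unfolded smooth_map_open_iff[OF assms(2)], rule_format] assms(3)])

section \<open>Diffeomorphisms\<close>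

lemma diffeoI:
  assumes "\<And>x. x \<in> X \<Longrightarrow> f x \<in> Y" "\<And>y. y \<in> Y \<Longrightarrow> g y \<in> X"
    "\<And>x. x \<in> X \<Longrightarrow> g (f x) = x" "\<And>y. y \<in> Y \<Longrightarrow> f (g y) = y"
    "smooth_map X f" "smooth_map Y g"
  shows "diffeo X Y f"
proof -
  have bij: "bij_betw f X Y" by (rule bij_betw_byWitness[where f' = g]) (use assms in auto)
  have "smooth_map Y (inv_into X f)"
  proof (rule smooth_map_cong[OF assms(6)])
    fix y assume "y \<in> Y"
    then show "g y = inv_into X f y"
      using bij assms(2,4) by (metis bij_betw_inv_into_left)
  qed
  then show ?thesis using bij assms by (simp add: diffeo_def)
qed

lemma
  assumes "diffeo X Y f"
  shows diffeo_image: "f ` X = Y"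
    and diffeo_in: "x \<in> X \<Longrightarrow> f x \<in> Y"
    and diffeo_inv_in: "y \<in> Y \<Longrightarrow> inv_into X f y \<in> X"
    and diffeo_inv_left: "x \<in> X \<Longrightarrow> inv_into X f (f x) = x"
    and diffeo_inv_right: "y \<in> Y \<Longrightarrow> f (inv_into X f y) = y"
    and diffeo_smooth: "smooth_map X f"
    and diffeo_inv_smooth: "smooth_map Y (inv_into X f)"
proof -
  have bij: "bij_betw f X Y" and "smooth_map X f" "smooth_map Y (inv_into X f)"
    using assms by (auto simp: diffeo_def)
  then show "smooth_map X f" "smooth_map Y (inv_into X f)" by auto
  show im: "f ` X = Y" using bij by (rule bij_betw_imp_surj_on)
  show "x \<in> X \<Longrightarrow> f x \<in> Y" using im by blast
  show "y \<in> Y \<Longrightarrow> inv_into X f y \<in> X" using im by (simp add: inv_into_into)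
  show "y \<in> Y \<Longrightarrow> f (inv_into X f y) = y" using im by (simp add: f_inv_into_f)
  show "x \<in> X \<Longrightarrow> inv_into X f (f x) = x" using bij_betw_imp_inj_on[OF bij] by (rule inv_into_f_f)
qed

lemma diffeo_compose:
  assumes f: "diffeo X Y f" and g: "diffeo Y Z g"
  shows "diffeo X Z (\<lambda>x. g (f x))"
proof (rule diffeoI[where g = "\<lambda>z. inv_into X f (inv_into Y g z)"])
  show "smooth_map X (\<lambda>x. g (f x))"
    by (rule smooth_map_compose[OF diffeo_smooth[OF f] diffeo_smooth[OF g]]) (simp add: diffeo_image[OF f])
  show "smooth_map Z (\<lambda>z. inv_into X f (inv_into Y g z))"
    by (rule smooth_map_compose[OF diffeo_inv_smooth[OF g] diffeo_inv_smooth[OF f]])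
      (auto intro: diffeo_inv_in[OF g])
qed (auto simp: diffeo_in[OF f] diffeo_in[OF g] diffeo_inv_in[OF f] diffeo_inv_in[OF g]
    diffeo_inv_left[OF f] diffeo_inv_left[OF g] diffeo_inv_right[OF f] diffeo_inv_right[OF g])

text \<open>The form of restriction needed to transport a chart along a diffeomorphism.\<close>

lemma diffeo_restrict_inverse:
  assumes f: "diffeo X Y f" and U: "U \<subseteq> X"
  shows "diffeo (f ` U) U (inv_into X f)"
proof -
  have "f ` U \<subseteq> Y" using diffeo_image[OF f] U by blast
  moreover have "inv_into X f (f x) = x" if "x \<in> U" for x using diffeo_inv_left[OF f] U that by blast
  ultimately show ?thesis
    by (intro diffeoI[where g = f] smooth_map_subset[OF diffeo_smooth[OF f] U]
        smooth_map_subset[OF diffeo_inv_smooth[OF f]]) auto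
qed

lemma diffeo_openin_image:
  assumes f: "diffeo X Y f" and U: "openin (top_of_set X) U"
  shows "openin (top_of_set Y) (f ` U)"
proof -
  have "homeomorphism X Y f (inv_into X f)"
    by (rule homeomorphismI)
      (use diffeo_in[OF f] in \<open>auto simp: diffeo_inv_left[OF f] diffeo_inv_right[OF f] diffeo_inv_in[OF f]
       smooth_map_continuous_on[OF diffeo_smooth[OF f]] smooth_map_continuous_on[OF diffeo_inv_smooth[OF f]]\<close>)
  then show ?thesis using homeomorphism_imp_open_map U by blast
qed

lemma interior_point_diffeo:
  fixes X Y :: "'a::euclidean_space set"
  assumes f: "diffeo X Y f" and x: "interior_point d X x"
  shows "interior_point d Y (f x)"
proof -
  obtain T :: "'a set" and U V h where T: "subspace T" "dim T = d" "openin (top_of_set X) U" "x \<in> U"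
    "openin (top_of_set T) V" "diffeo U V h" using x unfolding interior_point_def by blast
  have "U \<subseteq> X" using T(3) openin_imp_subset by blast
  then show ?thesis unfolding interior_point_def
    using T diffeo_openin_image[OF f T(3)] diffeo_compose[OF diffeo_restrict_inverse[OF f \<open>U \<subseteq> X\<close>] T(6)]
    by (intro exI[of _ T] exI[of _ "f ` U"] exI[of _ V] exI[of _ "\<lambda>x. h (inv_into X f x)"]) simp
qed

lemma boundary_point_diffeo:
  fixes X Y :: "'a::euclidean_space set"
  assumes f: "diffeo X Y f" and x: "boundary_point d X x"
  shows "boundary_point d Y (f x)"
proof -
  obtain T :: "'a set" and e U V h where T: "subspace T" "dim T = d" "e \<in> T" "e \<noteq> 0" "openin (top_of_set X) U" "x \<in> U"
    "openin (top_of_set (T \<inter> {y. 0 \<le> e \<bullet> y})) V" "diffeo U V h" "e \<bullet> h x = 0"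
    using x unfolding boundary_point_def by blast
  have UX: "U \<subseteq> X" using T(5) openin_imp_subset by blast
  have "inv_into X f (f x) = x" using diffeo_inv_left[OF f] T(6) UX by blast
  then have e: "e \<bullet> h (inv_into X f (f x)) = 0" using T(9) by simp
  show ?thesis unfolding boundary_point_def
    using T e diffeo_openin_image[OF f T(5)] diffeo_compose[OF diffeo_restrict_inverse[OF f UX] T(8)]
    by (intro exI[of _ T] exI[of _ e] exI[of _ "f ` U"] exI[of _ V] exI[of _ "\<lambda>x. h (inv_into X f x)"]) simp
qed

lemma diffeo_inverse: "diffeo X Y f \<Longrightarrow> diffeo Y X (inv_into X f)"
  using diffeo_restrict_inverse[of X Y f X] by (simp add: diffeo_image)

lemma manifold_with_boundary_diffeo:
  fixes X Y :: "'a::euclidean_space set"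
  assumes "diffeo X Y f" "manifold_with_boundary d X"
  shows "manifold_with_boundary d Y"
proof -
  have "Y = f ` X" using diffeo_image[OF assms(1)] by simp
  then show ?thesis
    using assms interior_point_diffeo[OF assms(1)] boundary_point_diffeo[OF assms(1)]
    unfolding manifold_with_boundary_def by blast
qed

lemma manifold_boundary_diffeo:
  fixes X Y :: "'a::euclidean_space set"
  assumes f: "diffeo X Y f"
  shows "manifold_boundary d Y = f ` manifold_boundary d X"
proof -
  have Y: "Y = f ` X" using diffeo_image[OF f] by simp
  have "boundary_point d Y (f x) \<longleftrightarrow> boundary_point d X x" if "x \<in> X" for x
    using boundary_point_diffeo[OF f, of d x] boundary_point_diffeo[OF diffeo_inverse[OF f], of d "f x"]
      diffeo_inv_left[OF f that] by auto
  then show ?thesis unfolding manifold_boundary_def Y by auto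
qed

section \<open>A diffeomorphism of the line pushing in the end of a half-line\<close>

text \<open>The diffeomorphism is \<open>\<phi> t = t + exp (- 1 / (L - t)) / 4\<close> for \<open>t < L\<close>, and \<open>\<phi> t = t\<close> otherwise. Its derivative is
positive because \<open>y\<^sup>2 < 4 exp y\<close> for \<open>y = 1 / (L - t)\<close>.\<close>

lemma half_line_push:
  fixes L :: real
  assumes L: "L > 0"
  obtains \<phi> \<psi> :: "real \<Rightarrow> real" and \<epsilon> :: real where "0 < \<epsilon>" "\<epsilon> < L" "smooth_map {0..} \<phi>" "smooth_map {\<epsilon>..} \<psi>" "\<phi> 0 = \<epsilon>"
    "\<forall>t\<ge>0. \<phi> t \<ge> \<epsilon> \<and> \<psi> (\<phi> t) = t \<and> (t < L \<longleftrightarrow> \<phi> t < L)"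
    "\<forall>t\<ge>\<epsilon>. \<psi> t \<ge> 0 \<and> \<phi> (\<psi> t) = t \<and> (t < L \<longleftrightarrow> \<psi> t < L)"
    "\<forall>t\<ge>L. \<phi> t = t \<and> \<psi> t = t"
proof -
  define \<phi> where "\<phi> t = t + flat 0 (L - t) * (1/4)" for t
  define \<phi>' where "\<phi>' t = 1 - flat 2 (L - t) * (1/4)" for t
  have D: "(\<phi> has_real_derivative \<phi>' t) (at t)" for t
  proof -
    have "(flat 0 has_real_derivative flat 2 y) (at y)" for y
      using flat_derivative[of 0 y] by (simp add: numeral_2_eq_2)
    then have "((\<lambda>t. flat 0 (L - t)) has_real_derivative flat 2 (L - t) * (- 1)) (at t)"
      by (rule DERIV_chain2) (auto intro!: derivative_eq_intros)
    then show ?thesis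
      unfolding \<phi>_def \<phi>'_def by (auto intro!: derivative_eq_intros)
  qed
  have "flat 2 x < 4" for x
  proof (cases "x > 0")
    case True
    define y where "y = inverse x"
    have y: "y > 0" using True by (simp add: y_def)
    have "y\<^sup>2 < 4 * (1 + y/2)\<^sup>2" using y by (simp add: power2_eq_square algebra_simps)
    also have "\<dots> \<le> 4 * (exp (y/2))\<^sup>2" using y by (intro mult_left_mono power_mono) auto
    also have "\<dots> = 4 * exp y" by (simp add: power2_eq_square flip: exp_add)
    finally show ?thesis using True unfolding flat_def y_def[symmetric] by (simp add: exp_minus field_simps)
  qed (simp add: flat_def)
  then have pos: "\<phi>' t > 0" for t by (simp add: \<phi>'_def)
  have mono: "\<phi> s < \<phi> t" if "s < t" for s t
    using DERIV_pos_imp_increasing[OF that] D pos by blast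
  then have less: "\<phi> s < \<phi> t \<longleftrightarrow> s < t" for s t by (metis not_less_iff_gr_or_eq)
  have inj: "inj \<phi>" by (rule injI) (metis mono not_less_iff_gr_or_eq less_irrefl)
  define \<psi> where "\<psi> = inv \<phi>"
  have \<psi>\<phi>: "\<psi> (\<phi> t) = t" for t using inj by (simp add: \<psi>_def)
  have fixed: "\<phi> t = t" if "t \<ge> L" for t using that by (simp add: \<phi>_def flat_def)
  have Ck: "Ck_on k UNIV \<phi>" for k
  proof -
    have "smooth_map UNIV \<phi>" unfolding \<phi>_def
      by (intro smooth_intros smooth_map_compose[of UNIV "\<lambda>t. L - t" UNIV "flat 0"] smooth_map_Ck[OF Ck_on_flat]) auto
    then show ?thesis using smooth_map_open_iff by blast
  qed
  have injD: "inj (frechet_derivative \<phi> (at t))" for t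
  proof -
    have "frechet_derivative \<phi> (at t) = (*) (\<phi>' t)"
      using frechet_derivative_at[OF D[of t, unfolded has_field_derivative_def]] by simp
    then show ?thesis using pos[of t] by (auto simp: inj_def)
  qed
  define \<epsilon> where "\<epsilon> = \<phi> 0"
  have \<epsilon>: "0 < \<epsilon>" "\<epsilon> < L" using mono[OF L] fixed[of L] L by (auto simp: \<epsilon>_def \<phi>_def flat_def)
  have surj: "t \<in> range \<phi>" if "t \<ge> \<epsilon>" for t
  proof -
    have "\<exists>x\<ge>0. x \<le> max t L \<and> \<phi> x = t"
      by (rule IVT') (use that fixed[of "max t L"] L Ck_on_continuous[OF Ck] in \<open>auto simp: \<epsilon>_def intro: continuous_on_subset\<close>)
    then show ?thesis by auto
  qed
  have \<phi>\<psi>: "\<phi> (\<psi> t) = t" if "t \<ge> \<epsilon>" for t using surj[OF that] \<psi>\<phi> by auto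
  have nn: "\<psi> t \<ge> 0" if "t \<ge> \<epsilon>" for t using \<phi>\<psi>[OF that] that less[of "\<psi> t" 0] unfolding \<epsilon>_def by force
  show thesis
  proof (rule that[OF \<epsilon>]; (intro allI impI)?)
    show "smooth_map {0..} \<phi>" by (rule smooth_map_Ck[OF Ck]) auto
    show "smooth_map {\<epsilon>..} \<psi>"
      by (rule smooth_map_Ck[OF Ck_on_inverse(2)[OF open_UNIV Ck, of \<psi>] Ck_on_inverse(1)[OF open_UNIV Ck, of \<psi>]])
        (use \<psi>\<phi> injD surj in auto)
    show "\<phi> 0 = \<epsilon>" by (simp add: \<epsilon>_def)
    show "\<phi> t \<ge> \<epsilon> \<and> \<psi> (\<phi> t) = t \<and> (t < L \<longleftrightarrow> \<phi> t < L)" if "t \<ge> 0" for t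
      using that \<psi>\<phi> less[of t L] less[of t 0] fixed[of L] unfolding \<epsilon>_def by auto
    show "\<psi> t \<ge> 0 \<and> \<phi> (\<psi> t) = t \<and> (t < L \<longleftrightarrow> \<psi> t < L)" if "t \<ge> \<epsilon>" for t
      using that \<phi>\<psi>[OF that] nn[OF that] less[of "\<psi> t" L] fixed[of L] by auto
    show "\<phi> t = t \<and> \<psi> t = t" if "t \<ge> L" for t using fixed[OF that] \<psi>\<phi>[of t] by auto
  qed
qed

section \<open>Velocities of curves\<close>

text \<open>One-sided derivatives are needed because a curve that starts on the boundary of a manifold need
not extend to negative times.\<close>

lemma has_vector_derivative_constant_right:
  fixes f :: "real \<Rightarrow> 'b::real_normed_vector"
  assumes f: "(f has_vector_derivative v) (at 0 within {0..})" and \<delta>: "\<delta> > 0"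
    and c: "\<And>t. 0 \<le> t \<Longrightarrow> t < \<delta> \<Longrightarrow> f t = c + t *\<^sub>R e"
  shows "v = e"
proof -
  have "((\<lambda>t. c + t *\<^sub>R e) has_vector_derivative e) (at 0 within {0..})"
    by (auto intro!: derivative_eq_intros simp: has_vector_derivative_def)
  then have fe: "(f has_vector_derivative e) (at 0 within {0..})"
    by (rule has_vector_derivative_transform_within[OF _ \<delta>]) (use c in \<open>auto simp: dist_real_def\<close>)
  show ?thesis
    by (rule vector_derivative_unique_within[OF _ f fe]) (simp add: trivial_limit_at_right_real at_within_Ici_at_right)
qed

text \<open>A boundary point is recognized by a velocity that can be reached from one side only. In a
half-space chart \<open>f\<close>, let the curve \<open>\<gamma>\<close> leave \<open>x\<close> in the direction \<open>e\<close>, with velocity \<open>u\<close>. If a curve \<open>c\<close> defined on both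
sides of \<open>0\<close> had the same velocity, the function \<open>e \<bullet> f (c t)\<close> would have a minimum at \<open>0\<close>, so its derivative
there would vanish; but this derivative depends only on \<open>u\<close> and equals \<open>e \<bullet> e\<close> by computing it along \<open>\<gamma>\<close>.\<close>

lemma boundary_point_inward_curve:
  fixes X :: "'a::euclidean_space set"
  assumes "boundary_point d X x"
  obtains \<gamma> u \<delta> where "0 < \<delta>" "(\<gamma> has_vector_derivative u) (at 0 within {0..})" "\<gamma> 0 = x"
    "\<forall>t. 0 \<le> t \<and> t < \<delta> \<longrightarrow> \<gamma> t \<in> X" "u \<notin> tangent_space X x"
proof -
  obtain T :: "'a set" and e U V f where T: "subspace T" "e \<in> T" "e \<noteq> 0" "openin (top_of_set X) U" "x \<in> U"
    "openin (top_of_set (T \<inter> {y. 0 \<le> e \<bullet> y})) V" and f: "diffeo U V f" and e0: "e \<bullet> f x = 0"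
    using assms unfolding boundary_point_def by blast
  obtain U' where U': "open U'" "U = X \<inter> U'" using T(4) by (auto simp: openin_open)
  obtain V' where V': "open V'" "V = T \<inter> {y. 0 \<le> e \<bullet> y} \<inter> V'" using T(6) by (auto simp: openin_open)
  define g where "g = inv_into U f"
  have fx: "f x \<in> V" using diffeo_in[OF f T(5)] .
  from diffeo_smooth[OF f] T(5) obtain N F where N: "open N" "x \<in> N" "\<forall>k. Ck_on k N F"
    "\<forall>y\<in>N. y \<in> U \<longrightarrow> F y = f y" by (rule smooth_mapE)
  from diffeo_inv_smooth[OF f] fx obtain L G where L: "open L" "f x \<in> L" "\<forall>k. Ck_on k L G"
    "\<forall>y\<in>L. y \<in> V \<longrightarrow> G y = inv_into U f y" by (rule smooth_mapE)
  define F' where "F' = frechet_derivative F (at x)"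
  define G' where "G' = frechet_derivative G (at (f x))"
  have F': "(F has_derivative F') (at x)"
    unfolding F'_def by (rule Ck_on_derivative[OF N(3)[rule_format] N(2)])
  have G': "(G has_derivative G') (at (f x))"
    unfolding G'_def by (rule Ck_on_derivative[OF L(3)[rule_format] L(2)])
  define \<gamma> where "\<gamma> t = G (f x + t *\<^sub>R e)" for t :: real
  define u where "u = G' e"
  have Gfx: "G (f x) = x" using L(2,4) fx diffeo_inv_left[OF f T(5)] by simp
  have line: "((\<lambda>t::real. f x + t *\<^sub>R e) has_derivative (\<lambda>t. t *\<^sub>R e)) (at 0)"
    by (auto intro!: derivative_eq_intros)
  have "(\<gamma> has_derivative (\<lambda>t. G' (t *\<^sub>R e))) (at 0)"
    using diff_chain_at[OF line, of G G'] G' by (simp add: \<gamma>_def[abs_def] o_def)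
  then have \<gamma>': "(\<gamma> has_vector_derivative u) (at 0)"
    by (simp add: has_vector_derivative_def u_def linear_cmul[OF has_derivative_linear[OF G']])
  have \<gamma>0: "\<gamma> 0 = x" by (simp add: \<gamma>_def Gfx)
  have "continuous (at 0) \<gamma>" using \<gamma>' has_vector_derivative_continuous by blast
  then have c1: "\<forall>\<^sub>F t in at 0. \<gamma> t \<in> N"
    using topological_tendstoD[of \<gamma> x "at 0" N] N \<gamma>0 by (simp add: isCont_def)
  have "isCont (\<lambda>t::real. f x + t *\<^sub>R e) 0" by (intro continuous_intros)
  then have "((\<lambda>t::real. f x + t *\<^sub>R e) \<longlongrightarrow> f x) (at 0)" by (simp add: isCont_def)
  then have c2: "\<forall>\<^sub>F t::real in at 0. f x + t *\<^sub>R e \<in> L \<inter> V'"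
    using topological_tendstoD[of _ "f x" "at 0" "L \<inter> V'"] L V' fx by auto
  from eventually_conj[OF c1 c2] obtain \<delta> where \<delta>: "\<delta> > 0"
    "\<And>t. t \<noteq> 0 \<Longrightarrow> \<bar>t\<bar> < \<delta> \<Longrightarrow> \<gamma> t \<in> N \<and> f x + t *\<^sub>R e \<in> L \<inter> V'"
    unfolding eventually_at by (auto simp: dist_real_def)
  have near: "\<gamma> t \<in> N" "f x + t *\<^sub>R e \<in> L \<inter> V'" if "\<bar>t\<bar> < \<delta>" for t
    using \<delta>(2)[of t] that \<gamma>0 N L V' fx by (cases "t = 0"; simp)+
  have inV: "f x + t *\<^sub>R e \<in> V" if "0 \<le> t" "t < \<delta>" for t
    using near(2)[of t] that fx T(1,2) e0 unfolding V'
    by (auto simp: inner_add_right subspace_add subspace_scale)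
  have inU: "\<gamma> t \<in> U" "F (\<gamma> t) = f x + t *\<^sub>R e" if "0 \<le> t" "t < \<delta>" for t
  proof -
    have *: "\<gamma> t = inv_into U f (f x + t *\<^sub>R e)" using L(4) near(2)[of t] inV[OF that] that by (simp add: \<gamma>_def)
    then show "\<gamma> t \<in> U" using diffeo_inv_in[OF f inV[OF that]] by simp
    then show "F (\<gamma> t) = f x + t *\<^sub>R e"
      using N(4) near(1)[of t] that * diffeo_inv_right[OF f inV[OF that]] by simp
  qed
  \<comment> \<open>\<open>F\<close> extends the chart to a neighbourhood of \<open>x\<close>, which makes the chain rule available along both curves.\<close>
  have "u \<notin> tangent_space X x"
  proof
    assume "u \<in> tangent_space X x"
    then obtain c \<epsilon> where c: "0 < \<epsilon>" "c ` {-\<epsilon><..<\<epsilon>} \<subseteq> X" "c 0 = x" "(c has_vector_derivative u) (at 0)"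
      unfolding tangent_space_def by blast
    have "continuous (at 0) c" using c(4) has_vector_derivative_continuous by blast
    then have "\<forall>\<^sub>F t in at 0. c t \<in> N \<inter> U'"
      using topological_tendstoD[of c x "at 0" "N \<inter> U'"] N U' c(3) T(5) by (auto simp: isCont_def)
    then obtain \<eta> where \<eta>: "\<eta> > 0" "\<And>t. t \<noteq> 0 \<Longrightarrow> \<bar>t\<bar> < \<eta> \<Longrightarrow> c t \<in> N \<inter> U'"
      unfolding eventually_at by (auto simp: dist_real_def)
    have "((\<lambda>t. F (c t)) has_derivative (\<lambda>t. F' (t *\<^sub>R u))) (at 0)"
      using diff_chain_at[of c "\<lambda>t. t *\<^sub>R u" 0 F F'] c(3,4) F' by (simp add: o_def has_vector_derivative_def)
    then have "((\<lambda>t. e \<bullet> F (c t)) has_derivative (\<lambda>t. e \<bullet> F' (t *\<^sub>R u))) (at 0)"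
      by (rule bounded_linear.has_derivative[OF bounded_linear_inner_right])
    moreover have "(\<lambda>t. e \<bullet> F' (t *\<^sub>R u)) = (*) (e \<bullet> F' u)"
      by (auto simp: linear_cmul[OF has_derivative_linear[OF F']])
    ultimately have D: "((\<lambda>t. e \<bullet> F (c t)) has_real_derivative e \<bullet> F' u) (at 0)"
      by (simp add: has_field_derivative_def)
    have Fx: "F x = f x" using N T(5) by simp
    have min: "e \<bullet> F (c 0) \<le> e \<bullet> F (c t)" if "\<bar>0 - t\<bar> < min \<epsilon> \<eta>" for t
    proof (cases "t = 0")
      case False
      have "t \<in> {-\<epsilon><..<\<epsilon>}" using that by auto
      then have "c t \<in> N \<inter> U'" "c t \<in> X" using False \<eta>(2)[of t] c(2) that by auto
      then have "c t \<in> U" "F (c t) = f (c t)" using U' N(4) by auto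
      then show ?thesis using diffeo_in[OF f, of "c t"] V' c(3) Fx e0 by auto
    qed simp
    have z: "e \<bullet> F' u = 0"
      by (rule DERIV_local_min[OF D, of "min \<epsilon> \<eta>"]) (use c(1) \<eta>(1) min in auto)
    have "((\<lambda>t. F (\<gamma> t)) has_derivative (\<lambda>t. F' (t *\<^sub>R u))) (at 0)"
      using diff_chain_at[of \<gamma> "\<lambda>t. t *\<^sub>R u" 0 F F'] \<gamma>0 \<gamma>' F' by (simp add: o_def has_vector_derivative_def)
    then have "((\<lambda>t. F (\<gamma> t)) has_vector_derivative F' u) (at 0)"
      by (simp add: has_vector_derivative_def linear_cmul[OF has_derivative_linear[OF F']])
    then have "F' u = e"
      using has_vector_derivative_constant_right[OF has_vector_derivative_at_within \<delta>(1) inU(2)] by blast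
    then show False using z T(3) by simp
  qed
  then show thesis
    using that[OF \<delta>(1) has_vector_derivative_at_within[OF \<gamma>'] \<gamma>0] inU(1) U' by blast
qed

section \<open>Transverse intersections of coaxial quadrics\<close>

text \<open>Quadrics with common axes: their equations involve only the squares of the coordinates. The spanning
condition says that the differentials of the equations have constant rank on \<open>M\<close>.\<close>

locale coaxial_quadrics =
  fixes \<nu> :: "'a::euclidean_space \<Rightarrow> 'w::euclidean_space" and c0 :: 'w
  assumes spanning: "(\<Sum>b\<in>Basis. (x \<bullet> b)\<^sup>2 *\<^sub>R \<nu> b) = c0
      \<Longrightarrow> \<nu> ` Basis \<subseteq> span (\<nu> ` {b\<in>Basis. x \<bullet> b \<noteq> 0})"
    and bounded_solutions: "bounded {x. (\<Sum>b\<in>Basis. (x \<bullet> b)\<^sup>2 *\<^sub>R \<nu> b) = c0}"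
begin

definition Q :: "'a \<Rightarrow> 'w" where "Q x = (\<Sum>b\<in>Basis. (x \<bullet> b)\<^sup>2 *\<^sub>R \<nu> b)"
definition M :: "'a set" where "M = {x. Q x = c0}"
definition slice :: "'a set \<Rightarrow> 'a set" where "slice C = {x \<in> M. \<forall>c\<in>C. x \<bullet> c = 0}"
definition rank :: nat where "rank = dim (\<nu> ` (Basis :: 'a set))"

text \<open>Membership of \<open>w\<close> in the kernel of the differential of \<open>Q\<close> at \<open>x\<close>, up to a factor 2.\<close>

definition tangential :: "'a \<Rightarrow> 'a \<Rightarrow> bool" where
  "tangential x w \<longleftrightarrow> (\<Sum>b\<in>Basis. ((x \<bullet> b) * (w \<bullet> b)) *\<^sub>R \<nu> b) = 0"

text \<open>Choose \<open>K\<close> in the support of \<open>x\<close> such that the vectors \<open>\<nu> i\<close> with \<open>i \<in> K\<close> form a basis of the span of all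
\<open>\<nu> b\<close>, and let \<open>g i\<close> be the dual coordinate functionals. Applied to the equation \<open>Q y = c0\<close>, they show that
it is equivalent to \<open>(y \<bullet> i)\<^sup>2 = D i y\<close> for \<open>i \<in> K\<close>, where \<open>D i y\<close> involves only the coordinates outside \<open>K\<close>. So
\<open>S\<close>, which keeps those coordinates and puts the square root of \<open>D i y\<close>, with the sign of \<open>x \<bullet> i\<close>, into the
others, maps the open set where all \<open>D i y\<close> are positive into \<open>M\<close> and fixes the points of \<open>M\<close> with the signs of
\<open>x\<close>.\<close>

lemma local_section:
  assumes x: "x \<in> M"
  obtains K O' :: "'a set" and S :: "'a \<Rightarrow> 'a" where "K \<subseteq> Basis" "\<forall>i\<in>K. x \<bullet> i \<noteq> 0" "card K = rank"
    "\<forall>u. (\<Sum>i\<in>K. u i *\<^sub>R \<nu> i) = 0 \<longrightarrow> (\<forall>i\<in>K. u i = 0)"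
    "open O'" "smooth_map O' S" "\<forall>y\<in>O'. S y \<in> M"
    "\<forall>y. \<forall>b\<in>Basis - K. S y \<bullet> b = y \<bullet> b"
    "\<forall>y\<in>O'. \<forall>i\<in>K. (S y \<bullet> i) * (x \<bullet> i) > 0"
    "\<forall>y\<in>M. (\<forall>i\<in>K. (y \<bullet> i) * (x \<bullet> i) > 0) \<longrightarrow> y \<in> O' \<and> S y = y"
    "\<forall>y z. (\<forall>b\<in>Basis - K. y \<bullet> b = z \<bullet> b) \<longrightarrow> (y \<in> O' \<longleftrightarrow> z \<in> O') \<and> S y = S z"
proof -
  let ?s = "{b\<in>Basis. x \<bullet> b \<noteq> 0}"
  obtain B where B: "B \<subseteq> \<nu> ` ?s" "independent B" "\<nu> ` ?s \<subseteq> span B" "card B = dim (\<nu> ` ?s)"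
    using basis_exists by blast
  obtain K where K: "K \<subseteq> ?s" "inj_on \<nu> K" "B = \<nu> ` K" using B(1) by (auto simp: subset_image_inj)
  have finK: "finite K" by (rule finite_subset[OF K(1)]) simp
  have sup: "\<nu> ` Basis \<subseteq> span (\<nu> ` ?s)" using spanning x by (auto simp: M_def Q_def)
  have spanB: "\<nu> ` Basis \<subseteq> span B"
    using sup span_minimal[OF B(3) subspace_span] by blast
  have "span (\<nu> ` Basis) \<subseteq> span (\<nu> ` ?s)" by (rule span_minimal[OF sup subspace_span])
  moreover have "span (\<nu> ` ?s) \<subseteq> span (\<nu> ` Basis)" by (rule span_mono) auto
  ultimately have "span (\<nu> ` ?s) = span (\<nu> ` Basis)" by (rule antisym[rotated])
  then have "dim (\<nu> ` ?s) = rank" unfolding rank_def by (rule span_eq_dim)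
  then have cardK: "card K = rank" using B(4) K(2,3) by (simp add: card_image)
  have "\<forall>i. \<exists>g. linear g \<and> (\<forall>v\<in>B. g v = (if v = \<nu> i then 1 else 0::real))"
    by (intro allI linear_independent_extend[OF B(2)])
  from choice[OF this] obtain g :: "'a \<Rightarrow> 'w \<Rightarrow> real"
    where g': "\<forall>i. linear (g i) \<and> (\<forall>v\<in>B. g i v = (if v = \<nu> i then 1 else 0))" ..
  then have g: "\<And>i. linear (g i)" "\<And>i v. v \<in> B \<Longrightarrow> g i v = (if v = \<nu> i then 1 else 0)"
    by simp_all
  have g\<nu>: "g i (\<nu> j) = (if j = i then 1 else 0)" if "i \<in> K" "j \<in> K" for i j
    using g(2)[of "\<nu> j" i] that K(2,3) by (auto simp: inj_on_eq_iff)
  have gsum: "g i (\<Sum>j\<in>K. u j *\<^sub>R \<nu> j) = u i" if "i \<in> K" for i u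
    using that finK by (simp add: linear_sum[OF g(1)] linear_cmul[OF g(1)] g\<nu> if_distrib cong: if_cong)
  have sep: "v = 0" if v: "v \<in> span B" "\<And>i. i \<in> K \<Longrightarrow> g i v = 0" for v
  proof -
    have "finite B" using K(3) finK by simp
    then obtain a where a: "v = (\<Sum>w\<in>B. a w *\<^sub>R w)" using v(1) by (auto simp: span_finite)
    then have a': "v = (\<Sum>j\<in>K. a (\<nu> j) *\<^sub>R \<nu> j)" using K(2,3) by (simp add: sum.reindex)
    then show ?thesis using gsum[of _ "\<lambda>j. a (\<nu> j)"] v(2) by simp
  qed
  define D where "D i y = g i c0 - (\<Sum>l\<in>Basis - K. (y \<bullet> l)\<^sup>2 * g i (\<nu> l))" for i y
  have QB: "Q y \<in> span B" for y unfolding Q_def using spanB by (intro span_sum span_scale) auto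
  have gQ: "g i (Q y - c0) = (y \<bullet> i)\<^sup>2 - D i y" if "i \<in> K" for i y
  proof -
    have "Q y = (\<Sum>l\<in>Basis - K. (y \<bullet> l)\<^sup>2 *\<^sub>R \<nu> l) + (\<Sum>l\<in>K. (y \<bullet> l)\<^sup>2 *\<^sub>R \<nu> l)"
      unfolding Q_def using K(1) by (intro sum.subset_diff) auto
    then have "g i (Q y) = (\<Sum>l\<in>Basis - K. (y \<bullet> l)\<^sup>2 * g i (\<nu> l)) + (y \<bullet> i)\<^sup>2"
      using gsum[OF that, of "\<lambda>l. (y \<bullet> l)\<^sup>2"]
      by (simp add: linear_add[OF g(1)]) (simp add: linear_sum[OF g(1)] linear_cmul[OF g(1)])
    then show ?thesis by (simp add: linear_diff[OF g(1)] D_def)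
  qed
  have M_iff: "y \<in> M \<longleftrightarrow> (\<forall>i\<in>K. (y \<bullet> i)\<^sup>2 = D i y)" for y
  proof
    assume "y \<in> M"
    then have "Q y - c0 = 0" by (simp add: M_def)
    then show "\<forall>i\<in>K. (y \<bullet> i)\<^sup>2 = D i y" using gQ[of _ y] linear_0[OF g(1)] by force
  next
    assume *: "\<forall>i\<in>K. (y \<bullet> i)\<^sup>2 = D i y"
    have "Q y - c0 = 0"
    proof (rule sep)
      have "c0 = Q x" using x by (simp add: M_def)
      then show "Q y - c0 \<in> span B" using QB by (simp add: span_diff)
    qed (use * gQ in auto)
    then show "y \<in> M" by (simp add: M_def)
  qed
  define O' where "O' = (\<Inter>i\<in>K. {y. 0 < D i y})"
  define S where "S y = (\<Sum>b\<in>Basis. (if b \<in> K then sgn (x \<bullet> b) * sqrt (D b y) else y \<bullet> b) *\<^sub>R b)" for y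
  have Sb: "S y \<bullet> b = (if b \<in> K then sgn (x \<bullet> b) * sqrt (D b y) else y \<bullet> b)" if "b \<in> Basis" for y b
    unfolding S_def using that by simp
  have Dcong: "D i y = D i z" if "\<forall>b\<in>Basis - K. y \<bullet> b = z \<bullet> b" for i y z
    unfolding D_def by (intro arg_cong[where f = "\<lambda>v. g i c0 - v"] sum.cong) (use that in auto)
  show thesis
  proof (rule that[of K O' S]; (intro allI ballI impI)?)
    show "K \<subseteq> Basis" using K by auto
    show "x \<bullet> i \<noteq> 0" if "i \<in> K" for i using that K by auto
    show "card K = rank" by (rule cardK)
    show "u i = 0" if "(\<Sum>i\<in>K. u i *\<^sub>R \<nu> i) = 0" "i \<in> K" for u i
      using gsum[OF that(2), of u] that linear_0[OF g(1)] by simp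
    show "open O'" unfolding O'_def D_def
      by (intro open_INT finK ballI open_Collect_less continuous_intros)
    show "smooth_map O' S" unfolding S_def[abs_def]
    proof (rule smooth_map_sum, rule smooth_map_scaleR[OF _ smooth_map_const])
      fix b
      show "smooth_map O' (\<lambda>y. if b \<in> K then sgn (x \<bullet> b) * sqrt (D b y) else y \<bullet> b)"
      proof (cases "b \<in> K")
        case True
        then have "D b y > 0" if "y \<in> O'" for y using that by (auto simp: O'_def)
        then have "smooth_map O' (\<lambda>y. sgn (x \<bullet> b) * sqrt (D b y))"
          by (intro smooth_intros) (auto simp: D_def intro!: smooth_intros)
        then show ?thesis using True by simp
      next
        case False
        then show ?thesis by (auto intro!: smooth_intros)
      qed
    qed
    show "S y \<in> M" if "y \<in> O'" for y
    proof -
      have "D i (S y) = D i y" for i by (rule Dcong) (auto simp: Sb)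
      moreover have "(S y \<bullet> i)\<^sup>2 = D i y" if i: "i \<in> K" for i
      proof -
        have "D i y > 0" "x \<bullet> i \<noteq> 0" "i \<in> Basis" using i \<open>y \<in> O'\<close> K(1) by (auto simp: O'_def)
        then show ?thesis using i by (simp add: Sb power_mult_distrib sgn_if)
      qed
      ultimately show ?thesis by (simp add: M_iff)
    qed
    show "S y \<bullet> b = y \<bullet> b" if "b \<in> Basis - K" for y b using that by (simp add: Sb)
    show "(S y \<bullet> i) * (x \<bullet> i) > 0" if "y \<in> O'" "i \<in> K" for y i
    proof -
      have "D i y > 0" "x \<bullet> i \<noteq> 0" "i \<in> Basis" using that K(1) by (auto simp: O'_def)
      then show ?thesis using that by (simp add: Sb sgn_if zero_less_mult_iff)
    qed
    show "y \<in> O' \<and> S y = y" if y: "y \<in> M" "\<forall>i\<in>K. (y \<bullet> i) * (x \<bullet> i) > 0" for y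
    proof -
      have D: "D i y = (y \<bullet> i)\<^sup>2" if "i \<in> K" for i using M_iff y(1) that by simp
      have ne: "y \<bullet> i \<noteq> 0" if "i \<in> K" for i using y(2) that by force
      have "y \<in> O'" using D ne by (auto simp: O'_def)
      moreover have "S y = y"
      proof (rule euclidean_eqI)
        fix b :: 'a assume b: "b \<in> Basis"
        show "S y \<bullet> b = y \<bullet> b"
        proof (cases "b \<in> K")
          case True
          then have "(y \<bullet> b) * (x \<bullet> b) > 0" using y(2) by blast
          then show ?thesis using b True D by (auto simp: Sb sgn_if zero_less_mult_iff)
        qed (use b in \<open>simp add: Sb\<close>)
      qed
      ultimately show ?thesis ..
    qed
    show "(y \<in> O' \<longleftrightarrow> z \<in> O') \<and> S y = S z" if "\<forall>b\<in>Basis - K. y \<bullet> b = z \<bullet> b" for y z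
    proof
      have D: "D i y = D i z" for i using Dcong[OF that] .
      show "y \<in> O' \<longleftrightarrow> z \<in> O'" by (simp add: O'_def D)
      show "S y = S z" by (rule euclidean_eqI) (use that in \<open>auto simp: Sb D\<close>)
    qed
  qed
qed

text \<open>The one-sided derivative suffices, so this also applies to curves that start at a boundary point.\<close>

lemma velocity_tangential:
  assumes \<gamma>: "(\<gamma> has_vector_derivative w) (at 0 within {0..})" and \<delta>: "\<delta> > 0"
    and sl: "\<And>t. 0 \<le> t \<Longrightarrow> t < \<delta> \<Longrightarrow> \<gamma> t \<in> slice C"
  shows "tangential (\<gamma> 0) w" "\<And>c. c \<in> C \<Longrightarrow> w \<bullet> c = 0"
proof -
  have coord: "((\<lambda>t. \<gamma> t \<bullet> b) has_vector_derivative w \<bullet> b) (at 0 within {0..})" for b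
    using bounded_linear.has_vector_derivative[OF bounded_linear_inner_left \<gamma>] .
  have "((\<lambda>t. (\<gamma> t \<bullet> b)\<^sup>2 *\<^sub>R \<nu> b) has_vector_derivative (2 * ((\<gamma> 0 \<bullet> b) * (w \<bullet> b))) *\<^sub>R \<nu> b)
      (at 0 within {0..})" for b
  proof -
    have "((\<lambda>t. \<gamma> t \<bullet> b) has_real_derivative w \<bullet> b) (at 0 within {0..})"
      using coord[of b] by (simp add: has_real_derivative_iff_has_vector_derivative)
    then have "((\<lambda>t. (\<gamma> t \<bullet> b)\<^sup>2) has_real_derivative 2 * ((\<gamma> 0 \<bullet> b) * (w \<bullet> b))) (at 0 within {0..})"
      by (auto intro!: derivative_eq_intros)
    then have "((\<lambda>t. (\<gamma> t \<bullet> b)\<^sup>2) has_vector_derivative 2 * ((\<gamma> 0 \<bullet> b) * (w \<bullet> b))) (at 0 within {0..})"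
      by (simp add: has_real_derivative_iff_has_vector_derivative)
    then show ?thesis
      by (rule bounded_linear.has_vector_derivative[OF bounded_linear_scaleR_left])
  qed
  then have D: "((\<lambda>t. Q (\<gamma> t)) has_vector_derivative (\<Sum>b\<in>Basis. (2 * ((\<gamma> 0 \<bullet> b) * (w \<bullet> b))) *\<^sub>R \<nu> b))
      (at 0 within {0..})"
    unfolding Q_def by (rule has_vector_derivative_sum)
  have "(\<Sum>b\<in>Basis. (2 * ((\<gamma> 0 \<bullet> b) * (w \<bullet> b))) *\<^sub>R \<nu> b) = 0"
    by (rule has_vector_derivative_constant_right[OF D \<delta>, of c0]) (use sl in \<open>auto simp: slice_def M_def\<close>)
  moreover have "(\<Sum>b\<in>Basis. (2 * ((\<gamma> 0 \<bullet> b) * (w \<bullet> b))) *\<^sub>R \<nu> b)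
      = 2 *\<^sub>R (\<Sum>b\<in>Basis. ((\<gamma> 0 \<bullet> b) * (w \<bullet> b)) *\<^sub>R \<nu> b)"
    by (simp add: scaleR_sum_right)
  ultimately show "tangential (\<gamma> 0) w" by (simp add: tangential_def)
  show "w \<bullet> c = 0" if "c \<in> C" for c
    by (rule has_vector_derivative_constant_right[OF coord \<delta>, of _ 0]) (use sl that in \<open>auto simp: slice_def\<close>)
qed

text \<open>Take the image of the line \<open>x + t *\<^sub>R w\<close> under the section \<open>S\<close>. Its velocity agrees with \<open>w\<close> outside \<open>K\<close>, and
both are tangential; as the vectors \<open>\<nu> i\<close> with \<open>i \<in> K\<close> are independent and \<open>x \<bullet> i \<noteq> 0\<close>, they agree. A
coordinate that vanishes at \<open>x\<close> does not belong to \<open>K\<close>, hence it is exactly linear along the curve.\<close>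

lemma curve_with_velocity:
  assumes x: "x \<in> slice C" and C: "C \<subseteq> Basis" and G: "open G" "x \<in> G"
    and w: "tangential x w" "\<And>c. c \<in> C \<Longrightarrow> w \<bullet> c = 0"
  obtains \<gamma> \<epsilon> where "0 < \<epsilon>" "smooth_map {-\<epsilon><..<\<epsilon>} \<gamma>" "\<gamma> ` {-\<epsilon><..<\<epsilon>} \<subseteq> slice C \<inter> G"
    "\<gamma> 0 = x" "(\<gamma> has_vector_derivative w) (at 0)"
    "\<forall>t. \<forall>b\<in>Basis. x \<bullet> b = 0 \<longrightarrow> \<gamma> t \<bullet> b = t * (w \<bullet> b)"
proof -
  have xM: "x \<in> M" using x by (simp add: slice_def)
  obtain K O' :: "'a set" and S :: "'a \<Rightarrow> 'a" where sec:
    "K \<subseteq> Basis" "\<forall>i\<in>K. x \<bullet> i \<noteq> 0" "card K = rank"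
    "\<forall>u. (\<Sum>i\<in>K. u i *\<^sub>R \<nu> i) = 0 \<longrightarrow> (\<forall>i\<in>K. u i = 0)"
    "open O'" "smooth_map O' S" "\<forall>y\<in>O'. S y \<in> M"
    "\<forall>y. \<forall>b\<in>Basis - K. S y \<bullet> b = y \<bullet> b"
    "\<forall>y\<in>O'. \<forall>i\<in>K. (S y \<bullet> i) * (x \<bullet> i) > 0"
    "\<forall>y\<in>M. (\<forall>i\<in>K. (y \<bullet> i) * (x \<bullet> i) > 0) \<longrightarrow> y \<in> O' \<and> S y = y"
    "\<forall>y z. (\<forall>b\<in>Basis - K. y \<bullet> b = z \<bullet> b) \<longrightarrow> (y \<in> O' \<longleftrightarrow> z \<in> O') \<and> S y = S z"
    by (rule local_section[OF xM])
  note K = sec(1) sec(2,3)[rule_format] and indep = sec(4)[rule_format]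
    and O = sec(5,6) sec(7)[rule_format] and sign = sec(9)[rule_format]
    and fixed = sec(10)[rule_format] and dep = sec(11)[rule_format]
  have S: "S y \<bullet> b = y \<bullet> b" if "b \<in> Basis" "b \<notin> K" for y b using sec(8) that by simp
  have "x \<in> O' \<and> S x = x"
    by (rule fixed[OF xM]) (use K(2) in \<open>auto simp: zero_less_mult_iff linorder_neq_iff\<close>)
  then have xO: "x \<in> O'" "S x = x" by auto
  have OG: "open (O' \<inter> S -` G)"
    using continuous_open_preimage[OF smooth_map_continuous_on[OF O(2)] O(1) G(1)] .
  define l where "l t = x + t *\<^sub>R w" for t :: real
  have "open (l -` (O' \<inter> S -` G))" unfolding l_def by (intro open_vimage OG continuous_intros)
  moreover have "0 \<in> l -` (O' \<inter> S -` G)" using xO G by (simp add: l_def)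
  ultimately obtain \<epsilon> where \<epsilon>: "\<epsilon> > 0" "ball 0 \<epsilon> \<subseteq> l -` (O' \<inter> S -` G)"
    unfolding open_contains_ball by blast
  have l: "l t \<in> O'" "S (l t) \<in> G" if "t \<in> {-\<epsilon><..<\<epsilon>}" for t
    using \<epsilon>(2) that by (auto simp: subset_iff dist_real_def)
  define \<gamma> where "\<gamma> t = S (l t)" for t
  have \<gamma>sl: "\<gamma> t \<in> slice C" if "t \<in> {-\<epsilon><..<\<epsilon>}" for t
  proof -
    have "\<gamma> t \<bullet> c = 0" if "c \<in> C" for c
    proof -
      have "x \<bullet> c = 0" using x that by (simp add: slice_def)
      then show ?thesis using S[of c "l t"] C K(2)[of c] w(2) that by (auto simp: \<gamma>_def l_def inner_add_left)
    qed
    then show ?thesis using O(3)[OF l(1)[OF that]] by (simp add: slice_def \<gamma>_def)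
  qed
  have \<gamma>0: "\<gamma> 0 = x" using xO by (simp add: \<gamma>_def l_def)
  define S' where "S' = frechet_derivative S (at x)"
  have S': "(S has_derivative S') (at x)" unfolding S'_def by (rule smooth_map_derivative[OF O(2,1) xO(1)])
  have "(l has_derivative (\<lambda>t. t *\<^sub>R w)) (at 0)" unfolding l_def by (auto intro!: derivative_eq_intros)
  then have "(\<gamma> has_derivative (\<lambda>t. S' (t *\<^sub>R w))) (at 0)"
    using diff_chain_at[of l "\<lambda>t. t *\<^sub>R w" 0 S S'] S' by (simp add: \<gamma>_def[abs_def] o_def l_def)
  then have \<gamma>': "(\<gamma> has_vector_derivative S' w) (at 0)"
    by (simp add: has_vector_derivative_def linear_cmul[OF has_derivative_linear[OF S']])
  note \<gamma>'' = has_vector_derivative_at_within[OF \<gamma>', of "{0..}"]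
  have tan: "tangential x (S' w)"
    using velocity_tangential(1)[OF \<gamma>'' \<epsilon>(1), of "{}"] \<gamma>sl \<gamma>0 by (auto simp: slice_def)
  have free: "S' w \<bullet> b = w \<bullet> b" if "b \<in> Basis" "b \<notin> K" for b
    by (rule has_vector_derivative_constant_right[OF
          bounded_linear.has_vector_derivative[OF bounded_linear_inner_left \<gamma>'', of b] \<epsilon>(1), of "x \<bullet> b"])
      (use S[OF that] in \<open>simp add: \<gamma>_def l_def inner_add_left\<close>)
  have "(\<Sum>b\<in>Basis. ((x \<bullet> b) * ((S' w - w) \<bullet> b)) *\<^sub>R \<nu> b) = 0"
    using tan w(1) by (simp add: tangential_def inner_diff_left right_diff_distrib scaleR_diff_left sum_subtractf)
  moreover have "(\<Sum>b\<in>Basis. ((x \<bullet> b) * ((S' w - w) \<bullet> b)) *\<^sub>R \<nu> b)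
      = (\<Sum>b\<in>K. ((x \<bullet> b) * ((S' w - w) \<bullet> b)) *\<^sub>R \<nu> b)"
    by (rule sum.mono_neutral_right) (use K(1) free in \<open>auto simp: inner_diff_left\<close>)
  ultimately have "\<forall>i\<in>K. (x \<bullet> i) * ((S' w - w) \<bullet> i) = 0" using indep[of "\<lambda>b. (x \<bullet> b) * ((S' w - w) \<bullet> b)"] by simp
  then have "S' w \<bullet> b = w \<bullet> b" if "b \<in> Basis" for b
    using free[OF that] K(2)[of b] by (cases "b \<in> K") (auto simp: inner_diff_left)
  then have "S' w = w" by (rule euclidean_eqI)
  show thesis
  proof (rule that[OF \<epsilon>(1)])
    show "smooth_map {-\<epsilon><..<\<epsilon>} \<gamma>" unfolding \<gamma>_def
    proof (rule smooth_map_compose[OF _ O(2)])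
      show "smooth_map {-\<epsilon><..<\<epsilon>} l" unfolding l_def by (intro smooth_intros)
      show "l ` {-\<epsilon><..<\<epsilon>} \<subseteq> O'" using l(1) by auto
    qed
    show "\<gamma> ` {-\<epsilon><..<\<epsilon>} \<subseteq> slice C \<inter> G" using \<gamma>sl l(2) by (auto simp: \<gamma>_def)
    show "\<gamma> 0 = x" by (rule \<gamma>0)
    show "(\<gamma> has_vector_derivative w) (at 0)" using \<gamma>' \<open>S' w = w\<close> by simp
    show "\<forall>t. \<forall>b\<in>Basis. x \<bullet> b = 0 \<longrightarrow> \<gamma> t \<bullet> b = t * (w \<bullet> b)"
    proof (intro allI ballI impI)
      fix t b assume "b \<in> Basis" "x \<bullet> b = 0"
      then show "\<gamma> t \<bullet> b = t * (w \<bullet> b)"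
        using S[of b "l t"] K(2)[of b] by (auto simp: \<gamma>_def l_def inner_add_left)
    qed
  qed
qed

lemma tangent_space_open_slice:
  assumes x: "x \<in> slice C" and C: "C \<subseteq> Basis" and G: "open G" "x \<in> G" and X: "slice C \<inter> G \<subseteq> X"
    and w: "tangential x w" "\<And>c. c \<in> C \<Longrightarrow> w \<bullet> c = 0"
  shows "w \<in> tangent_space X x"
proof -
  obtain \<gamma> \<epsilon> where "0 < \<epsilon>" "smooth_map {-\<epsilon><..<\<epsilon>} \<gamma>" "\<gamma> ` {-\<epsilon><..<\<epsilon>} \<subseteq> slice C \<inter> G"
    "\<gamma> 0 = x" "(\<gamma> has_vector_derivative w) (at 0)"
    "\<forall>t. \<forall>b\<in>Basis. x \<bullet> b = 0 \<longrightarrow> \<gamma> t \<bullet> b = t * (w \<bullet> b)"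
    by (rule curve_with_velocity[OF x C G w])
  then show ?thesis using X unfolding tangent_space_def by blast
qed

lemma tangent_space_slice:
  assumes x: "x \<in> slice C" and C: "C \<subseteq> Basis"
  shows "tangent_space (slice C) x = {w. tangential x w \<and> (\<forall>c\<in>C. w \<bullet> c = 0)}"
proof (intro equalityI subsetI)
  fix w assume "w \<in> tangent_space (slice C) x"
  then obtain \<gamma> \<epsilon> where \<gamma>: "0 < \<epsilon>" "\<gamma> ` {-\<epsilon><..<\<epsilon>} \<subseteq> slice C" "\<gamma> 0 = x"
    "(\<gamma> has_vector_derivative w) (at 0)" unfolding tangent_space_def by blast
  have "\<gamma> t \<in> slice C" if "0 \<le> t" "t < \<epsilon>" for t using \<gamma>(1,2) that by (auto simp: image_subset_iff)
  then show "w \<in> {w. tangential x w \<and> (\<forall>c\<in>C. w \<bullet> c = 0)}"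
    using velocity_tangential[OF has_vector_derivative_at_within[OF \<gamma>(4)] \<gamma>(1), of C] \<gamma>(3) by blast
next
  fix w assume "w \<in> {w. tangential x w \<and> (\<forall>c\<in>C. w \<bullet> c = 0)}"
  then show "w \<in> tangent_space (slice C) x"
    using tangent_space_open_slice[OF x C open_UNIV] by auto
qed

text \<open>The projection to the coordinates in \<open>D\<close>, which are neither in \<open>K\<close> nor forced to vanish, is a chart with inverse
\<open>S\<close>. The set \<open>Y\<close> is arbitrary so that the same chart serves for an open part of a slice and for a
half of it.\<close>

lemma slice_chart:
  assumes x: "x \<in> slice C" and C: "C \<subseteq> Basis"
  obtains D O' U :: "'a set" and S f :: "'a \<Rightarrow> 'a" where "D \<subseteq> Basis" "card D = DIM('a) - rank - card C"
    "\<forall>b\<in>Basis. b \<notin> C \<longrightarrow> x \<bullet> b = 0 \<longrightarrow> b \<in> D"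
    "open O'" "open U" "x \<in> U"
    "\<forall>G. open G \<longrightarrow> open (O' \<inter> S -` G)"
    "\<forall>Y. diffeo (slice C \<inter> U \<inter> Y) {y\<in>O'. (\<forall>b\<in>Basis. b \<notin> D \<longrightarrow> y \<bullet> b = 0) \<and> S y \<in> Y} f"
    "\<forall>y\<in>O'. \<forall>b\<in>D. S y \<bullet> b = y \<bullet> b"
    "\<forall>y. \<forall>b\<in>D. f y \<bullet> b = y \<bullet> b"
proof -
  have xM: "x \<in> M" and xC: "\<And>c. c \<in> C \<Longrightarrow> x \<bullet> c = 0" using x by (auto simp: slice_def)
  obtain K O' :: "'a set" and S :: "'a \<Rightarrow> 'a" where sec:
    "K \<subseteq> Basis" "\<forall>i\<in>K. x \<bullet> i \<noteq> 0" "card K = rank"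
    "\<forall>u. (\<Sum>i\<in>K. u i *\<^sub>R \<nu> i) = 0 \<longrightarrow> (\<forall>i\<in>K. u i = 0)"
    "open O'" "smooth_map O' S" "\<forall>y\<in>O'. S y \<in> M"
    "\<forall>y. \<forall>b\<in>Basis - K. S y \<bullet> b = y \<bullet> b"
    "\<forall>y\<in>O'. \<forall>i\<in>K. (S y \<bullet> i) * (x \<bullet> i) > 0"
    "\<forall>y\<in>M. (\<forall>i\<in>K. (y \<bullet> i) * (x \<bullet> i) > 0) \<longrightarrow> y \<in> O' \<and> S y = y"
    "\<forall>y z. (\<forall>b\<in>Basis - K. y \<bullet> b = z \<bullet> b) \<longrightarrow> (y \<in> O' \<longleftrightarrow> z \<in> O') \<and> S y = S z"
    by (rule local_section[OF xM])
  note K = sec(1) sec(2,3)[rule_format] and indep = sec(4)[rule_format]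
    and O = sec(5,6) sec(7)[rule_format] and sign = sec(9)[rule_format]
    and fixed = sec(10)[rule_format] and dep = sec(11)[rule_format]
  have S: "S y \<bullet> b = y \<bullet> b" if "b \<in> Basis" "b \<notin> K" for y b using sec(8) that by simp
  define D where "D = Basis - K - C"
  define f where "f y = (\<Sum>b\<in>Basis. (if b \<in> D then y \<bullet> b else 0) *\<^sub>R b)" for y
  define U where "U = (\<Inter>i\<in>K. {y. (y \<bullet> i) * (x \<bullet> i) > 0})"
  have finK: "finite K" using K(1) finite_Basis finite_subset by blast
  have KC: "K \<inter> C = {}" using K(2) xC by blast
  have fb: "f y \<bullet> b = (if b \<in> D then y \<bullet> b else 0)" if "b \<in> Basis" for y b
    unfolding f_def using that by simp
  show thesis
  proof (rule that[of D O' U S f]; (intro allI ballI impI)?)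
    show D: "D \<subseteq> Basis" by (auto simp: D_def)
    have "card (Basis - K - C) = card (Basis - K) - card C"
      using C KC finite_subset[OF C finite_Basis] by (intro card_Diff_subset) auto
    also have "card (Basis - K) = DIM('a) - card K" using K(1) finK by (intro card_Diff_subset)
    finally show "card D = DIM('a) - rank - card C" using K(3) by (simp add: D_def)
    show "b \<in> D" if "b \<in> Basis" "b \<notin> C" "x \<bullet> b = 0" for b using that K(2) by (auto simp: D_def)
    show "open O'" by (rule O)
    show "open U" unfolding U_def by (intro open_INT finK ballI open_Collect_less continuous_intros)
    show "x \<in> U" using K(2) by (auto simp: U_def zero_less_mult_iff linorder_neq_iff)
    show "open (O' \<inter> S -` G)" if "open G" for G
      using continuous_open_preimage[OF smooth_map_continuous_on[OF O(2)] O(1) that] .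
    show "S y \<bullet> b = y \<bullet> b" if "y \<in> O'" "b \<in> D" for y b using S that by (auto simp: D_def)
    show "f y \<bullet> b = y \<bullet> b" if "b \<in> D" for y b using fb[of b y] that D by auto
    show "diffeo (slice C \<inter> U \<inter> Y) {y\<in>O'. (\<forall>b\<in>Basis. b \<notin> D \<longrightarrow> y \<bullet> b = 0) \<and> S y \<in> Y} f" for Y
    proof (rule diffeoI[where g = S])
      fix y assume y: "y \<in> slice C \<inter> U \<inter> Y"
      then have "y \<in> O' \<and> S y = y" by (intro fixed) (auto simp: slice_def U_def)
      moreover have "(f y \<in> O' \<longleftrightarrow> y \<in> O') \<and> S (f y) = S y"
        by (rule dep) (use y fb in \<open>auto simp: D_def slice_def\<close>)
      ultimately show "S (f y) = y" "f y \<in> {y\<in>O'. (\<forall>b\<in>Basis. b \<notin> D \<longrightarrow> y \<bullet> b = 0) \<and> S y \<in> Y}"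
        using y fb by auto
    next
      fix y assume y: "y \<in> {y\<in>O'. (\<forall>b\<in>Basis. b \<notin> D \<longrightarrow> y \<bullet> b = 0) \<and> S y \<in> Y}"
      have "S y \<bullet> c = 0" if "c \<in> C" for c
        using y that C KC S[of c y] by (auto simp: D_def)
      then show "S y \<in> slice C \<inter> U \<inter> Y" using y O(3) sign by (auto simp: slice_def U_def)
      show "f (S y) = y"
        by (rule euclidean_eqI) (use y S in \<open>auto simp: fb D_def\<close>)
    next
      show "smooth_map (slice C \<inter> U \<inter> Y) f" unfolding f_def
        by (intro smooth_intros)
      show "smooth_map {y\<in>O'. (\<forall>b\<in>Basis. b \<notin> D \<longrightarrow> y \<bullet> b = 0) \<and> S y \<in> Y} S"
        by (rule smooth_map_subset[OF O(2)]) auto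
    qed
  qed
qed

lemma interior_point_open_slice:
  assumes x: "x \<in> slice C" and C: "C \<subseteq> Basis" and G: "open G" "x \<in> G" and X: "X \<inter> G = slice C \<inter> G"
  shows "interior_point (DIM('a) - rank - card C) X x"
proof -
  obtain D O' U :: "'a set" and S f :: "'a \<Rightarrow> 'a" where chart: "D \<subseteq> Basis" "card D = DIM('a) - rank - card C"
    "\<forall>b\<in>Basis. b \<notin> C \<longrightarrow> x \<bullet> b = 0 \<longrightarrow> b \<in> D"
    "open O'" "open U" "x \<in> U"
    "\<forall>G. open G \<longrightarrow> open (O' \<inter> S -` G)"
    "\<forall>Y. diffeo (slice C \<inter> U \<inter> Y) {y\<in>O'. (\<forall>b\<in>Basis. b \<notin> D \<longrightarrow> y \<bullet> b = 0) \<and> S y \<in> Y} f"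
    "\<forall>y\<in>O'. \<forall>b\<in>D. S y \<bullet> b = y \<bullet> b"
    "\<forall>y. \<forall>b\<in>D. f y \<bullet> b = y \<bullet> b"
    by (rule slice_chart[OF x C])
  note D = chart(1,2) and U = chart(4-6) chart(7)[rule_format, OF G(1)] and f = chart(8)[rule_format, of G]
  let ?T = "{y. \<forall>b\<in>Basis. b \<notin> D \<longrightarrow> y \<bullet> b = 0}"
  have "slice C \<inter> U \<inter> G = X \<inter> (U \<inter> G)" using X by auto
  then have 1: "openin (top_of_set X) (slice C \<inter> U \<inter> G)" using U(2) G(1) by (auto simp: openin_open)
  have "{y\<in>O'. (\<forall>b\<in>Basis. b \<notin> D \<longrightarrow> y \<bullet> b = 0) \<and> S y \<in> G} = ?T \<inter> (O' \<inter> S -` G)" by auto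
  then have 2: "openin (top_of_set ?T) {y\<in>O'. (\<forall>b\<in>Basis. b \<notin> D \<longrightarrow> y \<bullet> b = 0) \<and> S y \<in> G}"
    using U(4) by (auto simp: openin_open)
  have "subspace ?T" by (rule subspace_substandard)
  moreover have "dim ?T = DIM('a) - rank - card C" using dim_substandard[OF D(1)] D(2) by simp
  ultimately show ?thesis unfolding interior_point_def
    using 1 2 f x U(3) G(2)
    by (intro exI[of _ ?T] exI[of _ "slice C \<inter> U \<inter> G"] exI[of _ "{y\<in>O'. (\<forall>b\<in>Basis. b \<notin> D \<longrightarrow> y \<bullet> b = 0) \<and> S y \<in> G}"] exI[of _ f]) simp
qed

lemma boundary_point_half_slice:
  assumes x: "x \<in> slice C" and C: "C \<subseteq> Basis" and e: "e \<in> Basis" "e \<notin> C" "x \<bullet> e = 0"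
  shows "boundary_point (DIM('a) - rank - card C) (slice C \<inter> {y. 0 \<le> y \<bullet> e}) x"
proof -
  let ?Y = "{y. 0 \<le> y \<bullet> e}"
  obtain D O' U :: "'a set" and S f :: "'a \<Rightarrow> 'a" where chart: "D \<subseteq> Basis" "card D = DIM('a) - rank - card C"
    "\<forall>b\<in>Basis. b \<notin> C \<longrightarrow> x \<bullet> b = 0 \<longrightarrow> b \<in> D"
    "open O'" "open U" "x \<in> U"
    "\<forall>G. open G \<longrightarrow> open (O' \<inter> S -` G)"
    "\<forall>Y. diffeo (slice C \<inter> U \<inter> Y) {y\<in>O'. (\<forall>b\<in>Basis. b \<notin> D \<longrightarrow> y \<bullet> b = 0) \<and> S y \<in> Y} f"
    "\<forall>y\<in>O'. \<forall>b\<in>D. S y \<bullet> b = y \<bullet> b"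
    "\<forall>y. \<forall>b\<in>D. f y \<bullet> b = y \<bullet> b"
    by (rule slice_chart[OF x C])
  note U = chart(4-6) and f = chart(8)[rule_format, of ?Y] and S = chart(9)[rule_format] and fD = chart(10)[rule_format]
  have D: "D \<subseteq> Basis" "card D = DIM('a) - rank - card C" "e \<in> D" using chart(1-3) e by auto
  let ?T = "{y. \<forall>b\<in>Basis. b \<notin> D \<longrightarrow> y \<bullet> b = 0}"
  let ?V = "{y\<in>O'. (\<forall>b\<in>Basis. b \<notin> D \<longrightarrow> y \<bullet> b = 0) \<and> S y \<in> ?Y}"
  have "slice C \<inter> U \<inter> ?Y = (slice C \<inter> ?Y) \<inter> U" by auto
  then have 1: "openin (top_of_set (slice C \<inter> ?Y)) (slice C \<inter> U \<inter> ?Y)" using U(2) by (auto simp: openin_open)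
  have "?V = (?T \<inter> {y. 0 \<le> e \<bullet> y}) \<inter> O'" using S[OF _ D(3)] by (auto simp: inner_commute)
  then have 2: "openin (top_of_set (?T \<inter> {y. 0 \<le> e \<bullet> y})) ?V" using U(1) by (auto simp: openin_open)
  have "subspace ?T" by (rule subspace_substandard)
  moreover have "dim ?T = DIM('a) - rank - card C" using dim_substandard[OF D(1)] D(2) by simp
  moreover have "e \<in> ?T" using e(1) D(3) by (auto simp: inner_Basis)
  moreover have "e \<noteq> 0" using e(1) by auto
  moreover have "e \<bullet> f x = 0" using fD[OF D(3), of x] e(3) by (simp add: inner_commute)
  moreover have "x \<in> slice C \<inter> U \<inter> ?Y" using x U(3) e(3) by simp
  ultimately show ?thesis unfolding boundary_point_def
    using 1 2 f by (intro exI[of _ ?T] exI[of _ e] exI[of _ "slice C \<inter> U \<inter> ?Y"] exI[of _ ?V] exI[of _ f]) simp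
qed

text \<open>Where \<open>y \<bullet> e\<close> is positive, every tangential velocity is realized by a curve on both sides of \<open>0\<close>,
so the one-sided velocity of a boundary point cannot exist.\<close>

lemma not_boundary_point_half_slice:
  assumes x: "x \<in> slice C" and C: "C \<subseteq> Basis" and e: "0 < x \<bullet> e"
  shows "\<not> boundary_point d (slice C \<inter> {y. 0 \<le> y \<bullet> e}) x"
proof
  assume "boundary_point d (slice C \<inter> {y. 0 \<le> y \<bullet> e}) x"
  then obtain \<gamma> u \<delta> where \<gamma>: "0 < \<delta>" "(\<gamma> has_vector_derivative u) (at 0 within {0..})" "\<gamma> 0 = x"
    "\<forall>t. 0 \<le> t \<and> t < \<delta> \<longrightarrow> \<gamma> t \<in> slice C \<inter> {y. 0 \<le> y \<bullet> e}"
    "u \<notin> tangent_space (slice C \<inter> {y. 0 \<le> y \<bullet> e}) x"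
    by (rule boundary_point_inward_curve)
  have "u \<in> tangent_space (slice C \<inter> {y. 0 \<le> y \<bullet> e}) x"
  proof (rule tangent_space_open_slice[OF x C, of "{y. 0 < y \<bullet> e}"])
    show "open {y. 0 < y \<bullet> e}" by (intro open_Collect_less continuous_intros)
    show "tangential x u" "\<And>c. c \<in> C \<Longrightarrow> u \<bullet> c = 0"
      using velocity_tangential[OF \<gamma>(2,1), of C] \<gamma>(3,4) by auto
  qed (use e in auto)
  then show False using \<gamma>(5) by contradiction
qed

lemma compact_slice: "compact (slice C)"
proof -
  have "closed M" unfolding M_def Q_def by (intro closed_Collect_eq continuous_intros)
  moreover have "closed (\<Inter>c\<in>C. {x. x \<bullet> c = 0})"
    by (intro closed_INT ballI closed_Collect_eq continuous_intros)
  moreover have "slice C = M \<inter> (\<Inter>c\<in>C. {x. x \<bullet> c = 0})" by (auto simp: slice_def)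
  moreover have "bounded M" using bounded_solutions by (simp add: M_def Q_def)
  ultimately show ?thesis by (metis bounded_Int closed_Int compact_eq_bounded_closed)
qed

lemma closed_manifold_slice:
  assumes "C \<subseteq> Basis"
  shows "closed_manifold (DIM('a) - rank - card C) (slice C)"
  unfolding closed_manifold_def
  using compact_slice interior_point_open_slice[OF _ assms open_UNIV UNIV_I refl] by auto

end

section \<open>Rotation in the plane of two equal coefficients\<close>

locale rotational_quadrics = coaxial_quadrics \<nu> c0
  for \<nu> :: "'a::euclidean_space \<Rightarrow> 'w::euclidean_space" and c0 :: 'w +
  fixes p q :: 'a
  assumes p: "p \<in> Basis" and q: "q \<in> Basis" and pq: "p \<noteq> q" and \<nu>_eq: "\<nu> p = \<nu> q"
begin

text \<open>\<open>P\<close> and \<open>\<iota>\<close> identify the plane of \<open>q\<close> and \<open>p\<close> with the complex numbers, \<open>q\<close> being the real axis; \<open>rot \<zeta>\<close> is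
multiplication by \<open>\<zeta>\<close> in this plane. \<open>QH\<close> is the contribution of the other coordinates to \<open>Q\<close>, and \<open>angle\<close>
is the projection of the open book.\<close>

definition P :: "'a \<Rightarrow> complex" where "P x = Complex (x \<bullet> q) (x \<bullet> p)"
definition \<iota> :: "complex \<Rightarrow> 'a" where "\<iota> z = Re z *\<^sub>R q + Im z *\<^sub>R p"
definition axis_part :: "'a \<Rightarrow> 'a" where "axis_part x = x - \<iota> (P x)"
definition rot :: "complex \<Rightarrow> 'a \<Rightarrow> 'a" where "rot \<zeta> x = x + \<iota> ((\<zeta> - 1) * P x)"
definition angle :: "'a \<Rightarrow> complex" where "angle x = sgn (P x)"
definition QH :: "'a \<Rightarrow> 'w" where "QH x = (\<Sum>b\<in>Basis - {p, q}. (x \<bullet> b)\<^sup>2 *\<^sub>R \<nu> b)"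
definition B :: "'a set" where "B = slice {p, q}"
definition W :: "'a set" where "W = slice {p} \<inter> {y. 0 \<le> y \<bullet> q}"

lemma inner_pq: "p \<bullet> q = 0" "q \<bullet> p = 0" "p \<bullet> p = 1" "q \<bullet> q = 1"
  using p q pq by (auto simp: inner_Basis)

lemma bounded_linear_P: "bounded_linear P"
  by (intro linear_conv_bounded_linear[THEN iffD1] linearI)
    (auto simp: P_def complex_eq_iff inner_add_left)

lemma bounded_linear_\<iota>: "bounded_linear \<iota>"
  by (intro linear_conv_bounded_linear[THEN iffD1] linearI)
    (auto simp: \<iota>_def algebra_simps)

lemmas P_add = linear_add[OF bounded_linear.linear[OF bounded_linear_P]]
  and P_diff = linear_diff[OF bounded_linear.linear[OF bounded_linear_P]]
  and P_scale = linear_cmul[OF bounded_linear.linear[OF bounded_linear_P]]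
  and P_0 = linear_0[OF bounded_linear.linear[OF bounded_linear_P]]
  and \<iota>_add = linear_add[OF bounded_linear.linear[OF bounded_linear_\<iota>]]
  and \<iota>_0 = linear_0[OF bounded_linear.linear[OF bounded_linear_\<iota>]]
  and smooth_map_P [smooth_intros] = smooth_map_bounded_linear[OF bounded_linear_P]
  and smooth_map_\<iota> [smooth_intros] = smooth_map_bounded_linear[OF bounded_linear_\<iota>]

lemma P_\<iota> [simp]: "P (\<iota> z) = z"
  by (simp add: P_def \<iota>_def inner_add_left inner_pq)

lemma inner_\<iota>: "b \<in> Basis - {p, q} \<Longrightarrow> \<iota> z \<bullet> b = 0"
  using p q by (auto simp: \<iota>_def inner_add_left inner_Basis)

lemma norm_\<iota>: "norm (\<iota> z) \<le> 2 * cmod z"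
proof -
  have "norm (\<iota> z) \<le> \<bar>Re z\<bar> + \<bar>Im z\<bar>"
    unfolding \<iota>_def using norm_triangle_ineq[of "Re z *\<^sub>R q" "Im z *\<^sub>R p"] p q by simp
  then show ?thesis using abs_Re_le_cmod[of z] abs_Im_le_cmod[of z] by linarith
qed

lemma \<iota>_of_real: "\<iota> (of_real t) = t *\<^sub>R q"
  by (simp add: \<iota>_def)

lemma axis_part_eq: "axis_part x = (\<Sum>b\<in>Basis - {p, q}. (x \<bullet> b) *\<^sub>R b)"
proof -
  have "x = (\<Sum>b\<in>Basis. (x \<bullet> b) *\<^sub>R b)" by (simp add: euclidean_representation)
  also have "\<dots> = (\<Sum>b\<in>Basis - {p, q}. (x \<bullet> b) *\<^sub>R b) + (\<Sum>b\<in>{p, q}. (x \<bullet> b) *\<^sub>R b)"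
    using p q by (intro sum.subset_diff) auto
  also have "(\<Sum>b\<in>{p, q}. (x \<bullet> b) *\<^sub>R b) = \<iota> (P x)"
    using pq by (simp add: \<iota>_def P_def)
  finally have "x - \<iota> (P x) = (\<Sum>b\<in>Basis - {p, q}. (x \<bullet> b) *\<^sub>R b) + \<iota> (P x) - \<iota> (P x)"
    by (rule arg_cong)
  then show ?thesis by (simp add: axis_part_def)
qed

lemma axis_part_add_\<iota>: "axis_part (x + \<iota> z) = axis_part x"
  by (simp add: axis_part_def P_add \<iota>_add)

lemma axis_part_id: "P x = 0 \<Longrightarrow> axis_part x = x"
  by (simp add: axis_part_def \<iota>_0)

lemma P_axis_part [simp]: "P (axis_part x) = 0"
  by (simp add: axis_part_def P_diff)

lemma axis_part_decomp: "axis_part x + \<iota> (P x) = x"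
  by (simp add: axis_part_def)

text \<open>This is where \<open>\<nu> p = \<nu> q\<close> matters: \<open>Q\<close> depends on the coordinates in the rotated plane
through \<open>cmod (P x)\<close> only.\<close>

lemma Q_eq: "Q x = QH x + (cmod (P x))\<^sup>2 *\<^sub>R \<nu> q"
proof -
  have "Q x = QH x + (\<Sum>b\<in>{p, q}. (x \<bullet> b)\<^sup>2 *\<^sub>R \<nu> b)"
    unfolding Q_def QH_def using p q by (intro sum.subset_diff) auto
  also have "(\<Sum>b\<in>{p, q}. (x \<bullet> b)\<^sup>2 *\<^sub>R \<nu> b) = (cmod (P x))\<^sup>2 *\<^sub>R \<nu> q"
    using pq \<nu>_eq by (simp add: P_def cmod_power2 algebra_simps)
  finally show ?thesis .
qed

lemma QH_add_\<iota>: "QH (x + \<iota> z) = QH x"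
  unfolding QH_def by (intro sum.cong) (auto simp: inner_add_left inner_\<iota>)

lemma QH_axis_part: "QH (axis_part x) = QH x"
  using QH_add_\<iota>[of "axis_part x" "P x"] by (simp add: axis_part_decomp)

lemma P_rot [simp]: "P (rot \<zeta> x) = \<zeta> * P x"
  by (simp add: rot_def P_add algebra_simps)

lemma axis_part_rot: "axis_part (rot \<zeta> x) = axis_part x"
  by (simp add: rot_def axis_part_add_\<iota>)

lemma eq_if_parts: "axis_part x = axis_part y \<Longrightarrow> P x = P y \<Longrightarrow> x = y"
  by (metis axis_part_decomp)

lemma rot_rot: "rot \<zeta> (rot \<xi> x) = rot (\<zeta> * \<xi>) x"
  by (rule eq_if_parts) (auto simp: axis_part_rot)

lemma rot_1 [simp]: "rot 1 x = x"
  by (rule eq_if_parts) (auto simp: axis_part_rot)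

lemma rot_add_\<iota>: "P x = 0 \<Longrightarrow> rot \<zeta> (x + \<iota> z) = x + \<iota> (\<zeta> * z)"
  by (rule eq_if_parts) (auto simp: axis_part_rot axis_part_add_\<iota> P_add)

lemma rot_M: "cmod \<zeta> = 1 \<Longrightarrow> rot \<zeta> x \<in> M \<longleftrightarrow> x \<in> M"
  using QH_add_\<iota> by (simp add: M_def Q_eq norm_mult) (simp add: rot_def)

lemma smooth_map_rot [smooth_intros]:
  "smooth_map X f \<Longrightarrow> smooth_map X g \<Longrightarrow> smooth_map X (\<lambda>x. rot (f x) (g x))"
  unfolding rot_def by (intro smooth_intros)

lemma smooth_map_axis_part [smooth_intros]:
  "smooth_map X f \<Longrightarrow> smooth_map X (\<lambda>x. axis_part (f x))"
  unfolding axis_part_def by (intro smooth_intros)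

lemma mem_B: "x \<in> B \<longleftrightarrow> x \<in> M \<and> P x = 0"
  by (auto simp: B_def slice_def P_def complex_eq_iff)

lemma mem_W: "x \<in> W \<longleftrightarrow> x \<in> M \<and> P x = of_real (x \<bullet> q) \<and> 0 \<le> x \<bullet> q"
  by (auto simp: W_def slice_def P_def complex_eq_iff)

lemma mem_B_iff_QH: "P x = 0 \<Longrightarrow> x \<in> B \<longleftrightarrow> QH x = c0"
  by (simp add: mem_B M_def Q_eq)

lemma inner_q_Re: "x \<bullet> q = Re (P x)"
  by (simp add: P_def)

lemma M_eq_slice: "M = slice {}"
  by (simp add: slice_def)

lemma compact_M: "compact M" and compact_B: "compact B"
  using compact_slice by (simp_all add: M_eq_slice B_def)

lemma compact_W: "compact W"
proof -
  have "closed {y. 0 \<le> y \<bullet> q}" by (intro closed_Collect_le continuous_intros)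
  then show ?thesis unfolding W_def using compact_slice compact_Int_closed by blast
qed

section \<open>A collar of the axis compatible with the rotation\<close>

text \<open>A finite spanning set of the orthogonal complement of all \<open>\<nu> b\<close>. Adding it to the Gram operator \<open>A\<close> below makes
that operator invertible near \<open>B\<close> although the \<open>\<nu> b\<close> need not span the whole space.\<close>

definition conormal :: "'w set" where
  "conormal = (SOME N. finite N \<and> span N = {w. \<forall>b\<in>Basis. \<nu> b \<bullet> w = 0})"

lemma conormal: "finite conormal" "span conormal = {w. \<forall>b\<in>Basis. \<nu> b \<bullet> w = 0}"
proof -
  let ?N = "{w. \<forall>b\<in>Basis. \<nu> b \<bullet> w = 0}"
  have "subspace ?N" by (auto simp: subspace_def inner_add_right)
  obtain N where N: "N \<subseteq> ?N" "independent N" "?N \<subseteq> span N"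
    by (rule basis_exists[of ?N])
  have "span N \<subseteq> ?N" by (rule span_minimal[OF N(1) \<open>subspace ?N\<close>])
  then have "finite N \<and> span N = ?N" using independent_imp_finite[OF N(2)] N(3) by blast
  then have "finite conormal \<and> span conormal = ?N" unfolding conormal_def by (rule someI)
  then show "finite conormal" "span conormal = ?N" by auto
qed

text \<open>On the span of the \<open>\<nu> b\<close>, \<open>A x\<close> is the Gram operator weighted by the squares of the coordinates
other than \<open>p\<close> and \<open>q\<close>. Its quadratic form \<open>w \<bullet> A x w\<close> is positive on nonzero vectors if \<open>x\<close> is in \<open>B\<close>, because
the \<open>\<nu> b\<close> in the support of \<open>x\<close> span all of them.\<close>

definition A :: "'a \<Rightarrow> 'w \<Rightarrow> 'w" where
  "A x w = (\<Sum>b\<in>Basis - {p, q}. (x \<bullet> b)\<^sup>2 *\<^sub>R ((\<nu> b \<bullet> w) *\<^sub>R \<nu> b)) + (\<Sum>u\<in>conormal. (u \<bullet> w) *\<^sub>R u)"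

definition \<eta> :: "'a \<Rightarrow> 'w" where "\<eta> x = inv (A x) (\<nu> q)"

lemma linear_A: "linear (A x)"
  unfolding A_def by (intro linear_compose_add linear_compose_sum ballI)
    (auto intro!: linearI simp: inner_add_right algebra_simps)

lemma smooth_A: "smooth_map X (\<lambda>x. A x w)"
  unfolding A_def by (intro smooth_intros)

lemma inj_A_on_B:
  assumes x: "x \<in> B"
  shows "inj (A x)"
  unfolding linear_injective_0[OF linear_A]
proof (intro allI impI)
  fix w assume "A x w = 0"
  then have "w \<bullet> A x w = 0" by simp
  then have "(\<Sum>b\<in>Basis - {p, q}. ((x \<bullet> b) * (\<nu> b \<bullet> w))\<^sup>2) + (\<Sum>u\<in>conormal. (u \<bullet> w)\<^sup>2) = 0"
    by (simp add: A_def inner_add_right inner_sum_right power2_eq_square inner_commute algebra_simps)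
  then have "(\<Sum>b\<in>Basis - {p, q}. ((x \<bullet> b) * (\<nu> b \<bullet> w))\<^sup>2) = 0" "(\<Sum>u\<in>conormal. (u \<bullet> w)\<^sup>2) = 0"
    by (simp_all add: add_nonneg_eq_0_iff sum_nonneg)
  then have z: "\<And>b. b \<in> Basis - {p, q} \<Longrightarrow> (x \<bullet> b) * (\<nu> b \<bullet> w) = 0" "\<And>u. u \<in> conormal \<Longrightarrow> u \<bullet> w = 0"
    using conormal(1) by (simp_all add: sum_nonneg_eq_0_iff)
  have "orthogonal w v" if v: "v \<in> \<nu> ` {b\<in>Basis. x \<bullet> b \<noteq> 0}" for v
  proof -
    obtain b where b: "v = \<nu> b" "b \<in> Basis" "x \<bullet> b \<noteq> 0" using v by auto
    then have "b \<notin> {p, q}" using x by (auto simp: B_def slice_def)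
    then show ?thesis using z(1)[of b] b by (simp add: orthogonal_def inner_commute)
  qed
  then have orth: "orthogonal w v" if "v \<in> span (\<nu> ` {b\<in>Basis. x \<bullet> b \<noteq> 0})" for v
    using orthogonal_to_span that by blast
  have sp: "\<nu> ` Basis \<subseteq> span (\<nu> ` {b\<in>Basis. x \<bullet> b \<noteq> 0})"
    using spanning[of x] x by (auto simp: mem_B M_def Q_def)
  have "w \<in> span conormal" unfolding conormal(2)
  proof safe
    fix b :: 'a assume "b \<in> Basis"
    then have "orthogonal w (\<nu> b)" using orth sp by blast
    then show "\<nu> b \<bullet> w = 0" by (simp add: orthogonal_def inner_commute)
  qed
  moreover have "orthogonal w v" if "v \<in> span conormal" for v
    by (rule orthogonal_to_span[OF that]) (simp add: orthogonal_def inner_commute z(2))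
  ultimately have "orthogonal w w" by blast
  then show "w = 0" by (simp add: orthogonal_def)
qed

lemma open_inj_A: "open {x. inj (A x)}"
  using open_injective_parameters[OF open_UNIV, of A] linear_A smooth_map_continuous_on[OF smooth_A]
  by simp

lemma A_\<eta>: "inj (A x) \<Longrightarrow> A x (\<eta> x) = \<nu> q"
  unfolding \<eta>_def using linear_injective_imp_surjective[OF linear_A] by (simp add: surj_f_inv_f)

lemma smooth_\<eta>: "smooth_map {x. inj (A x)} \<eta>"
  unfolding smooth_map_open_iff[OF open_inj_A]
proof
  fix k show "Ck_on k {x. inj (A x)} \<eta>"
  proof (rule Ck_on_linear_solve[OF open_inj_A, where A = A])
    show "Ck_on k {x. inj (A x)} (\<lambda>x. A x u)" for u
      using smooth_A smooth_map_open_iff[OF open_inj_A] by blast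
  qed (auto simp: linear_A A_\<eta> intro: Ck_on_const)
qed

text \<open>The part of the system that comes from \<open>conormal\<close> drops out, since it is orthogonal to \<open>\<nu> q\<close> and to
all other terms.\<close>

lemma \<eta>_solves:
  assumes "inj (A x)"
  shows "(\<Sum>b\<in>Basis - {p, q}. ((x \<bullet> b)\<^sup>2 * (\<nu> b \<bullet> \<eta> x)) *\<^sub>R \<nu> b) = \<nu> q"
proof -
  define n where "n = (\<Sum>u\<in>conormal. (u \<bullet> \<eta> x) *\<^sub>R u)"
  have "n \<in> span conormal" unfolding n_def by (intro span_sum span_scale span_base)
  then have n: "\<nu> b \<bullet> n = 0" if "b \<in> Basis" for b using that by (simp add: conormal(2))
  have eq: "(\<Sum>b\<in>Basis - {p, q}. ((x \<bullet> b)\<^sup>2 * (\<nu> b \<bullet> \<eta> x)) *\<^sub>R \<nu> b) + n = \<nu> q"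
    using A_\<eta>[OF assms] by (simp add: A_def n_def)
  have "(\<Sum>b\<in>Basis - {p, q}. ((x \<bullet> b)\<^sup>2 * (\<nu> b \<bullet> \<eta> x)) *\<^sub>R \<nu> b) \<bullet> n = 0"
    by (simp add: inner_sum_left n)
  then have "n \<bullet> n = 0" using arg_cong[OF eq, of "\<lambda>v. v \<bullet> n"] n[OF q] by (simp add: inner_add_left)
  then show ?thesis using eq by simp
qed

text \<open>The factor by which \<open>T\<close> multiplies the square of the coordinate \<open>b\<close>. It is \<open>1\<close> on \<open>B\<close>, and the choice of \<open>\<eta>\<close>
makes the total change of \<open>QH\<close> equal to \<open>- (cmod (P x))\<^sup>2 *\<^sub>R \<nu> q\<close>, which is minus the contribution of the
coordinates \<open>p\<close> and \<open>q\<close>.\<close>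

definition factor :: "'a \<Rightarrow> 'a \<Rightarrow> real" where
  "factor x b = 1 - (cmod (P x))\<^sup>2 * (\<nu> b \<bullet> \<eta> x)"

definition T :: "'a \<Rightarrow> 'a" where
  "T x = (\<Sum>b\<in>Basis - {p, q}. ((x \<bullet> b) * sqrt (factor x b)) *\<^sub>R b) + \<iota> (P x)"

definition T_dom :: "'a set" where
  "T_dom = {x. inj (A x) \<and> (\<forall>b\<in>Basis. 0 < factor x b)}"

lemma smooth_factor: "smooth_map {x. inj (A x)} (\<lambda>x. factor x b)"
  unfolding factor_def cmod_power2 by (intro smooth_intros smooth_\<eta>)

lemma open_T_dom: "open T_dom"
proof -
  have "open ({x. inj (A x)} \<inter> (\<lambda>x. factor x b) -` {0<..})" for b
    by (rule continuous_open_preimage[OF smooth_map_continuous_on[OF smooth_factor] open_inj_A open_greaterThan])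
  then have "open (\<Inter>b\<in>Basis. {x. inj (A x)} \<inter> (\<lambda>x. factor x b) -` {0<..})" by (intro open_INT) auto
  moreover have "T_dom = (\<Inter>b\<in>Basis. {x. inj (A x)} \<inter> (\<lambda>x. factor x b) -` {0<..})"
    using p by (auto simp: T_dom_def)
  ultimately show ?thesis by simp
qed

lemma smooth_T: "smooth_map T_dom T"
  unfolding T_def[abs_def]
proof (intro smooth_map_add smooth_map_sum smooth_map_scaleR smooth_map_const smooth_map_mult
    smooth_map_inner smooth_map_ident smooth_map_sqrt smooth_map_\<iota> smooth_map_P)
  show "smooth_map T_dom (\<lambda>x. factor x b)" for b
    by (rule smooth_map_subset[OF smooth_factor]) (auto simp: T_dom_def)
qed (auto simp: T_dom_def)

lemma T_inner: "b \<in> Basis - {p, q} \<Longrightarrow> T x \<bullet> b = (x \<bullet> b) * sqrt (factor x b)"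
  unfolding T_def by (simp add: inner_add_left inner_\<iota> inner_sum_left inner_Basis if_distrib cong: if_cong)

lemma P_T [simp]: "P (T x) = P x"
proof -
  have "(\<Sum>b\<in>Basis - {p, q}. ((x \<bullet> b) * sqrt (factor x b)) *\<^sub>R b) \<bullet> e = 0" if "e \<in> {p, q}" for e
    unfolding inner_sum_left using that p q by (intro sum.neutral) (auto simp: inner_Basis)
  then have "P (\<Sum>b\<in>Basis - {p, q}. ((x \<bullet> b) * sqrt (factor x b)) *\<^sub>R b) = 0"
    by (simp add: P_def complex_eq_iff)
  then show ?thesis by (simp add: T_def P_add)
qed

lemma T_axis: "P x = 0 \<Longrightarrow> T x = x"
  using axis_part_eq[of x] axis_part_id[of x] by (simp add: T_def factor_def \<iota>_0)

lemma QH_T: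
  assumes "x \<in> T_dom"
  shows "QH (T x) = QH x - (cmod (P x))\<^sup>2 *\<^sub>R \<nu> q"
proof -
  have x: "inj (A x)" "\<And>b. b \<in> Basis \<Longrightarrow> 0 < factor x b" using assms by (auto simp: T_dom_def)
  have "QH (T x) = (\<Sum>b\<in>Basis - {p, q}. ((x \<bullet> b)\<^sup>2 * factor x b) *\<^sub>R \<nu> b)"
    unfolding QH_def by (intro sum.cong) (use x(2) in \<open>auto simp: T_inner power_mult_distrib less_imp_le\<close>)
  also have "\<dots> = (\<Sum>b\<in>Basis - {p, q}. (x \<bullet> b)\<^sup>2 *\<^sub>R \<nu> b
      - (cmod (P x))\<^sup>2 *\<^sub>R (((x \<bullet> b)\<^sup>2 * (\<nu> b \<bullet> \<eta> x)) *\<^sub>R \<nu> b))"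
    by (intro sum.cong) (auto simp: factor_def algebra_simps)
  also have "\<dots> = QH x - (cmod (P x))\<^sup>2 *\<^sub>R (\<Sum>b\<in>Basis - {p, q}. ((x \<bullet> b)\<^sup>2 * (\<nu> b \<bullet> \<eta> x)) *\<^sub>R \<nu> b)"
    unfolding QH_def sum_subtractf scaleR_sum_right ..
  finally show ?thesis by (simp add: \<eta>_solves[OF x(1)])
qed

text \<open>\<open>T\<close> transports the equation of \<open>B\<close> for the projection of \<open>x\<close> along the plane to the equation of \<open>M\<close> for
\<open>T x\<close>. So it maps the product of \<open>B\<close> with a small disc in the plane into \<open>M\<close>.\<close>

lemma T_M_iff: "x \<in> T_dom \<Longrightarrow> T x \<in> M \<longleftrightarrow> axis_part x \<in> B"
  using mem_B_iff_QH[of "axis_part x"] by (simp add: M_def Q_eq QH_T QH_axis_part)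

lemma B_subset_T_dom: "B \<subseteq> T_dom"
  by (auto simp: T_dom_def inj_A_on_B factor_def mem_B)

lemma A_rot: "A (rot \<zeta> x) = A x"
  unfolding A_def rot_def by (auto simp: fun_eq_iff inner_add_left inner_\<iota> intro!: sum.cong)

lemma T_rot:
  assumes "cmod \<zeta> = 1"
  shows "T (rot \<zeta> x) = rot \<zeta> (T x)"
proof (rule eq_if_parts)
  have f: "factor (rot \<zeta> x) b = factor x b" for b
    using assms by (simp add: factor_def \<eta>_def A_rot norm_mult)
  have "T (rot \<zeta> x) \<bullet> b = T x \<bullet> b" if "b \<in> Basis - {p, q}" for b
    using that by (simp add: T_inner f) (simp add: rot_def inner_add_left inner_\<iota>)
  then show "axis_part (T (rot \<zeta> x)) = axis_part (rot \<zeta> (T x))"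
    unfolding axis_part_rot by (simp add: axis_part_eq)
qed simp

text \<open>\<open>T\<close> preserves \<open>P\<close>, so the kernel of its derivative lies in the kernel of
\<open>P\<close>, and there \<open>T\<close> is the identity.\<close>

lemma inj_derivative_T:
  assumes b: "b \<in> B"
  shows "inj (frechet_derivative T (at b))"
proof -
  define D where "D = frechet_derivative T (at b)"
  have D: "(T has_derivative D) (at b)"
    unfolding D_def using smooth_map_derivative[OF smooth_T open_T_dom] B_subset_T_dom b by blast
  note linD = has_derivative_linear[OF D]
  have "((\<lambda>x. P (T x)) has_derivative (\<lambda>v. P (D v))) (at b)"
    by (rule bounded_linear.has_derivative[OF bounded_linear_P D])
  then have "(P has_derivative (\<lambda>v. P (D v))) (at b)" by simp
  then have PD: "P (D v) = P v" for v
    using has_derivative_unique[OF _ bounded_linear_imp_has_derivative[OF bounded_linear_P, of "at b"]] by metis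
  have "v = 0" if v: "D v = 0" for v
  proof -
    have Pv: "P v = 0" using PD[of v] v by (simp add: P_0)
    have "T (b + t *\<^sub>R v) = b + t *\<^sub>R v" for t
      by (rule T_axis) (use b Pv in \<open>simp add: mem_B P_add P_scale\<close>)
    moreover have l: "((\<lambda>t::real. b + t *\<^sub>R v) has_derivative (\<lambda>t. t *\<^sub>R v)) (at 0)"
      by (auto intro!: derivative_eq_intros)
    moreover have "((\<lambda>t::real. T (b + t *\<^sub>R v)) has_derivative (\<lambda>t. D (t *\<^sub>R v))) (at 0)"
      using diff_chain_at[OF l, of T D] D by (simp add: o_def)
    ultimately have "(\<lambda>t. D (t *\<^sub>R v)) = (\<lambda>t. t *\<^sub>R v)"
      using has_derivative_unique by (metis (no_types, lifting) ext)
    then have "D (1 *\<^sub>R v) = 1 *\<^sub>R v" by (rule fun_cong)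
    then show ?thesis using v by simp
  qed
  then show ?thesis using linear_injective_0[OF linD] by (simp add: D_def)
qed

text \<open>Near \<open>B\<close>, the pair of \<open>r\<close> and \<open>P\<close> consists of the coordinates of \<open>M\<close> inverse to \<open>(b, z) \<mapsto> T (b + \<iota> z)\<close>. The
radius \<open>L\<close> must be small for two reasons: \<open>b + \<iota> z\<close> has to lie in the neighbourhood \<open>U\<close> where \<open>T\<close> is invertible, and
the points of \<open>M\<close> with \<open>cmod (P x) < L\<close> have to lie in \<open>T ` U\<close>; both follow from compactness.\<close>

lemma tube_coordinates:
  obtains L r where "L > 0" "smooth_map {x\<in>M. cmod (P x) < L} r"
    "\<forall>x\<in>M. cmod (P x) < L \<longrightarrow> r x \<in> B \<and> T (r x + \<iota> (P x)) = x"
    "\<forall>b\<in>B. \<forall>z. cmod z < L \<longrightarrow> b + \<iota> z \<in> T_dom \<and> r (T (b + \<iota> z)) = b"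
proof -
  have TCk: "Ck_on k T_dom T" for k using smooth_T smooth_map_open_iff[OF open_T_dom] by blast
  have injB: "inj_on T B" by (rule inj_onI) (auto simp: mem_B T_axis)
  obtain U g where U: "open U" "B \<subseteq> U" "U \<subseteq> T_dom" "open (T ` U)" and
    gCk: "\<forall>k. Ck_on k (T ` U) g" and g: "\<forall>x\<in>U. g (T x) = x"
    by (rule inverse_function_near_compact[OF open_T_dom TCk compact_B B_subset_T_dom injB inj_derivative_T])
  obtain e where e: "e > 0" "(\<Union>b\<in>B. ball b e) \<subseteq> U"
    using compact_subset_open_imp_ball_epsilon_subset[OF compact_B U(1,2)] by blast
  have inU: "b + \<iota> z \<in> U" if "b \<in> B" "cmod z < e / 2" for b z
  proof -
    have "dist b (b + \<iota> z) < e" using norm_\<iota>[of z] that by (simp add: dist_norm)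
    then have "b + \<iota> z \<in> ball b e" by simp
    then show ?thesis using that(1) e(2) by blast
  qed
  obtain L2 where L2: "L2 > 0" "\<forall>x\<in>M. cmod (P x) < L2 \<longrightarrow> x \<in> T ` U"
  proof (cases "M - T ` U = {}")
    case True
    then show thesis by (intro that[of 1]) auto
  next
    case False
    have "compact (M - T ` U)" using compact_M U(4) by (rule compact_diff)
    moreover have "continuous_on (M - T ` U) (\<lambda>x. cmod (P x))"
      by (intro continuous_intros bounded_linear.continuous_on[OF bounded_linear_P])
    ultimately obtain x0 where x0: "x0 \<in> M - T ` U" "\<forall>y\<in>M - T ` U. cmod (P x0) \<le> cmod (P y)"
      using False continuous_attains_inf by meson
    have "P x0 \<noteq> 0"
    proof
      assume "P x0 = 0"
      then have "x0 \<in> U" "T x0 = x0" using x0(1) U(2) by (auto simp: mem_B T_axis subset_iff)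
      then show False using x0(1) by (metis DiffE image_eqI)
    qed
    then show thesis by (intro that[of "cmod (P x0)"]) (use x0(2) in force)+
  qed
  define r where "r x = axis_part (g x)" for x
  show thesis
  proof (rule that[of "min (e / 2) L2" r])
    show "0 < min (e / 2) L2" using e L2 by simp
    have "smooth_map (T ` U) r" unfolding r_def
      using gCk smooth_map_open_iff[OF U(4)] by (intro smooth_intros) blast
    then show "smooth_map {x\<in>M. cmod (P x) < min (e / 2) L2} r"
      by (rule smooth_map_subset) (use L2(2) in auto)
    show "\<forall>x\<in>M. cmod (P x) < min (e / 2) L2 \<longrightarrow> r x \<in> B \<and> T (r x + \<iota> (P x)) = x"
    proof (intro ballI impI)
      fix x assume x: "x \<in> M" "cmod (P x) < min (e / 2) L2"
      then obtain y where y: "y \<in> U" "x = T y" using L2(2) by auto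
      have ry: "r x = axis_part y" using g y by (simp add: r_def)
      have "axis_part y \<in> B" using T_M_iff[of y] y x(1) U(3) by auto
      moreover have "P x = P y" using y(2) by simp
      then have "r x + \<iota> (P x) = y" by (simp only: ry axis_part_decomp)
      ultimately show "r x \<in> B \<and> T (r x + \<iota> (P x)) = x" using y ry by simp
    qed
    show "\<forall>b\<in>B. \<forall>z. cmod z < min (e / 2) L2 \<longrightarrow> b + \<iota> z \<in> T_dom \<and> r (T (b + \<iota> z)) = b"
    proof (intro ballI allI impI)
      fix b z assume b: "b \<in> B" "cmod z < min (e / 2) L2"
      then have "b + \<iota> z \<in> U" using inU by simp
      then show "b + \<iota> z \<in> T_dom \<and> r (T (b + \<iota> z)) = b"
        using U(3) g b(1) by (auto simp: r_def axis_part_add_\<iota> axis_part_id mem_B)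
    qed
  qed
qed

section \<open>The open book\<close>

text \<open>The truncated subtractions in the dimensions are harmless: the coefficients \<open>\<nu> p\<close> and \<open>\<nu> q\<close> coincide,
and the support of a point of \<open>B\<close>, which already spans, avoids both \<open>p\<close> and \<open>q\<close>.\<close>

lemma rank_less: "Suc rank \<le> DIM('a)"
proof -
  have "\<nu> ` Basis = \<nu> ` (Basis - {p})" using \<nu>_eq p q pq by (auto simp: image_iff)
  then have "rank \<le> card (\<nu> ` (Basis - {p}))" unfolding rank_def by (simp add: dim_le_card')
  also have "\<dots> \<le> card (Basis - {p})" by (rule card_image_le) simp
  also have "\<dots> = DIM('a) - 1" using p by simp
  finally show ?thesis using DIM_positive[where 'a = 'a] by linarith
qed

lemma rank_less_B:
  assumes "x \<in> B"
  shows "Suc (Suc rank) \<le> DIM('a)"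
proof -
  let ?s = "{b\<in>Basis. x \<bullet> b \<noteq> 0}"
  have "\<nu> ` Basis \<subseteq> span (\<nu> ` ?s)" using spanning[of x] assms by (auto simp: mem_B M_def Q_def)
  then have "rank \<le> card (\<nu> ` ?s)" unfolding rank_def by (intro span_card_ge_dim) auto
  also have "\<dots> \<le> card ?s" by (rule card_image_le) simp
  also have "\<dots> \<le> card (Basis - {p, q})"
    using assms by (intro card_mono) (auto simp: B_def slice_def)
  also have "\<dots> = DIM('a) - 2" using p q pq by (simp add: card_Diff_subset)
  finally have "rank \<le> DIM('a) - 2" .
  moreover have "card {p, q} \<le> DIM('a)" using p q by (intro card_mono) auto
  ultimately show ?thesis using pq by simp
qed

abbreviation d :: nat where "d \<equiv> DIM('a) - rank - 1"

lemma manifold_with_boundary_W: "manifold_with_boundary d W" "manifold_boundary d W = B"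
proof -
  have pB: "{p} \<subseteq> Basis" using p by simp
  have bd: "boundary_point d W x" if "x \<in> W" "x \<bullet> q = 0" for x
    using boundary_point_half_slice[OF _ pB q _ that(2)] that(1) pq by (simp add: W_def)
  have nbd: "\<not> boundary_point d W x" if "x \<in> W" "x \<bullet> q > 0" for x
    using not_boundary_point_half_slice[OF _ pB that(2)] that(1) by (simp add: W_def)
  have int: "interior_point d W x" if "x \<in> W" "x \<bullet> q > 0" for x
  proof -
    have "open {y. 0 < y \<bullet> q}" by (intro open_Collect_less continuous_intros)
    moreover have "W \<inter> {y. 0 < y \<bullet> q} = slice {p} \<inter> {y. 0 < y \<bullet> q}" by (auto simp: W_def)
    ultimately show ?thesis
      using interior_point_open_slice[of x "{p}" "{y. 0 < y \<bullet> q}" W] that p by (simp add: W_def)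
  qed
  have W: "x \<bullet> q = 0 \<or> x \<bullet> q > 0" if "x \<in> W" for x using that by (auto simp: W_def)
  show "manifold_with_boundary d W" unfolding manifold_with_boundary_def using bd int W by blast
  have "B = {x \<in> W. x \<bullet> q = 0}" by (auto simp: B_def W_def slice_def)
  then show "manifold_boundary d W = B"
    unfolding manifold_boundary_def using bd nbd W by fastforce
qed

lemma unit_inverse:
  assumes "cmod \<theta> = 1"
  shows "\<theta> * cnj \<theta> = 1" "cnj \<theta> * \<theta> = 1"
proof -
  show "\<theta> * cnj \<theta> = 1" using complex_norm_square[of \<theta>] assms by simp
  then show "cnj \<theta> * \<theta> = 1" by (simp only: mult.commute)
qed

lemma sgn_unit: "cmod \<theta> = 1 \<Longrightarrow> sgn \<theta> = \<theta>"
  by (simp add: sgn_div_norm)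

lemma diffeo_rot:
  assumes "cmod \<theta> = 1"
  shows "diffeo W (rot \<theta> ` W) (rot \<theta>)"
proof (rule diffeoI[where g = "rot (cnj \<theta>)"])
  show "rot (cnj \<theta>) (rot \<theta> x) = x" for x by (simp add: rot_rot unit_inverse[OF assms])
  then show "y \<in> rot \<theta> ` W \<Longrightarrow> rot (cnj \<theta>) y \<in> W" "y \<in> rot \<theta> ` W \<Longrightarrow> rot \<theta> (rot (cnj \<theta>) y) = y" for y
    by auto
  show "smooth_map W (rot \<theta>)" "smooth_map (rot \<theta> ` W) (rot (cnj \<theta>))"
    by (intro smooth_intros)+
qed simp

lemma mem_fibre: "x \<in> fibre (M - B) angle J \<longleftrightarrow> x \<in> M \<and> P x \<noteq> 0 \<and> angle x \<in> J"
  by (auto simp: fibre_def mem_B)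

lemma P_angle: "P x = cmod (P x) *\<^sub>R angle x"
  by (cases "P x = 0") (auto simp: angle_def sgn_div_norm)

lemma cmod_angle: "P x \<noteq> 0 \<Longrightarrow> cmod (angle x) = 1"
  by (simp add: angle_def norm_sgn)

text \<open>The orbit of \<open>x\<close> meets \<open>W\<close> in the point obtained by rotating back by the angle of \<open>x\<close>.\<close>

lemma unwind_W:
  assumes "x \<in> M" "P x \<noteq> 0"
  shows "rot (cnj (angle x)) x \<in> W" "rot (cnj (angle x)) x \<bullet> q = cmod (P x)"
    "rot (angle x) (rot (cnj (angle x)) x) = x"
proof -
  note u = cmod_angle[OF assms(2)]
  have "P (rot (cnj (angle x)) x) = cnj (angle x) * P x" by simp
  also have "\<dots> = cnj (angle x) * (cmod (P x) *\<^sub>R angle x)" by (rule arg_cong[OF P_angle])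
  also have "\<dots> = (cnj (angle x) * angle x) * of_real (cmod (P x))"
    by (simp add: scaleR_conv_of_real)
  finally have P: "P (rot (cnj (angle x)) x) = of_real (cmod (P x))" using unit_inverse(2)[OF u] by simp
  then show Re: "rot (cnj (angle x)) x \<bullet> q = cmod (P x)" by (simp only: inner_q_Re Re_complex_of_real)
  show "rot (cnj (angle x)) x \<in> W"
    unfolding mem_W Re using P rot_M[of "cnj (angle x)" x] assms(1) u by simp
  show "rot (angle x) (rot (cnj (angle x)) x) = x" by (simp add: rot_rot unit_inverse(1)[OF u])
qed

lemma smooth_angle: "smooth_map {x. P x \<noteq> 0} angle"
proof -
  have eq: "angle x = inverse (sqrt ((Re (P x))\<^sup>2 + (Im (P x))\<^sup>2)) *\<^sub>R P x" for x
    by (simp add: angle_def sgn_div_norm cmod_def divide_inverse)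
  show ?thesis unfolding eq[abs_def]
  proof (intro smooth_map_scaleR smooth_map_inverse smooth_map_sqrt smooth_map_add smooth_map_power
      smooth_map_Re smooth_map_Im smooth_map_P smooth_map_ident)
    fix x assume "x \<in> {x. P x \<noteq> 0}"
    then show pos: "0 < (Re (P x))\<^sup>2 + (Im (P x))\<^sup>2" by (simp add: complex_neq_0)
    then have "0 < sqrt ((Re (P x))\<^sup>2 + (Im (P x))\<^sup>2)" by (simp only: real_sqrt_gt_0_iff)
    then show "sqrt ((Re (P x))\<^sup>2 + (Im (P x))\<^sup>2) \<noteq> 0" by linarith
  qed
qed

lemma angle_rot: "cmod \<zeta> = 1 \<Longrightarrow> angle (rot \<zeta> x) = \<zeta> * angle x"
  by (simp add: angle_def sgn_mult sgn_unit)

text \<open>The rotation trivializes the fibration over the whole circle at once.\<close>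

lemma fibration: "smooth_fibration_S1 (M - B) angle"
  unfolding smooth_fibration_S1_def
proof (intro conjI ballI)
  have nz: "M - B \<subseteq> {x. P x \<noteq> 0}" by (auto simp: mem_B)
  show "smooth_map (M - B) angle" by (rule smooth_map_subset[OF smooth_angle nz])
  show "angle ` (M - B) \<subseteq> S1" using nz cmod_angle by auto
  fix \<theta> assume "\<theta> \<in> S1"
  then have \<theta>: "cmod \<theta> = 1" by simp
  define h where "h x = (angle x, rot (\<theta> * cnj (angle x)) x)" for x
  define g where "g y = rot (fst y * cnj \<theta>) (snd y)" for y
  have "diffeo (fibre (M - B) angle S1) (S1 \<times> fibre (M - B) angle {\<theta>}) h"
  proof (rule diffeoI[where g = g])
    fix x assume x: "x \<in> fibre (M - B) angle S1"
    then have x': "x \<in> M" "P x \<noteq> 0" by (auto simp: mem_fibre)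
    note u = cmod_angle[OF x'(2)]
    have n: "cmod (\<theta> * cnj (angle x)) = 1" using \<theta> u by (simp add: norm_mult)
    have "angle (rot (\<theta> * cnj (angle x)) x) = \<theta> * (cnj (angle x) * angle x)"
      using angle_rot[OF n] by (simp add: mult.assoc)
    then have "angle (rot (\<theta> * cnj (angle x)) x) = \<theta>" using unit_inverse(2)[OF u] by simp
    then show "h x \<in> S1 \<times> fibre (M - B) angle {\<theta>}"
      using u n x' \<theta> rot_M[OF n] by (auto simp: h_def mem_fibre)
    have "angle x * cnj \<theta> * (\<theta> * cnj (angle x)) = (angle x * cnj (angle x)) * (cnj \<theta> * \<theta>)"
      by (simp add: algebra_simps)
    then show "g (h x) = x" using unit_inverse[OF u] unit_inverse[OF \<theta>] by (simp add: g_def h_def rot_rot)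
  next
    fix y assume "y \<in> S1 \<times> fibre (M - B) angle {\<theta>}"
    then obtain \<zeta> w where y: "y = (\<zeta>, w)" "cmod \<zeta> = 1" "w \<in> M" "P w \<noteq> 0" "angle w = \<theta>"
      by (auto simp: mem_fibre)
    have n: "cmod (\<zeta> * cnj \<theta>) = 1" using \<theta> y(2) by (simp add: norm_mult)
    have a: "angle (rot (\<zeta> * cnj \<theta>) w) = \<zeta>"
      using angle_rot[OF n, of w] unit_inverse(2)[OF \<theta>] y(5) by (simp add: mult.assoc)
    then show "g y \<in> fibre (M - B) angle S1"
      using y n rot_M[OF n] by (auto simp: g_def mem_fibre)
    have "\<theta> * cnj \<zeta> * (\<zeta> * cnj \<theta>) = (\<theta> * cnj \<theta>) * (cnj \<zeta> * \<zeta>)" by (simp add: algebra_simps)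
    then show "h (g y) = y" using a unit_inverse[OF y(2)] unit_inverse[OF \<theta>] by (simp add: g_def h_def rot_rot y(1))
  next
    have "smooth_map (fibre (M - B) angle S1) angle"
      by (rule smooth_map_subset[OF smooth_angle]) (auto simp: mem_fibre)
    then show "smooth_map (fibre (M - B) angle S1) h" unfolding h_def
      by (intro smooth_intros)
    show "smooth_map (S1 \<times> fibre (M - B) angle {\<theta>}) g" unfolding g_def
      by (intro smooth_intros)
  qed
  then show "\<exists>J h. openin (top_of_set S1) J \<and> \<theta> \<in> J \<and>
      diffeo (fibre (M - B) angle J) (J \<times> fibre (M - B) angle {\<theta>}) h \<and>
      (\<forall>x\<in>fibre (M - B) angle J. fst (h x) = angle x)"
    using \<open>\<theta> \<in> S1\<close> by (intro exI[of _ S1] exI[of _ h]) (simp add: h_def)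
qed

text \<open>Closing the fibre adds all of \<open>B\<close>: from each point of \<open>B\<close> a curve in \<open>M\<close> starts with velocity
\<open>\<iota> \<theta>\<close>, and along it \<open>P\<close> equals \<open>t * \<theta>\<close> exactly, so it runs inside the fibre for small \<open>t > 0\<close>.\<close>

lemma page_eq:
  assumes \<theta>: "cmod \<theta> = 1"
  shows "page M B angle \<theta> = rot \<theta> ` W"
proof
  have "continuous_on W (rot \<theta>)"
    by (rule smooth_map_continuous_on) (intro smooth_intros)
  then have "closed (rot \<theta> ` W)"
    using compact_W by (intro compact_imp_closed compact_continuous_image)
  moreover have "fibre (M - B) angle {\<theta>} \<subseteq> rot \<theta> ` W"
  proof
    fix x assume "x \<in> fibre (M - B) angle {\<theta>}"
    then have "x \<in> M" "P x \<noteq> 0" "angle x = \<theta>" by (auto simp: mem_fibre)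
    then show "x \<in> rot \<theta> ` W" using unwind_W[of x] by (metis image_eqI)
  qed
  ultimately show "page M B angle \<theta> \<subseteq> rot \<theta> ` W" unfolding page_def by (simp add: closure_minimal)
  show "rot \<theta> ` W \<subseteq> page M B angle \<theta>"
  proof safe
    fix w assume w: "w \<in> W"
    have PW: "P (rot \<theta> w) = of_real (w \<bullet> q) * \<theta>" using w by (simp add: mem_W)
    have xM: "rot \<theta> w \<in> M" using w rot_M[OF \<theta>] by (simp add: mem_W)
    show "rot \<theta> w \<in> page M B angle \<theta>"
    proof (cases "w \<bullet> q = 0")
      case False
      then have "w \<bullet> q > 0" using w by (simp add: mem_W)
      then have "angle (rot \<theta> w) = \<theta>" unfolding angle_def PW using \<theta> by (simp add: sgn_mult sgn_unit sgn_of_real)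
      then have "rot \<theta> w \<in> fibre (M - B) angle {\<theta>}"
        using xM PW False \<theta> by (auto simp: mem_fibre)
      then show ?thesis unfolding page_def using closure_subset by blast
    next
      case True
      define x where "x = rot \<theta> w"
      have Px: "P x = 0" using PW True by (simp add: x_def)
      then have xpq: "x \<bullet> p = 0" "x \<bullet> q = 0" by (auto simp: P_def complex_eq_iff)
      have xs: "x \<in> slice {}" using xM by (simp add: x_def M_eq_slice)
      have tan: "tangential x (\<iota> \<theta>)" unfolding tangential_def
      proof (intro sum.neutral ballI)
        fix b :: 'a assume "b \<in> Basis"
        then show "((x \<bullet> b) * (\<iota> \<theta> \<bullet> b)) *\<^sub>R \<nu> b = 0"
          using inner_\<iota>[of b \<theta>] xpq by (cases "b \<in> {p, q}") auto
      qed
      obtain \<gamma> \<epsilon> where \<gamma>: "0 < \<epsilon>" "smooth_map {-\<epsilon><..<\<epsilon>} \<gamma>" "\<gamma> ` {-\<epsilon><..<\<epsilon>} \<subseteq> slice {} \<inter> UNIV"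
        "\<gamma> 0 = x" "(\<gamma> has_vector_derivative \<iota> \<theta>) (at 0)"
        "\<forall>t. \<forall>b\<in>Basis. x \<bullet> b = 0 \<longrightarrow> \<gamma> t \<bullet> b = t * (\<iota> \<theta> \<bullet> b)"
        by (rule curve_with_velocity[OF xs empty_subsetI open_UNIV UNIV_I tan]) auto
      have P\<gamma>: "P (\<gamma> t) = of_real t * \<theta>" for t
      proof -
        have "P (\<gamma> t) = P (t *\<^sub>R \<iota> \<theta>)" using \<gamma>(6) p q xpq by (simp add: P_def)
        then show ?thesis by (simp add: P_scale scaleR_conv_of_real)
      qed
      have fib: "\<gamma> t \<in> fibre (M - B) angle {\<theta>}" if "0 < t" "t < \<epsilon>" for t
      proof -
        have "t \<in> {-\<epsilon><..<\<epsilon>}" using that by auto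
        then have "\<gamma> t \<in> M" using \<gamma>(3) by (auto simp: M_eq_slice)
        moreover have "angle (\<gamma> t) = \<theta>" unfolding angle_def P\<gamma> using \<theta> that by (simp add: sgn_mult sgn_unit sgn_of_real)
        ultimately show ?thesis using P\<gamma> \<theta> that by (auto simp: mem_fibre)
      qed
      have "continuous (at 0) \<gamma>" using \<gamma>(5) has_vector_derivative_continuous by blast
      then have lim: "(\<gamma> \<longlongrightarrow> x) (at_right 0)" using \<gamma>(4) by (simp add: isCont_def filterlim_at_split)
      have "x \<in> closure (fibre (M - B) angle {\<theta>})"
      proof (rule Lim_in_closed_set[OF closed_closure _ _ lim])
        have "\<forall>\<^sub>F t in at_right 0. t \<in> {0<..<\<epsilon>}" using eventually_at_right_real[OF \<gamma>(1)] .
        then show "\<forall>\<^sub>F t in at_right 0. \<gamma> t \<in> closure (fibre (M - B) angle {\<theta>})"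
          by eventually_elim (use fib closure_subset in \<open>auto simp: subset_iff\<close>)
      qed simp
      then show ?thesis by (simp add: page_def x_def)
    qed
  qed
qed

text \<open>The constant fields \<open>q\<close> and \<open>p\<close> frame the normal bundle: at a point of \<open>B\<close> the corresponding
coordinates vanish, so being tangential to \<open>M\<close> puts no condition on these components.\<close>

lemma trivial_normal_bundle: "trivial_normal_bundle2 M B"
  unfolding trivial_normal_bundle2_def
proof (intro exI conjI ballI allI impI)
  show "smooth_map B (\<lambda>_. q)" "smooth_map B (\<lambda>_. p)" by (rule smooth_map_const)+
  fix b assume b: "b \<in> B"
  then have bpq: "b \<bullet> p = 0" "b \<bullet> q = 0" and bs: "b \<in> slice {p, q}" "b \<in> slice {}"
    by (auto simp: B_def slice_def)
  have TB: "tangent_space B b = {w. tangential b w \<and> (\<forall>c\<in>{p, q}. w \<bullet> c = 0)}"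
    unfolding B_def by (rule tangent_space_slice[OF bs(1)]) (use p q in auto)
  have TM: "tangent_space M b = {w. tangential b w}"
    unfolding M_eq_slice using tangent_space_slice[OF bs(2)] by simp
  have shift: "tangential b (t + \<alpha> *\<^sub>R q + \<beta> *\<^sub>R p) \<longleftrightarrow> tangential b t" for t \<alpha> \<beta>
  proof -
    have "(b \<bullet> e) * ((t + \<alpha> *\<^sub>R q + \<beta> *\<^sub>R p) \<bullet> e) = (b \<bullet> e) * (t \<bullet> e)" if "e \<in> Basis" for e
      using that p q bpq by (cases "e = p \<or> e = q") (auto simp: inner_add_left inner_Basis)
    then have "(\<Sum>e\<in>Basis. ((b \<bullet> e) * ((t + \<alpha> *\<^sub>R q + \<beta> *\<^sub>R p) \<bullet> e)) *\<^sub>R \<nu> e)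
        = (\<Sum>e\<in>Basis. ((b \<bullet> e) * (t \<bullet> e)) *\<^sub>R \<nu> e)"
      by (intro sum.cong refl) (simp only:)
    then show ?thesis by (simp only: tangential_def)
  qed
  show "tangent_space M b = {t + \<alpha> *\<^sub>R q + \<beta> *\<^sub>R p |t \<alpha> \<beta>. t \<in> tangent_space B b}"
  proof (intro equalityI subsetI)
    fix w assume w: "w \<in> tangent_space M b"
    define t where "t = w - (w \<bullet> q) *\<^sub>R q - (w \<bullet> p) *\<^sub>R p"
    have w': "w = t + (w \<bullet> q) *\<^sub>R q + (w \<bullet> p) *\<^sub>R p" by (simp add: t_def)
    have "t \<in> tangent_space B b"
      using w shift[of t "w \<bullet> q" "w \<bullet> p"] w' inner_pq
      by (auto simp: TM TB t_def inner_diff_left)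
    then show "w \<in> {t + \<alpha> *\<^sub>R q + \<beta> *\<^sub>R p |t \<alpha> \<beta>. t \<in> tangent_space B b}" using w' by blast
  qed (use shift in \<open>auto simp: TM TB\<close>)
  fix \<alpha> \<beta> assume "\<alpha> *\<^sub>R q + \<beta> *\<^sub>R p \<in> tangent_space B b"
  then have "(\<alpha> *\<^sub>R q + \<beta> *\<^sub>R p) \<bullet> q = 0" "(\<alpha> *\<^sub>R q + \<beta> *\<^sub>R p) \<bullet> p = 0" by (auto simp: TB)
  then show "\<alpha> = 0" "\<beta> = 0" by (simp_all add: inner_add_left inner_pq)
qed

text \<open>In the collar, the point with coordinates \<open>(b, t)\<close> goes to the point with coordinates \<open>(b, \<kappa> t)\<close>; beyond \<open>t = l\<close> nothing
moves.\<close>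

definition push :: "real \<Rightarrow> ('a \<Rightarrow> 'a) \<Rightarrow> (real \<Rightarrow> real) \<Rightarrow> 'a \<Rightarrow> 'a" where
  "push l r \<kappa> x = (if x \<bullet> q < l then T (r x + \<kappa> (x \<bullet> q) *\<^sub>R q) else x)"

text \<open>The collar formula stays valid for \<open>l \<le> t < L\<close>, where \<open>\<kappa> t = t\<close> and \<open>T\<close> inverts the collar coordinates.
So the two cases in the definition agree on an open overlap and the map is smooth. The general lower bound \<open>a\<close> allows
using this for \<open>\<phi>\<close> with \<open>a = 0\<close> and for its inverse with \<open>a = \<epsilon>\<close>.\<close>

lemma push:
  assumes l: "0 < l" "l < L"
    and r: "smooth_map {x\<in>M. cmod (P x) < L} r"
      "\<forall>x\<in>M. cmod (P x) < L \<longrightarrow> r x \<in> B \<and> T (r x + \<iota> (P x)) = x"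
      "\<forall>b\<in>B. \<forall>z. cmod z < L \<longrightarrow> b + \<iota> z \<in> T_dom \<and> r (T (b + \<iota> z)) = b"
    and a: "0 \<le> a" and \<kappa>: "smooth_map {a..} \<kappa>"
      "\<forall>t\<ge>a. 0 \<le> \<kappa> t \<and> (t < l \<longleftrightarrow> \<kappa> t < l)" "\<forall>t\<ge>l. \<kappa> t = t"
  shows "smooth_map (W \<inter> {x. a \<le> x \<bullet> q}) (push l r \<kappa>)"
    and "\<And>x. x \<in> W \<Longrightarrow> a \<le> x \<bullet> q \<Longrightarrow> push l r \<kappa> x \<in> W \<and> push l r \<kappa> x \<bullet> q = \<kappa> (x \<bullet> q) \<and>
       (x \<bullet> q < l \<longrightarrow> r (push l r \<kappa> x) = r x)"
proof -
  have base: "r x \<in> B" "T (r x + (x \<bullet> q) *\<^sub>R q) = x" if "x \<in> W" "x \<bullet> q < L" for x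
  proof -
    have *: "x \<in> M" "P x = of_real (x \<bullet> q)" "0 \<le> x \<bullet> q" using that by (auto simp: mem_W)
    then have "cmod (P x) < L" using that(2) by simp
    then have "r x \<in> B \<and> T (r x + \<iota> (P x)) = x" using r(2) *(1) by blast
    then show "r x \<in> B" "T (r x + (x \<bullet> q) *\<^sub>R q) = x" by (simp_all add: *(2) \<iota>_of_real)
  qed
  have moved: "T (b + t *\<^sub>R q) \<in> W \<and> T (b + t *\<^sub>R q) \<bullet> q = t \<and> r (T (b + t *\<^sub>R q)) = b \<and> b + t *\<^sub>R q \<in> T_dom"
    if "b \<in> B" "0 \<le> t" "t < L" for b t
  proof -
    have *: "b + \<iota> (of_real t) \<in> T_dom" "r (T (b + \<iota> (of_real t))) = b" using r(3) that by auto
    have "axis_part (b + \<iota> (of_real t)) = b" using that(1) by (simp add: axis_part_add_\<iota> axis_part_id mem_B)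
    then have "T (b + \<iota> (of_real t)) \<in> M" using T_M_iff[OF *(1)] that(1) by simp
    moreover have "P (T (b + \<iota> (of_real t))) = of_real t" using that(1) by (simp add: P_add mem_B)
    ultimately show ?thesis
      using * that(2) by (simp add: mem_W inner_q_Re \<iota>_of_real)
  qed
  show "push l r \<kappa> x \<in> W \<and> push l r \<kappa> x \<bullet> q = \<kappa> (x \<bullet> q) \<and> (x \<bullet> q < l \<longrightarrow> r (push l r \<kappa> x) = r x)"
    if x: "x \<in> W" "a \<le> x \<bullet> q" for x
  proof (cases "x \<bullet> q < l")
    case True
    then have "0 \<le> \<kappa> (x \<bullet> q)" "\<kappa> (x \<bullet> q) < L" using \<kappa>(2) x(2) l by force+
    then show ?thesis using moved[OF base(1)[OF x(1)]] True l by (simp add: push_def)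
  next
    case False
    then show ?thesis using \<kappa>(3) x by (simp add: push_def)
  qed
  show "smooth_map (W \<inter> {x. a \<le> x \<bullet> q}) (push l r \<kappa>)"
  proof (rule smooth_map_local)
    fix x assume x: "x \<in> W \<inter> {x. a \<le> x \<bullet> q}"
    have o: "open {x. x \<bullet> q < L}" "open {x. l < x \<bullet> q}"
      by (intro open_Collect_less continuous_intros)+
    show "\<exists>U. open U \<and> x \<in> U \<and> smooth_map (W \<inter> {x. a \<le> x \<bullet> q} \<inter> U) (push l r \<kappa>)"
    proof (cases "x \<bullet> q < L")
      case True
      let ?X = "W \<inter> {x. a \<le> x \<bullet> q} \<inter> {x. x \<bullet> q < L}"
      have "smooth_map ?X (\<lambda>x. T (r x + \<kappa> (x \<bullet> q) *\<^sub>R q))"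
      proof (rule smooth_map_compose[OF _ smooth_T])
        have "smooth_map ?X r"
          by (rule smooth_map_subset[OF r(1)]) (auto simp: mem_W)
        moreover have "smooth_map ?X (\<lambda>x. \<kappa> (x \<bullet> q))"
          by (rule smooth_map_compose[OF _ \<kappa>(1)])
            (auto intro: smooth_map_inner smooth_map_ident smooth_map_const)
        ultimately show "smooth_map ?X (\<lambda>x. r x + \<kappa> (x \<bullet> q) *\<^sub>R q)"
          by (intro smooth_intros)
        show "(\<lambda>x. r x + \<kappa> (x \<bullet> q) *\<^sub>R q) ` ?X \<subseteq> T_dom"
        proof safe
          fix y assume y: "y \<in> W" "a \<le> y \<bullet> q" "y \<bullet> q < L"
          have "0 \<le> \<kappa> (y \<bullet> q)" "\<kappa> (y \<bullet> q) < L"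
            using \<kappa>(2,3) y l by (cases "y \<bullet> q < l"; force)+
          then show "r y + \<kappa> (y \<bullet> q) *\<^sub>R q \<in> T_dom" using moved[OF base(1)[OF y(1,3)]] by blast
        qed
      qed
      then have "smooth_map ?X (push l r \<kappa>)"
      proof (rule smooth_map_cong)
        fix y assume "y \<in> ?X"
        then show "T (r y + \<kappa> (y \<bullet> q) *\<^sub>R q) = push l r \<kappa> y"
          using base(2)[of y] \<kappa>(3) by (auto simp: push_def)
      qed
      then show ?thesis using o(1) True by blast
    next
      case False
      have "smooth_map (W \<inter> {x. a \<le> x \<bullet> q} \<inter> {x. l < x \<bullet> q}) (push l r \<kappa>)"
        by (rule smooth_map_cong[OF smooth_map_ident]) (auto simp: push_def)
      then show ?thesis using o(2) False l by (intro exI[of _ "{x. l < x \<bullet> q}"]) auto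
    qed
  qed
qed

text \<open>The rescaling by \<open>\<epsilon>\<close> makes the tube the set where \<open>cmod (P x) \<le> \<epsilon>\<close>, parametrized by the unit disc; as \<open>T\<close> preserves
\<open>P\<close>, its angular coordinate is the projection of the open book.\<close>

lemma tube_diffeo:
  assumes \<epsilon>: "0 < \<epsilon>" "\<epsilon> < L"
    and r: "smooth_map {x\<in>M. cmod (P x) < L} r"
      "\<forall>x\<in>M. cmod (P x) < L \<longrightarrow> r x \<in> B \<and> T (r x + \<iota> (P x)) = x"
      "\<forall>b\<in>B. \<forall>z. cmod z < L \<longrightarrow> b + \<iota> z \<in> T_dom \<and> r (T (b + \<iota> z)) = b"
  shows "tubular_angular M B angle (\<lambda>(b, z). T (b + \<iota> (\<epsilon> *\<^sub>R z))) {x\<in>M. cmod (P x) \<le> \<epsilon>}"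
proof -
  let ?N = "{x\<in>M. cmod (P x) \<le> \<epsilon>}"
  define \<tau> where "\<tau> y = T (fst y + \<iota> (\<epsilon> *\<^sub>R snd y))" for y
  have small: "cmod (\<epsilon> *\<^sub>R z) \<le> \<epsilon>" "cmod (\<epsilon> *\<^sub>R z) < L" if "z \<in> D2" for z
  proof -
    show "cmod (\<epsilon> *\<^sub>R z) \<le> \<epsilon>" using that \<epsilon>(1) by (simp add: mult_left_le)
    then show "cmod (\<epsilon> *\<^sub>R z) < L" using \<epsilon>(2) by linarith
  qed
  have P\<tau>: "P (T (b + \<iota> z)) = z" if "b \<in> B" for b z using that by (simp add: P_add mem_B)
  have "diffeo (B \<times> D2) ?N \<tau>"
  proof (rule diffeoI[where g = "\<lambda>x. (r x, inverse \<epsilon> *\<^sub>R P x)"])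
    fix y assume "y \<in> B \<times> D2"
    then obtain b z where y: "y = (b, z)" "b \<in> B" "z \<in> D2" by auto
    note s = small[OF y(3)]
    have dom: "b + \<iota> (\<epsilon> *\<^sub>R z) \<in> T_dom" "r (T (b + \<iota> (\<epsilon> *\<^sub>R z))) = b" using r(3) y(2) s(2) by auto
    have "axis_part (b + \<iota> (\<epsilon> *\<^sub>R z)) = b" using y(2) by (simp add: axis_part_add_\<iota> axis_part_id mem_B)
    then have "T (b + \<iota> (\<epsilon> *\<^sub>R z)) \<in> M" using T_M_iff[OF dom(1)] y(2) by simp
    then show "\<tau> y \<in> ?N" using s(1) P\<tau>[OF y(2)] by (simp add: \<tau>_def y(1) del: P_T norm_scaleR)
    show "(r (\<tau> y), inverse \<epsilon> *\<^sub>R P (\<tau> y)) = y"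
      using dom(2) P\<tau>[OF y(2)] \<epsilon>(1) by (simp add: \<tau>_def y(1) del: P_T)
  next
    fix x assume x: "x \<in> ?N"
    then have "r x \<in> B \<and> T (r x + \<iota> (P x)) = x" using r(2) \<epsilon>(2) by auto
    then show "(r x, inverse \<epsilon> *\<^sub>R P x) \<in> B \<times> D2" "\<tau> (r x, inverse \<epsilon> *\<^sub>R P x) = x"
      using x \<epsilon>(1) by (simp_all add: \<tau>_def field_simps)
  next
    show "smooth_map (B \<times> D2) \<tau>" unfolding \<tau>_def
    proof (rule smooth_map_compose[OF _ smooth_T])
      show "smooth_map (B \<times> D2) (\<lambda>y. fst y + \<iota> (\<epsilon> *\<^sub>R snd y))"
        by (intro smooth_intros)
      show "(\<lambda>y. fst y + \<iota> (\<epsilon> *\<^sub>R snd y)) ` (B \<times> D2) \<subseteq> T_dom"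
        using r(3) small(2) by (auto simp del: norm_scaleR)
    qed
    have "smooth_map ?N r" by (rule smooth_map_subset[OF r(1)]) (use \<epsilon> in auto)
    then show "smooth_map ?N (\<lambda>x. (r x, inverse \<epsilon> *\<^sub>R P x))"
      by (intro smooth_intros)
  qed
  moreover have "\<exists>O'. openin (top_of_set M) O' \<and> B \<subseteq> O' \<and> O' \<subseteq> ?N"
  proof (intro exI conjI)
    have "open {x. cmod (P x) < \<epsilon>}"
      by (intro open_Collect_less continuous_intros bounded_linear.continuous_on[OF bounded_linear_P])
    then show "openin (top_of_set M) (M \<inter> {x. cmod (P x) < \<epsilon>})" by (rule openin_open_Int)
    show "B \<subseteq> M \<inter> {x. cmod (P x) < \<epsilon>}" using \<epsilon>(1) by (auto simp: mem_B)
  qed auto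
  moreover have "T (b + \<iota> 0) = b" if "b \<in> B" for b using that by (simp add: \<iota>_0 T_axis mem_B)
  moreover have "angle (T (b + \<iota> (\<epsilon> *\<^sub>R z))) = sgn z" if "b \<in> B" for b z
    using P\<tau>[OF that] \<epsilon>(1) by (simp add: angle_def sgn_scaleR del: P_T)
  moreover have "\<tau> = (\<lambda>(b, z). T (b + \<iota> (\<epsilon> *\<^sub>R z)))" by (auto simp: \<tau>_def fun_eq_iff)
  ultimately show ?thesis by (auto simp: tubular_angular_def)
qed

text \<open>The two pieces of \<open>M\<close> are \<open>M1\<close>, where \<open>cmod (P x) \<ge> \<epsilon>\<close>, and \<open>M2\<close>, where \<open>cmod (P x) \<le> \<epsilon>\<close>. The map \<open>\<Phi>\<close> onto the first rotates the
pushed page \<open>S ` W\<close>; its inverse rotates back to \<open>W\<close> and undoes the push.\<close>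

theorem open_book_trivial_monodromy_rotational: "open_book_trivial_monodromy M B W"
proof -
  obtain L r where L: "L > 0" and r: "smooth_map {x\<in>M. cmod (P x) < L} r"
    "\<forall>x\<in>M. cmod (P x) < L \<longrightarrow> r x \<in> B \<and> T (r x + \<iota> (P x)) = x"
    "\<forall>b\<in>B. \<forall>z. cmod z < L \<longrightarrow> b + \<iota> z \<in> T_dom \<and> r (T (b + \<iota> z)) = b"
    by (rule tube_coordinates)
  \<comment> \<open>The push ends strictly inside the tube, which leaves room for the overlap in the smoothness of \<open>push\<close>.\<close>
  define l where "l = L / 2"
  have l: "0 < l" "l < L" using L by (auto simp: l_def)
  obtain \<phi> \<psi> :: "real \<Rightarrow> real" and \<epsilon> :: real where \<epsilon>: "0 < \<epsilon>" "\<epsilon> < l"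
    and \<phi>\<psi>: "smooth_map {0..} \<phi>" "smooth_map {\<epsilon>..} \<psi>" "\<phi> 0 = \<epsilon>"
    "\<forall>t\<ge>0. \<phi> t \<ge> \<epsilon> \<and> \<psi> (\<phi> t) = t \<and> (t < l \<longleftrightarrow> \<phi> t < l)"
    "\<forall>t\<ge>\<epsilon>. \<psi> t \<ge> 0 \<and> \<phi> (\<psi> t) = t \<and> (t < l \<longleftrightarrow> \<psi> t < l)"
    "\<forall>t\<ge>l. \<phi> t = t \<and> \<psi> t = t"
    by (rule half_line_push[OF l(1)])
  have \<epsilon>L: "\<epsilon> < L" using \<epsilon>(2) l(2) by simp
  define S where "S = push l r \<phi>"
  define S' where "S' = push l r \<psi>"
  have \<phi>c: "\<forall>t\<ge>0. 0 \<le> \<phi> t \<and> (t < l \<longleftrightarrow> \<phi> t < l)" "\<forall>t\<ge>l. \<phi> t = t"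
    using \<phi>\<psi>(4,6) \<epsilon>(1) by (auto intro: order_trans[OF less_imp_le[OF \<epsilon>(1)]])
  have \<psi>c: "\<forall>t\<ge>\<epsilon>. 0 \<le> \<psi> t \<and> (t < l \<longleftrightarrow> \<psi> t < l)" "\<forall>t\<ge>l. \<psi> t = t"
    using \<phi>\<psi>(5,6) by auto
  have W0: "W \<inter> {x. 0 \<le> x \<bullet> q} = W" by (auto simp: W_def)
  have smS: "smooth_map W S"
    using push(1)[OF l r order_refl \<phi>\<psi>(1) \<phi>c] by (simp add: S_def W0)
  have smS': "smooth_map (W \<inter> {x. \<epsilon> \<le> x \<bullet> q}) S'"
    using push(1)[OF l r less_imp_le[OF \<epsilon>(1)] \<phi>\<psi>(2) \<psi>c] by (simp add: S'_def)
  have S: "S x \<in> W \<and> S x \<bullet> q = \<phi> (x \<bullet> q) \<and> (x \<bullet> q < l \<longrightarrow> r (S x) = r x)" if "x \<in> W" for x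
    unfolding S_def by (rule push(2)[OF l r order_refl \<phi>\<psi>(1) \<phi>c that]) (use that in \<open>simp add: mem_W\<close>)
  have S': "S' x \<in> W \<and> S' x \<bullet> q = \<psi> (x \<bullet> q) \<and> (x \<bullet> q < l \<longrightarrow> r (S' x) = r x)"
    if "x \<in> W" "\<epsilon> \<le> x \<bullet> q" for x
    unfolding S'_def by (rule push(2)[OF l r less_imp_le[OF \<epsilon>(1)] \<phi>\<psi>(2) \<psi>c that])
  have fixed: "T (r x + (x \<bullet> q) *\<^sub>R q) = x" if "x \<in> W" "x \<bullet> q < l" for x
  proof -
    have "P x = of_real (x \<bullet> q)" "x \<in> M" "cmod (P x) < L" using that l by (auto simp: mem_W)
    then show ?thesis using r(2) by (metis \<iota>_of_real)
  qed
  have S'S: "S' (S x) = x" if x: "x \<in> W" for x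
  proof (cases "x \<bullet> q < l")
    case True
    have x0: "0 \<le> x \<bullet> q" using x by (simp add: mem_W)
    have s: "S x \<bullet> q = \<phi> (x \<bullet> q)" "r (S x) = r x" "\<phi> (x \<bullet> q) < l"
      using S[OF x] True \<phi>c(1) x0 by blast+
    have "S' (S x) = T (r x + \<psi> (\<phi> (x \<bullet> q)) *\<^sub>R q)"
      by (simp only: S'_def push_def s if_True)
    then show ?thesis using fixed[OF x True] \<phi>\<psi>(4) x0 by simp
  next
    case False
    then show ?thesis by (simp add: S_def S'_def push_def)
  qed
  have SS': "S (S' x) = x" if x: "x \<in> W" "\<epsilon> \<le> x \<bullet> q" for x
  proof (cases "x \<bullet> q < l")
    case True
    have s: "S' x \<bullet> q = \<psi> (x \<bullet> q)" "r (S' x) = r x" "\<psi> (x \<bullet> q) < l"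
      using S'[OF x] True \<psi>c(1) x(2) by blast+
    have "S (S' x) = T (r x + \<phi> (\<psi> (x \<bullet> q)) *\<^sub>R q)"
      by (simp only: S_def push_def s if_True)
    then show ?thesis using fixed[OF x(1) True] \<phi>\<psi>(5) x(2) by simp
  next
    case False
    then show ?thesis by (simp add: S_def S'_def push_def)
  qed
  define \<Phi> where "\<Phi> y = rot (snd y) (S (fst y))" for y
  define \<tau> where "\<tau> = (\<lambda>(b, z). T (b + \<iota> (\<epsilon> *\<^sub>R z)))"
  define M1 where "M1 = {x\<in>M. \<epsilon> \<le> cmod (P x)}"
  define M2 where "M2 = {x\<in>M. cmod (P x) \<le> \<epsilon>}"
  have PS: "P (S w) = of_real (\<phi> (w \<bullet> q))" "\<phi> (w \<bullet> q) \<ge> \<epsilon>" if "w \<in> W" for w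
    using S[OF that] \<phi>\<psi>(4) that by (auto simp: mem_W)
  have angle\<Phi>: "angle (\<Phi> (w, \<theta>)) = \<theta>" if "w \<in> W" "cmod \<theta> = 1" for w \<theta>
  proof -
    have "\<phi> (w \<bullet> q) > 0" using PS(2)[OF that(1)] \<epsilon>(1) by linarith
    then show ?thesis
      using that PS(1)[OF that(1)] by (simp add: \<Phi>_def angle_rot) (simp add: angle_def sgn_of_real)
  qed
  have \<Phi>: "diffeo (W \<times> S1) M1 \<Phi>"
  proof (rule diffeoI[where g = "\<lambda>x. (S' (rot (cnj (angle x)) x), angle x)"])
    fix y assume "y \<in> W \<times> S1"
    then obtain w \<theta> where y: "y = (w, \<theta>)" "w \<in> W" "cmod \<theta> = 1" by auto
    have "\<epsilon> \<le> cmod (P (\<Phi> y))" using PS[OF y(2)] y(1,3) \<epsilon>(1) by (simp add: \<Phi>_def norm_mult)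
    then show "\<Phi> y \<in> M1" using S[OF y(2)] rot_M[OF y(3)] by (simp add: M1_def \<Phi>_def y(1) mem_W)
    have a: "angle (\<Phi> y) = \<theta>" using angle\<Phi>[OF y(2,3)] y(1) by simp
    have "rot (cnj \<theta>) (\<Phi> y) = S w" by (simp add: \<Phi>_def y(1) rot_rot unit_inverse(2)[OF y(3)])
    then show "(S' (rot (cnj (angle (\<Phi> y))) (\<Phi> y)), angle (\<Phi> y)) = y"
      using a S'S[OF y(2)] y(1) by simp
  next
    fix x assume "x \<in> M1"
    then have x: "x \<in> M" "P x \<noteq> 0" "\<epsilon> \<le> cmod (P x)" using \<epsilon>(1) by (auto simp: M1_def)
    note w = unwind_W[OF x(1,2)]
    have "S' (rot (cnj (angle x)) x) \<in> W" using S'[OF w(1)] w(2) x(3) by simp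
    then show "(S' (rot (cnj (angle x)) x), angle x) \<in> W \<times> S1" using cmod_angle[OF x(2)] by simp
    have "S (S' (rot (cnj (angle x)) x)) = rot (cnj (angle x)) x" using SS'[OF w(1)] w(2) x(3) by simp
    then show "\<Phi> (S' (rot (cnj (angle x)) x), angle x) = x" using w(3) by (simp add: \<Phi>_def)
  next
    have "smooth_map (W \<times> S1) (\<lambda>y. S (fst y))"
      by (rule smooth_map_compose[OF smooth_map_fst[OF smooth_map_ident] smS]) auto
    then show "smooth_map (W \<times> S1) \<Phi>" unfolding \<Phi>_def
      by (intro smooth_intros)
    have M1nz: "M1 \<subseteq> {x. P x \<noteq> 0}" using \<epsilon>(1) by (auto simp: M1_def)
    have a: "smooth_map M1 angle" by (rule smooth_map_subset[OF smooth_angle M1nz])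
    have "smooth_map M1 (\<lambda>x. S' (rot (cnj (angle x)) x))"
    proof (rule smooth_map_compose[OF _ smS'])
      show "smooth_map M1 (\<lambda>x. rot (cnj (angle x)) x)"
        by (intro smooth_map_rot smooth_map_cnj a smooth_map_ident)
      show "(\<lambda>x. rot (cnj (angle x)) x) ` M1 \<subseteq> W \<inter> {x. \<epsilon> \<le> x \<bullet> q}"
      proof safe
        fix x assume x: "x \<in> M1"
        then have x': "x \<in> M" "P x \<noteq> 0" using M1nz by (auto simp: M1_def)
        show "rot (cnj (angle x)) x \<in> W" by (rule unwind_W(1)[OF x'])
        show "\<epsilon> \<le> rot (cnj (angle x)) x \<bullet> q" using unwind_W(2)[OF x'] x by (simp add: M1_def)
      qed
    qed
    then show "smooth_map M1 (\<lambda>x. (S' (rot (cnj (angle x)) x), angle x))"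
      by (intro smooth_map_Pair a)
  qed
  have \<tau>: "tubular_angular M B angle \<tau> M2"
    unfolding \<tau>_def M2_def by (rule tube_diffeo[OF \<epsilon>(1) \<epsilon>L r])
  have glue: "\<Phi> (b, \<theta>) = \<tau> (b, \<theta>)" if b: "b \<in> B" and \<theta>: "cmod \<theta> = 1" for b \<theta>
  proof -
    have b0: "P b = 0" "b \<in> M" "b \<bullet> q = 0" using b by (auto simp: mem_B P_def complex_eq_iff)
    have rb: "r b = b" using r(3) b L T_axis[OF b0(1)] by (metis \<iota>_0 add.right_neutral norm_zero)
    have "S b = T (b + \<iota> (of_real \<epsilon>))"
      using l(1) by (simp add: S_def push_def b0(3) rb \<phi>\<psi>(3) \<iota>_of_real)
    then have "\<Phi> (b, \<theta>) = T (rot \<theta> (b + \<iota> (of_real \<epsilon>)))" by (simp add: \<Phi>_def T_rot[OF \<theta>])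
    also have "rot \<theta> (b + \<iota> (of_real \<epsilon>)) = b + \<iota> (\<epsilon> *\<^sub>R \<theta>)"
      using rot_add_\<iota>[OF b0(1)] by (simp add: scaleR_conv_of_real mult.commute)
    finally show ?thesis by (simp add: \<tau>_def)
  qed
  have inter: "M1 \<inter> M2 = \<Phi> ` (B \<times> S1)"
  proof (intro equalityI subsetI)
    fix x assume "x \<in> M1 \<inter> M2"
    then have x: "x \<in> M" "cmod (P x) = \<epsilon>" by (auto simp: M1_def M2_def)
    then have rx: "r x \<in> B" "T (r x + \<iota> (P x)) = x" using r(2) \<epsilon>L by auto
    have nz: "P x \<noteq> 0" using x(2) \<epsilon>(1) by auto
    have "\<tau> (r x, angle x) = x" using rx(2) P_angle[of x] x(2) by (simp add: \<tau>_def)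
    then have "x = \<Phi> (r x, angle x)" using glue[OF rx(1) cmod_angle[OF nz]] by simp
    then show "x \<in> \<Phi> ` (B \<times> S1)" using rx(1) cmod_angle[OF nz] by (intro image_eqI) auto
  next
    fix x assume "x \<in> \<Phi> ` (B \<times> S1)"
    then obtain b \<theta> where x: "x = \<Phi> (b, \<theta>)" "b \<in> B" "cmod \<theta> = 1" by auto
    have bW: "b \<in> W" using x(2) by (auto simp: B_def W_def slice_def)
    then have "x \<in> M1" using diffeo_in[OF \<Phi>, of "(b, \<theta>)"] x by simp
    moreover have "cmod (P x) = \<epsilon>"
    proof -
      have "b \<bullet> q = 0" using x(2) by (simp add: B_def slice_def)
      then show ?thesis using PS(1)[OF bW] x(1,3) \<phi>\<psi>(3) \<epsilon>(1) by (simp add: \<Phi>_def norm_mult)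
    qed
    ultimately show "x \<in> M1 \<inter> M2" by (simp add: M1_def M2_def)
  qed
  have rotB: "rot \<theta> ` B = B" if "cmod \<theta> = 1" for \<theta>
  proof -
    have "rot \<theta> b = b" if "b \<in> B" for b using that by (simp add: rot_def mem_B \<iota>_0)
    then show ?thesis by (auto simp: image_iff)
  qed
  have book: "open_book d M B angle" unfolding open_book_def
  proof (intro conjI ballI)
    have "Suc d = DIM('a) - rank - card ({} :: 'a set)" using rank_less by simp
    then show "closed_manifold (Suc d) M" using closed_manifold_slice[of "{}"] by (simp add: M_eq_slice)
    show "B \<subseteq> M" by (auto simp: mem_B)
    show "B = {} \<or> (\<exists>c. d = Suc c \<and> closed_manifold c B)"
    proof (cases "B = {}")
      case False
      then obtain x where "x \<in> B" by blast
      then have "d = Suc (DIM('a) - rank - card {p, q})" using rank_less_B[of x] pq by simp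
      moreover have "closed_manifold (DIM('a) - rank - card {p, q}) B"
        unfolding B_def by (rule closed_manifold_slice) (use p q in auto)
      ultimately show ?thesis by blast
    qed simp
    show "trivial_normal_bundle2 M B" by (rule trivial_normal_bundle)
    show "smooth_fibration_S1 (M - B) angle" by (rule fibration)
    show "\<exists>\<tau> N. tubular_angular M B angle \<tau> N" using \<tau> by blast
    fix \<theta> assume "\<theta> \<in> S1"
    then have \<theta>: "cmod \<theta> = 1" by simp
    note D = diffeo_rot[OF \<theta>]
    show "manifold_with_boundary d (page M B angle \<theta>)"
      unfolding page_eq[OF \<theta>] by (rule manifold_with_boundary_diffeo[OF D manifold_with_boundary_W(1)])
    show "manifold_boundary d (page M B angle \<theta>) = B"
      unfolding page_eq[OF \<theta>] manifold_boundary_diffeo[OF D] manifold_with_boundary_W(2) by (rule rotB[OF \<theta>])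
  qed
  have mono: "trivial_monodromy d M B angle W" unfolding trivial_monodromy_def manifold_with_boundary_W(2)
  proof (intro exI conjI ballI)
    show "diffeo (W \<times> S1) M1 \<Phi>" by (rule \<Phi>)
    show "tubular_angular M B angle \<tau> M2" by (rule \<tau>)
    show "M = M1 \<union> M2" by (auto simp: M1_def M2_def)
    show "M1 \<inter> M2 = \<Phi> ` (B \<times> S1)" by (rule inter)
    show "\<Phi> (b, \<theta>) = \<tau> (b, \<theta>)" if "b \<in> B" "\<theta> \<in> S1" for b \<theta> using glue that by simp
    show "angle (\<Phi> (w, \<theta>)) = \<theta>" if "w \<in> W" "\<theta> \<in> S1" for w \<theta> using angle\<Phi> that by simp
  qed
  have "W = page M B angle 1" by (simp add: page_eq)
  then show ?thesis unfolding open_book_trivial_monodromy_def using book mono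
    by (intro exI[of _ d] exI[of _ angle]) (auto intro!: bexI[of _ 1])
qed

end

section \<open>Weak hyperbolicity\<close>

text \<open>The origin lies in the convex hull of the \<open>\<Lambda> i\<close> with \<open>r i \<noteq> 0\<close>. By Caratheodory's theorem it lies in
the convex hull of at most \<open>a + 1\<close> of them, where \<open>a\<close> is the dimension of their affine hull. Weak hyperbolicity forces \<open>a + 1\<close>
to exceed \<open>dim E\<close>, so the affine hull is \<open>E\<close>. In homogeneous coordinates, lying in the affine hull becomes lying in a
span.\<close>

lemma weakly_hyperbolic_spanning:
  fixes \<Lambda> :: "'n::finite \<Rightarrow> 'v::euclidean_space" and r :: "'n \<Rightarrow> real"
  assumes wh: "weakly_hyperbolic E \<Lambda>"
    and r: "\<And>i. 0 \<le> r i" "(\<Sum>i\<in>UNIV. r i *\<^sub>R \<Lambda> i) = 0" "(\<Sum>i\<in>UNIV. r i) = 1"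
  shows "(\<Lambda> k, 1 :: real) \<in> span ((\<lambda>i. (\<Lambda> i, 1)) ` {i. r i \<noteq> 0})"
proof -
  let ?S = "{i. r i \<noteq> 0}"
  have E: "subspace E" "range \<Lambda> \<subseteq> E" and J: "\<And>J. card J \<le> dim E \<Longrightarrow> 0 \<notin> convex hull (\<Lambda> ` J)"
    using wh by (auto simp: weakly_hyperbolic_def)
  have s1: "(\<Sum>i\<in>?S. r i) = 1"
    unfolding r(3)[symmetric] by (rule sum.mono_neutral_left) auto
  have s0: "(\<Sum>i\<in>?S. r i *\<^sub>R \<Lambda> i) = 0"
    unfolding r(2)[symmetric] by (rule sum.mono_neutral_left) auto
  have "(\<Sum>i\<in>?S. r i *\<^sub>R \<Lambda> i) \<in> convex hull (\<Lambda> ` ?S)"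
    by (rule convex_sum[OF _ convex_convex_hull s1]) (auto simp: r(1) hull_inc)
  then have "\<exists>X. finite X \<and> X \<subseteq> \<Lambda> ` ?S \<and> card X \<le> aff_dim (\<Lambda> ` ?S) + 1 \<and> 0 \<in> convex hull X"
    unfolding s0 caratheodory_aff_dim[of "\<Lambda> ` ?S"] by (rule CollectD)
  then obtain X where X: "X \<subseteq> \<Lambda> ` ?S" "card X \<le> aff_dim (\<Lambda> ` ?S) + 1" "0 \<in> convex hull X"
    by blast
  obtain J0 where J0: "inj_on \<Lambda> J0" "X = \<Lambda> ` J0" using X(1) unfolding subset_image_inj by blast
  have "dim E < card J0" using J[of J0] X(3) unfolding J0(2) by (meson not_le)
  then have "int (dim E) \<le> aff_dim (\<Lambda> ` ?S)" using X(2) J0 by (simp add: card_image)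
  moreover have sub: "affine hull (\<Lambda> ` ?S) \<subseteq> E"
    using E by (intro hull_minimal subspace_imp_affine) auto
  moreover have "aff_dim (affine hull (\<Lambda> ` ?S)) \<le> aff_dim E" by (rule aff_dim_subset[OF sub])
  ultimately have "aff_dim (affine hull (\<Lambda> ` ?S)) = aff_dim E"
    using aff_dim_subspace[OF E(1)] by simp
  moreover have "affine hull (\<Lambda> ` ?S) \<noteq> {}"
  proof
    assume "affine hull (\<Lambda> ` ?S) = {}"
    then have "?S = {}" by simp
    then show False using s1 by (simp only: sum.empty)
  qed
  ultimately have "affine hull (\<Lambda> ` ?S) = E"
    using affine_dim_equal[OF affine_affine_hull subspace_imp_affine[OF E(1)] _ sub] by blast
  then have k: "\<Lambda> k \<in> affine hull (\<Lambda> ` ?S)" using E(2) by auto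
  let ?A = "{v. (v, 1::real) \<in> span ((\<lambda>i. (\<Lambda> i, 1)) ` ?S)}"
  have "affine ?A" unfolding affine_def
  proof (intro ballI allI impI)
    fix x y and a b :: real
    assume xy: "x \<in> ?A" "y \<in> ?A" and ab: "a + b = 1"
    have "a *\<^sub>R (x, 1) + b *\<^sub>R (y, 1) \<in> span ((\<lambda>i. (\<Lambda> i, 1 :: real)) ` ?S)"
      using xy by (intro span_add span_scale) auto
    then show "a *\<^sub>R x + b *\<^sub>R y \<in> ?A" using ab by simp
  qed
  moreover have "\<Lambda> ` ?S \<subseteq> ?A" by (auto intro: span_base)
  ultimately have "affine hull (\<Lambda> ` ?S) \<subseteq> ?A" by (rule hull_minimal[rotated])
  then show ?thesis using k by blast
qed

text \<open>A last coordinate \<open>1\<close> merges the linear condition and the normalization into one equation.\<close>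

lemma homogenized_quadric_iff:
  fixes v :: "'b \<Rightarrow> 'v::real_vector" and s :: "'b \<Rightarrow> real"
  shows "(\<Sum>b\<in>S. s b *\<^sub>R (v b, 1 :: real)) = (0, 1)
    \<longleftrightarrow> (\<Sum>b\<in>S. s b *\<^sub>R v b) = 0 \<and> (\<Sum>b\<in>S. s b) = 1"
  by (simp add: prod_eq_iff fst_sum snd_sum)

text \<open>The map \<open>ix\<close> assigns to every real coordinate the index of its coefficient, with repetitions for doubled
coordinates. Summing the squares over the coordinates with a given index gives a solution of the original
equations to which \<open>weakly_hyperbolic_spanning\<close> applies.\<close>

lemma weakly_hyperbolic_coaxial_quadrics:
  fixes \<Lambda> :: "'n::finite \<Rightarrow> 'v::euclidean_space" and ix :: "'a::euclidean_space \<Rightarrow> 'n"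
  assumes wh: "weakly_hyperbolic E \<Lambda>"
  shows "coaxial_quadrics (\<lambda>b. (\<Lambda> (ix b), 1 :: real)) (0, 1)"
proof
  fix x :: 'a
  assume "(\<Sum>b\<in>Basis. (x \<bullet> b)\<^sup>2 *\<^sub>R (\<Lambda> (ix b), 1 :: real)) = (0, 1)"
  then have x: "(\<Sum>b\<in>Basis. (x \<bullet> b)\<^sup>2 *\<^sub>R \<Lambda> (ix b)) = 0" "(\<Sum>b\<in>Basis. (x \<bullet> b)\<^sup>2) = 1"
    unfolding homogenized_quadric_iff by blast+
  define r where "r i = (\<Sum>b\<in>{b\<in>Basis. ix b = i}. (x \<bullet> b)\<^sup>2)" for i
  have "(\<Sum>i\<in>UNIV. r i *\<^sub>R \<Lambda> i) = (\<Sum>i\<in>UNIV. \<Sum>b\<in>{b\<in>Basis. ix b = i}. (x \<bullet> b)\<^sup>2 *\<^sub>R \<Lambda> (ix b))"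
    by (intro sum.cong refl) (simp add: r_def scaleR_sum_left)
  also have "\<dots> = 0" unfolding x(1)[symmetric] by (rule sum.group) auto
  finally have 1: "(\<Sum>i\<in>UNIV. r i *\<^sub>R \<Lambda> i) = 0" .
  have 2: "(\<Sum>i\<in>UNIV. r i) = 1" unfolding x(2)[symmetric] r_def by (rule sum.group) auto
  have 3: "0 \<le> r i" for i by (simp add: r_def sum_nonneg)
  have "{i. r i \<noteq> 0} \<subseteq> ix ` {b\<in>Basis. x \<bullet> b \<noteq> 0}"
  proof
    fix i assume "i \<in> {i. r i \<noteq> 0}"
    then obtain b where "b \<in> {b\<in>Basis. ix b = i}" "(x \<bullet> b)\<^sup>2 \<noteq> 0"
      unfolding r_def by (auto elim: sum.not_neutral_contains_not_neutral)
    then show "i \<in> ix ` {b\<in>Basis. x \<bullet> b \<noteq> 0}" by auto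
  qed
  then have "span ((\<lambda>i. (\<Lambda> i, 1 :: real)) ` {i. r i \<noteq> 0})
      \<subseteq> span ((\<lambda>b. (\<Lambda> (ix b), 1)) ` {b\<in>Basis. x \<bullet> b \<noteq> 0})"
    by (intro span_mono) auto
  then show "(\<lambda>b. (\<Lambda> (ix b), 1 :: real)) ` Basis \<subseteq> span ((\<lambda>b. (\<Lambda> (ix b), 1)) ` {b\<in>Basis. x \<bullet> b \<noteq> 0})"
    using weakly_hyperbolic_spanning[OF wh 3 1 2] by blast
next
  have "norm x = 1" if "(\<Sum>b\<in>Basis. (x \<bullet> b)\<^sup>2) = 1" for x :: 'a
    using that by (simp add: norm_eq_sqrt_inner euclidean_inner[of x x] power2_eq_square)
  then show "bounded {x :: 'a. (\<Sum>b\<in>Basis. (x \<bullet> b)\<^sup>2 *\<^sub>R (\<Lambda> (ix b), 1 :: real)) = (0, 1)}"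
    unfolding homogenized_quadric_iff by (intro boundedI[of _ 1]) auto
qed

lemma sum_Basis_vec:
  fixes f :: "'a::euclidean_space ^ 'n::finite \<Rightarrow> 'b::comm_monoid_add"
  shows "(\<Sum>b\<in>Basis. f b) = (\<Sum>i\<in>UNIV. \<Sum>u\<in>Basis. f (axis i u))"
proof -
  have B: "(Basis :: ('a ^ 'n) set) = (\<lambda>(i, u). axis i u) ` (UNIV \<times> Basis)"
    by (auto simp: Basis_vec_def)
  have "inj_on (\<lambda>(i, u). axis i u :: 'a ^ 'n) (UNIV \<times> Basis)"
    by (auto simp: inj_on_def axis_eq_axis)
  then show ?thesis
    by (simp add: B sum.reindex sum.cartesian_product case_prod_unfold)
qed

lemma sum_Basis_prod:
  fixes f :: "'a::euclidean_space \<times> 'b::euclidean_space \<Rightarrow> 'c::comm_monoid_add"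
  shows "(\<Sum>b\<in>Basis. f b) = (\<Sum>u\<in>Basis. f (u, 0)) + (\<Sum>v\<in>Basis. f (0, v))"
proof -
  have "(\<lambda>u. (u, 0 :: 'b)) ` (Basis :: 'a set) \<inter> (\<lambda>v. (0 :: 'a, v)) ` (Basis :: 'b set) = {}" by auto
  then show ?thesis
    by (simp add: Basis_prod_def sum.union_disjoint sum.reindex inj_on_def)
qed

lemma axis_support: "u \<noteq> 0 \<Longrightarrow> (SOME k. axis i u $ k \<noteq> 0) = i"
  by (rule some_equality) (auto simp: axis_def split: if_splits)

text \<open>The axes \<open>(1, 0)\<close> of \<open>x\<^sub>0\<close> and \<open>(0, axis j 1)\<close> of \<open>x\<^sub>j\<close> have the same coefficient \<open>\<Lambda> j\<close>.\<close>

lemma open_book_Z_doubled: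
  fixes \<Lambda> :: "'n::finite \<Rightarrow> 'v::euclidean_space"
  assumes wh: "weakly_hyperbolic E \<Lambda>"
  shows "open_book_trivial_monodromy (Z_doubled \<Lambda> j) (Pair 0 ` Z_zero \<Lambda> j) (Pair 0 ` Z_plus \<Lambda> j)"
proof -
  define ix :: "real \<times> (real ^ 'n) \<Rightarrow> 'n" where
    "ix b = (if fst b = 0 then SOME k. snd b $ k \<noteq> 0 else j)" for b
  have ix: "ix (1, 0) = j" "ix (0, axis i 1) = i" for i
    by (simp_all add: ix_def axis_support)
  let ?\<nu> = "\<lambda>b. (\<Lambda> (ix b), 1 :: real)"
  let ?p = "(1, 0) :: real \<times> (real ^ 'n)" and ?q = "(0, axis j 1) :: real \<times> (real ^ 'n)"
  interpret rotational_quadrics ?\<nu> "(0, 1)" ?p ?q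
    by (intro rotational_quadrics.intro weakly_hyperbolic_coaxial_quadrics[OF wh] rotational_quadrics_axioms.intro)
      (auto simp: Basis_prod_def Basis_vec_def ix)
  have mem: "(x0, x) \<in> M \<longleftrightarrow> x0\<^sup>2 *\<^sub>R \<Lambda> j + (\<Sum>i\<in>UNIV. (x $ i)\<^sup>2 *\<^sub>R \<Lambda> i) = 0 \<and> x0\<^sup>2 + (\<Sum>i\<in>UNIV. (x $ i)\<^sup>2) = 1"
    for x0 x
    unfolding M_def Q_def mem_Collect_eq homogenized_quadric_iff
    by (simp add: sum_Basis_prod sum_Basis_vec ix inner_axis)
  have "M = Z_doubled \<Lambda> j"
  proof (rule set_eqI, clarify)
    fix x0 and x :: "real ^ 'n"
    have 1: "(\<Sum>i\<in>UNIV. (x $ i)\<^sup>2 *\<^sub>R \<Lambda> i) = (x $ j)\<^sup>2 *\<^sub>R \<Lambda> j + (\<Sum>i\<in>UNIV - {j}. (x $ i)\<^sup>2 *\<^sub>R \<Lambda> i)"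
      and 2: "(\<Sum>i\<in>UNIV. (x $ i)\<^sup>2) = (x $ j)\<^sup>2 + (\<Sum>i\<in>UNIV - {j}. (x $ i)\<^sup>2)"
      by (rule sum.remove; simp)+
    show "(x0, x) \<in> M \<longleftrightarrow> (x0, x) \<in> Z_doubled \<Lambda> j"
      unfolding mem 1 2 by (simp add: Z_doubled_def scaleR_add_left add.assoc)
  qed
  moreover have "B = Pair 0 ` Z_zero \<Lambda> j"
    by (auto simp: B_def slice_def mem inner_axis Z_zero_def Z_real_def image_iff)
  moreover have "W = Pair 0 ` Z_plus \<Lambda> j"
    by (auto simp: W_def slice_def mem inner_axis Z_plus_def Z_real_def image_iff)
  ultimately show ?thesis using open_book_trivial_monodromy_rotational by simp
qed

text \<open>Every complex coordinate already consists of two real ones with the same coefficient; rotating the plane of \<open>z\<^sub>i\<close> gives the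
open book.\<close>

lemma open_book_Z_complex:
  fixes \<Lambda> :: "'n::finite \<Rightarrow> 'v::euclidean_space"
  assumes wh: "weakly_hyperbolic E \<Lambda>"
  shows "\<exists>W. open_book_trivial_monodromy (Z_complex \<Lambda>) (Z_complex \<Lambda> \<inter> {z. z $ i = 0}) W"
proof -
  define ix :: "complex ^ 'n \<Rightarrow> 'n" where "ix b = (SOME k. b $ k \<noteq> 0)" for b
  have ix: "ix (axis k 1) = k" "ix (axis k \<i>) = k" for k
    by (simp_all add: ix_def axis_support)
  let ?\<nu> = "\<lambda>b. (\<Lambda> (ix b), 1 :: real)"
  let ?p = "axis i \<i> :: complex ^ 'n" and ?q = "axis i 1 :: complex ^ 'n"
  interpret rotational_quadrics ?\<nu> "(0, 1)" ?p ?q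
    by (intro rotational_quadrics.intro weakly_hyperbolic_coaxial_quadrics[OF wh] rotational_quadrics_axioms.intro)
      (auto simp: Basis_vec_def Basis_complex_def ix axis_eq_axis)
  have "M = Z_complex \<Lambda>"
    unfolding M_def Q_def homogenized_quadric_iff Z_complex_def
    by (simp add: sum_Basis_vec Basis_complex_def ix inner_axis cmod_power2 scaleR_add_left)
  moreover from this have "B = Z_complex \<Lambda> \<inter> {z. z $ i = 0}"
    by (auto simp: B_def slice_def inner_axis complex_eq_iff)
  ultimately show ?thesis using open_book_trivial_monodromy_rotational by auto
qed

theorem theorem1:
  fixes E :: "'v::euclidean_space set" and \<Lambda> :: "'n::finite \<Rightarrow> 'v"
  assumes "weakly_hyperbolic E \<Lambda>"
  shows "(\<forall>j. open_book_trivial_monodromy (Z_doubled \<Lambda> j)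
                (Pair 0 ` Z_zero \<Lambda> j) (Pair 0 ` Z_plus \<Lambda> j)) \<and>
         (\<forall>(P :: 'd::euclidean_space set) F \<phi> i.
            simple_polytope P \<and> F facet_of P \<and> realizes \<Lambda> \<phi> P \<and>
            \<phi> ` F = assoc_polytope \<Lambda> \<inter> {r. r $ i = 0} \<longrightarrow>
            (\<exists>W. open_book_trivial_monodromy (Z_complex \<Lambda>)
                   (Z_complex \<Lambda> \<inter> {z. z $ i = 0}) W))"
  using open_book_Z_doubled[OF assms] open_book_Z_complex[OF assms] by blast

end
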